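(* Let $0<p<\infty$ and $\mathbf w\in\mathcal W$. Suppose that $\mathcal B$ is a symmetric basic sequence of the Garling sequence space $g(\mathbf w,p)$. Then $\mathcal B$ is equivalent to the unit vector basis of $\ell_p$.
   Context: $\mathcal W$ is the set of sequences $\mathbf w=(w_j)_{j=1}^\infty\in c_0\setminus\ell_1$ with $1=w_1\ge w_2\ge\cdots>0$. $g(\mathbf w,p)$ is the quasi-Banach space of (real or complex) scalar sequences $x=(a_j)_{j=1}^\infty$ with $\|x\|_g=\sup_{\phi}\big(\sum_{j=1}^\infty|a_{\phi(j)}|^pw_j\big)^{1/p}<\infty$, the supremum being over all (strictly) increasing maps $\phi\colon\mathbb N\to\mathbb N$. A basic sequence in a quasi-Banach space is a sequence that is a Schauder basis of its closed linear span. Basic sequences $(x_j)$, $(y_j)$ (possibly in different spaces) are equivalent if $\sum a_jx_j$ converges iff $\sum a_jy_j$ does. A basic sequence $(x_j)$ is symmetric if $(x_{\pi(j)})_j$ is equivalent to $(x_j)_j$ for every permutation $\pi$ of $\mathbb N$. *)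

theory Defs
  imports "HOL-Analysis.Analysis" "HOL-Library.Function_Algebras"
begin

text \<open>
  Sequences are functions on \<^typ>\<open>nat\<close>, indexed from 0, with the pointwise vector space
  structure. A (quasi-Banach) sequence space is passed as a pair \<open>V\<close>, \<open>N\<close> of its underlying set and
  its quasi-norm; the value of \<open>N\<close> outside \<open>V\<close> carries no meaning, so the notions below are meant
  for sequences of vectors of \<open>V\<close>.
\<close>

definition seq_scale :: "'a::real_normed_field \<Rightarrow> (nat \<Rightarrow> 'a) \<Rightarrow> nat \<Rightarrow> 'a"
  where "seq_scale c x = (\<lambda>k. c * x k)"

interpretation seq: vector_space "seq_scale :: 'a::real_normed_field \<Rightarrow> _"
  by unfold_locales (auto simp: seq_scale_def fun_eq_iff algebra_simps)

definition series_converges_to ::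
  "(nat \<Rightarrow> 'a::real_normed_field) set \<Rightarrow> ((nat \<Rightarrow> 'a) \<Rightarrow> real) \<Rightarrow>
    (nat \<Rightarrow> nat \<Rightarrow> 'a) \<Rightarrow> (nat \<Rightarrow> 'a) \<Rightarrow> (nat \<Rightarrow> 'a) \<Rightarrow> bool"
  where "series_converges_to V N X a x \<longleftrightarrow>
    x \<in> V \<and> (\<lambda>n. N ((\<Sum>j<n. seq_scale (a j) (X j)) - x)) \<longlonglongrightarrow> 0"

definition series_converges ::
  "(nat \<Rightarrow> 'a::real_normed_field) set \<Rightarrow> ((nat \<Rightarrow> 'a) \<Rightarrow> real) \<Rightarrow>
    (nat \<Rightarrow> nat \<Rightarrow> 'a) \<Rightarrow> (nat \<Rightarrow> 'a) \<Rightarrow> bool"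
  where "series_converges V N X a \<longleftrightarrow> (\<exists>x. series_converges_to V N X a x)"

definition closed_span ::
  "(nat \<Rightarrow> 'a::real_normed_field) set \<Rightarrow> ((nat \<Rightarrow> 'a) \<Rightarrow> real) \<Rightarrow>
    (nat \<Rightarrow> 'a) set \<Rightarrow> (nat \<Rightarrow> 'a) set"
  where "closed_span V N S = {x \<in> V. \<forall>\<epsilon>>0. \<exists>y\<in>seq.span S. N (y - x) < \<epsilon>}"

definition schauder_basis_of ::
  "(nat \<Rightarrow> 'a::real_normed_field) set \<Rightarrow> ((nat \<Rightarrow> 'a) \<Rightarrow> real) \<Rightarrow>
    (nat \<Rightarrow> nat \<Rightarrow> 'a) \<Rightarrow> (nat \<Rightarrow> 'a) set \<Rightarrow> bool"
  where "schauder_basis_of V N X Y \<longleftrightarrow>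
    range X \<subseteq> Y \<and> (\<forall>x\<in>Y. \<exists>!a. series_converges_to V N X a x)"

definition basic_sequence ::
  "(nat \<Rightarrow> 'a::real_normed_field) set \<Rightarrow> ((nat \<Rightarrow> 'a) \<Rightarrow> real) \<Rightarrow>
    (nat \<Rightarrow> nat \<Rightarrow> 'a) \<Rightarrow> bool"
  where "basic_sequence V N X \<longleftrightarrow>
    range X \<subseteq> V \<and> schauder_basis_of V N X (closed_span V N (range X))"

definition equivalent_sequences ::
  "(nat \<Rightarrow> 'a::real_normed_field) set \<Rightarrow> ((nat \<Rightarrow> 'a) \<Rightarrow> real) \<Rightarrow> (nat \<Rightarrow> nat \<Rightarrow> 'a) \<Rightarrow>
    (nat \<Rightarrow> 'a) set \<Rightarrow> ((nat \<Rightarrow> 'a) \<Rightarrow> real) \<Rightarrow> (nat \<Rightarrow> nat \<Rightarrow> 'a) \<Rightarrow> bool"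
  where "equivalent_sequences V N X V' N' X' \<longleftrightarrow>
    (\<forall>a. series_converges V N X a \<longleftrightarrow> series_converges V' N' X' a)"

definition symmetric_basic_sequence ::
  "(nat \<Rightarrow> 'a::real_normed_field) set \<Rightarrow> ((nat \<Rightarrow> 'a) \<Rightarrow> real) \<Rightarrow>
    (nat \<Rightarrow> nat \<Rightarrow> 'a) \<Rightarrow> bool"
  where "symmetric_basic_sequence V N X \<longleftrightarrow>
    basic_sequence V N X \<and>
    (\<forall>\<pi>. bij \<pi> \<longrightarrow> equivalent_sequences V N (X \<circ> \<pi>) V N X)"

definition garling_weights :: "(nat \<Rightarrow> real) set"
  where "garling_weights =
    {w. w \<longlonglongrightarrow> 0 \<and> \<not> summable (\<lambda>j. \<bar>w j\<bar>) \<and> w 0 = 1 \<and> decseq w \<and> (\<forall>j. 0 < w j)}"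

text \<open>
  Membership in the Garling space says that the supremum defining the norm, taken in
  \<open>[0, \<infinity>]\<close>, is finite: every series involved converges and the resulting values are bounded.
\<close>

definition garling_space :: "(nat \<Rightarrow> real) \<Rightarrow> real \<Rightarrow> (nat \<Rightarrow> 'a::real_normed_field) set"
  where "garling_space w p =
    {x. (\<forall>\<phi>. strict_mono \<phi> \<longrightarrow> summable (\<lambda>j. norm (x (\<phi> j)) powr p * w j)) \<and>
        bdd_above ((\<lambda>\<phi>. (\<Sum>j. norm (x (\<phi> j)) powr p * w j) powr (1 / p)) ` {\<phi>. strict_mono \<phi>})}"

definition garling_norm :: "(nat \<Rightarrow> real) \<Rightarrow> real \<Rightarrow> (nat \<Rightarrow> 'a::real_normed_field) \<Rightarrow> real"
  where "garling_norm w p x =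
    (SUP \<phi>\<in>{\<phi>. strict_mono \<phi>}. (\<Sum>j. norm (x (\<phi> j)) powr p * w j) powr (1 / p))"

definition lp_space :: "real \<Rightarrow> (nat \<Rightarrow> 'a::real_normed_field) set"
  where "lp_space p = {x. summable (\<lambda>j. norm (x j) powr p)}"

definition lp_norm :: "real \<Rightarrow> (nat \<Rightarrow> 'a::real_normed_field) \<Rightarrow> real"
  where "lp_norm p x = (\<Sum>j. norm (x j) powr p) powr (1 / p)"

definition unit_vectors :: "nat \<Rightarrow> nat \<Rightarrow> 'a::real_normed_field"
  where "unit_vectors j = (\<lambda>k. if k = j then 1 else 0)"

text \<open>
  The scalar field is a type of sort \<open>{real_normed_field, heine_borel}\<close>. Both \<^typ>\<open>real\<close> and
  \<^typ>\<open>complex\<close> are of this sort, and by the Gelfand--Mazur theorem they are the only such fields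
  up to isometric isomorphism.
\<close>

end

theory Submission imports Defs begin

text \<open>
  The \<open>p\<close>-th power of the Garling norm of \<open>x\<close> is the supremum of \<open>\<Sum>\<^sub>i |x (k\<^sub>i)|\<^sup>p w\<^sub>i\<close> over finite increasing
  selections \<open>k\<^sub>0 < k\<^sub>1 < \<dots>\<close>, and a single selection is linear in \<open>|x|\<^sup>p\<close>. A symmetric basic sequence \<open>B\<close> is
  uniformly symmetric and unconditional, so it is equivalent to a sequence of differences
  \<open>B\<^sub>i - B\<^sub>l\<close>. By compactness these differences can be taken to be almost null on any initial segment, hence
  up to a small perturbation they are successive finite blocks \<open>z\<^sub>n\<close>, which \<open>\<ell>\<^sub>p\<close> dominates.

  Suppose first that, for some \<open>\<delta> > 0\<close> and every \<open>\<epsilon>\<close>, infinitely many blocks keep norm at least \<open>\<delta>\<close> after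
  all coordinates larger than \<open>\<epsilon>\<close> are deleted. Concatenating selections from such truncated blocks, with
  \<open>\<epsilon>\<close> tiny compared to the length already used, loses almost nothing, and this gives the lower \<open>\<ell>\<^sub>p\<close> estimate.

  Otherwise, up to small errors, the blocks have a bounded number of nonzero coordinates. Take normalised
  constant-coefficient stretches of \<open>z\<close>, each much longer and flatter than the previous ones. If the short
  stretches come first, selections can be concatenated and the norm grows with the number of stretches.
  If the long stretches come first, a selection either spends few places on the first stretch, which then
  contributes little, or so many that only negligible weights remain for the rest; so the norm stays
  bounded. This contradicts symmetry.
\<close>

section \<open>Weighted sums along increasing selections\<close>

text \<open>The hypotheses are qualitative: expansions exist and are unique, and permutations
  preserve convergence. Constants have to be extracted first: the basis constant by Baire category,
  the symmetry constant by a gliding hump, unconditionality from these two. All this takes place for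
  the power \<open>min 1 p\<close> of the quasi-norm, a subadditive functional, so that every
  \<open>p\<close> is treated in a complete metric space and without duality. Differences enter
  because nothing makes \<open>B\<close> itself coordinatewise null. Once supports are disjoint, the
  \<open>p\<close>-th power of the modulus of a combination is the combination of the
  \<open>p\<close>-th powers with nonnegative coefficients. What remains is a problem about
  nonnegative functions, posed in \<open>symmetric_blocks\<close>, where only the lower estimate is
  in doubt. The obstacle there is rank: a selection that is good for one block starts at the largest
  weight, but after concatenation it starts late. Flat blocks hardly notice this, peaked blocks lose
  almost everything, and such a dependence on the order is what symmetry forbids.\<close>

fun gsum :: "(nat \<Rightarrow> real) \<Rightarrow> (nat \<Rightarrow> real) \<Rightarrow> nat \<Rightarrow> nat list \<Rightarrow> real" where
  "gsum w u m [] = 0"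
| "gsum w u m (k # ks) = w m * u k + gsum w u (Suc m) ks"

text \<open>Finite selections stand in for infinite increasing maps: the functions of interest are
  nonnegative, so partial sums have the same supremum and no summability is involved. Boundedness is
  a separate predicate because a real-valued \<open>SUP\<close> of an unbounded set is
  meaningless.\<close>

definition gbdd :: "(nat \<Rightarrow> real) \<Rightarrow> (nat \<Rightarrow> real) \<Rightarrow> bool"
  where "gbdd w u \<longleftrightarrow> bdd_above (gsum w u 0 ` {xs. sorted_wrt (<) xs})"

definition gsup :: "(nat \<Rightarrow> real) \<Rightarrow> (nat \<Rightarrow> real) \<Rightarrow> real"
  where "gsup w u = (SUP xs\<in>{xs. sorted_wrt (<) xs}. gsum w u 0 xs)"

text \<open>The offset \<open>m\<close> exists for this identity: in a concatenation the second list
  meets only the weights that the first one has left over.\<close>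

lemma gsum_append: "gsum w u m (xs @ ys) = gsum w u m xs + gsum w u (m + length xs) ys"
  by (induction xs arbitrary: m) auto

lemma gsum_add: "gsum w (\<lambda>k. u k + v k) m xs = gsum w u m xs + gsum w v m xs"
  by (induction xs arbitrary: m) (auto simp: algebra_simps)

lemma gsum_cmult: "gsum w (\<lambda>k. c * u k) m xs = c * gsum w u m xs"
  by (induction xs arbitrary: m) (auto simp: algebra_simps)

lemma gsum_zero [simp]: "gsum w (\<lambda>k. 0) m xs = 0"
  by (induction xs arbitrary: m) auto

lemma gsum_sum: "gsum w (\<lambda>k. \<Sum>j\<in>A. f j k) m xs = (\<Sum>j\<in>A. gsum w (f j) m xs)"
  by (induction A rule: infinite_finite_induct) (auto simp: gsum_add)

lemma gsum_cong: "(\<And>k. k \<in> set xs \<Longrightarrow> u k = v k) \<Longrightarrow> gsum w u m xs = gsum w v m xs"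
  by (induction xs arbitrary: m) auto

lemma gsup_le:
  assumes "\<And>xs. sorted_wrt (<) xs \<Longrightarrow> gsum w u 0 xs \<le> M"
  shows "gsup w u \<le> M"
  unfolding gsup_def using assms by (intro cSUP_least) (auto intro: exI[of _ "[]"])

lemma gbddI:
  assumes "\<And>xs. sorted_wrt (<) xs \<Longrightarrow> gsum w u 0 xs \<le> M"
  shows "gbdd w u"
  unfolding gbdd_def bdd_above_def using assms by blast

lemma gsum_le_gsup:
  assumes "gbdd w u" "sorted_wrt (<) xs"
  shows "gsum w u 0 xs \<le> gsup w u"
  using assms unfolding gsup_def gbdd_def by (intro cSUP_upper) auto

lemma gsup_nonneg: "gbdd w u \<Longrightarrow> 0 \<le> gsup w u"
  using gsum_le_gsup[of w u "[]"] by simp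

lemma gsup_gtE:
  assumes "c < gsup w u"
  obtains xs where "sorted_wrt (<) xs" "c < gsum w u 0 xs"
  using assms gsup_le[of w u c] by (meson not_less)

section \<open>Selections against a decreasing null weight with divergent sum\<close>

locale weight =
  fixes w :: "nat \<Rightarrow> real"
  assumes w_one: "w 0 = 1" and w_dec: "decseq w" and w_pos: "\<And>j. 0 < w j"
    and w_lim: "w \<longlonglongrightarrow> 0" and w_div: "\<not> summable w"
begin

lemma w_nonneg: "0 \<le> w j"
  using w_pos[of j] by simp

lemma w_le_one: "w j \<le> 1"
  using w_dec w_one by (metis decseqD zero_le)

lemma w_antimono: "i \<le> j \<Longrightarrow> w j \<le> w i"
  using w_dec by (auto dest: decseqD)

lemma w_sum_unbounded: "\<exists>n. R < (\<Sum>i<n. w i)"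
proof (rule ccontr)
  assume "\<not> ?thesis"
  then have "\<And>n. (\<Sum>i<n. w i) \<le> R" by (auto simp: not_less)
  then have "summable w" by (intro summableI_nonneg_bounded[of w R] w_nonneg)
  with w_div show False by simp
qed

lemma gsum_nonneg: "(\<And>k. 0 \<le> u k) \<Longrightarrow> 0 \<le> gsum w u m xs"
  by (induction xs arbitrary: m) (auto simp: w_nonneg)

lemma gsum_mono: "(\<And>k. k \<in> set xs \<Longrightarrow> u k \<le> v k) \<Longrightarrow> gsum w u m xs \<le> gsum w v m xs"
  by (induction xs arbitrary: m) (auto intro!: add_mono mult_left_mono simp: w_nonneg)

lemma gsum_shift: "(\<And>k. 0 \<le> u k) \<Longrightarrow> m \<le> m' \<Longrightarrow> gsum w u m' xs \<le> gsum w u m xs"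
  by (induction xs arbitrary: m m') (auto intro!: add_mono mult_right_mono w_antimono)

text \<open>Deleting entries at which \<open>u\<close> vanishes moves the remaining ones to earlier
  ranks, where the weights are larger.\<close>

lemma gsum_filter:
  assumes "\<And>k. 0 \<le> u k" "\<And>k. k \<in> set xs \<Longrightarrow> \<not> P k \<Longrightarrow> u k = 0"
  shows "gsum w u m xs \<le> gsum w u m (filter P xs)"
  using assms(2)
proof (induction xs arbitrary: m)
  case (Cons k ks)
  then have "gsum w u (Suc m) ks \<le> gsum w u (Suc m) (filter P ks)" by simp
  also have "\<dots> \<le> gsum w u m (filter P ks)" by (rule gsum_shift) (auto simp: assms)
  finally show ?case using Cons by (cases "P k") auto
qed simp

lemma gsum_le_length:
  assumes "\<And>k. k \<in> set xs \<Longrightarrow> u k \<le> b" "0 \<le> b"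
  shows "gsum w u m xs \<le> w m * b * length xs"
  using assms(1)
proof (induction xs arbitrary: m)
  case (Cons k ks)
  have "gsum w u (Suc m) ks \<le> w (Suc m) * b * length ks" using Cons by simp
  also have "\<dots> \<le> w m * b * length ks"
    by (intro mult_right_mono w_antimono) (auto simp: assms)
  finally show ?case
    using mult_left_mono[OF Cons.prems[of k], of "w m"] w_nonneg[of m] by (simp add: algebra_simps)
qed simp

lemma gsum_le_length':
  assumes "\<And>k. k \<in> set xs \<Longrightarrow> u k \<le> b" "0 \<le> b"
  shows "gsum w u m xs \<le> b * length xs"
proof -
  have "gsum w u m xs \<le> w m * (b * length xs)"
    using gsum_le_length[OF assms, where m = m] by (simp add: mult.assoc)
  also have "\<dots> \<le> 1 * (b * length xs)"
    by (rule mult_right_mono) (auto simp: assms w_le_one)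
  finally show ?thesis by simp
qed

text \<open>This is the price of concatenation. If \<open>m\<close> ranks are already occupied, the
  first \<open>m\<close> entries of a new selection are sacrificed so that the others keep their
  ranks; each sacrificed entry is worth at most \<open>b\<close>.\<close>

lemma gsum_drop:
  assumes "\<And>k. k \<in> set xs \<Longrightarrow> u k \<le> b" "0 \<le> b"
  shows "gsum w u 0 xs - b * m \<le> gsum w u m (drop m xs)"
proof (cases "m \<le> length xs")
  case True
  have "gsum w u 0 xs = gsum w u 0 (take m xs) + gsum w u m (drop m xs)"
    using gsum_append[of w u 0 "take m xs" "drop m xs"] True by simp
  moreover have "gsum w u 0 (take m xs) \<le> b * length (take m xs)"
    by (rule gsum_le_length') (use assms in \<open>auto dest: in_set_takeD\<close>)
  moreover have "length (take m xs) = m" using True by simp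
  ultimately show ?thesis by simp
next
  case False
  have "gsum w u 0 xs \<le> b * length xs" by (rule gsum_le_length') (use assms in auto)
  also have "\<dots> \<le> b * m" using False assms by (intro mult_left_mono) auto
  finally show ?thesis using False by simp
qed

lemma gsum_ge_length:
  assumes "\<And>k. k \<in> set xs \<Longrightarrow> b \<le> u k"
  shows "b * (\<Sum>i<length xs. w (m + i)) \<le> gsum w u m xs"
  using assms
proof (induction xs arbitrary: m)
  case (Cons k ks)
  have "b * (\<Sum>i<length ks. w (Suc m + i)) \<le> gsum w u (Suc m) ks"
    by (rule Cons.IH) (use Cons.prems in simp)
  moreover have "w m * b \<le> w m * u k" using Cons.prems[of k] by (intro mult_left_mono w_nonneg) simp
  ultimately show ?case by (simp add: sum.lessThan_Suc_shift algebra_simps del: sum.lessThan_Suc)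
qed simp

lemma gsum_le_card:
  assumes "distinct xs" "finite H" "\<And>k. 0 \<le> u k" "\<And>k. u k \<le> b" "\<And>k. k \<notin> H \<Longrightarrow> u k = 0" "0 \<le> b"
  shows "gsum w u m xs \<le> w m * b * card H"
proof -
  have "gsum w u m xs \<le> gsum w u m (filter (\<lambda>k. k \<in> H) xs)"
    by (rule gsum_filter) (use assms in auto)
  also have "\<dots> \<le> w m * b * length (filter (\<lambda>k. k \<in> H) xs)"
    by (rule gsum_le_length) (use assms in auto)
  also have "length (filter (\<lambda>k. k \<in> H) xs) = card (set (filter (\<lambda>k. k \<in> H) xs))"
    using assms(1) by (simp only: distinct_card distinct_filter)
  also have "\<dots> \<le> card H" by (rule card_mono) (use assms in auto)
  finally show ?thesis using w_nonneg[of m] assms by (meson mult_left_mono mult_nonneg_nonneg of_nat_mono order_trans)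
qed

lemma strict_sorted_distinct: "sorted_wrt (<) (xs::nat list) \<Longrightarrow> distinct xs"
  using strict_sorted_iff by blast

lemma gbdd_finite:
  assumes "finite {k. u k \<noteq> 0}" "\<And>k. 0 \<le> u k"
  shows "gbdd w u"
proof (rule gbddI)
  define b where "b = (\<Sum>k | u k \<noteq> 0. u k)"
  have b: "u k \<le> b" for k
    using assms unfolding b_def by (cases "u k = 0") (auto intro: member_le_sum sum_nonneg)
  have "0 \<le> b" using b[of 0] assms(2)[of 0] by linarith
  fix xs :: "nat list" assume "sorted_wrt (<) xs"
  then show "gsum w u 0 xs \<le> w 0 * b * card {k. u k \<noteq> 0}"
    by (intro gsum_le_card) (use assms b \<open>0 \<le> b\<close> in \<open>auto dest: strict_sorted_distinct\<close>)
qed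

lemma gbdd_mono:
  assumes "gbdd w v" "\<And>k. u k \<le> v k"
  shows "gbdd w u"
  by (rule gbddI[of _ _ "gsup w v"])
     (use assms in \<open>blast intro: order_trans[OF gsum_mono] gsum_le_gsup\<close>)

lemma gsup_mono:
  assumes "gbdd w v" "\<And>k. u k \<le> v k"
  shows "gsup w u \<le> gsup w v"
  by (rule gsup_le) (use assms in \<open>blast intro: order_trans[OF gsum_mono] gsum_le_gsup\<close>)

lemma gbdd_add: "gbdd w u \<Longrightarrow> gbdd w v \<Longrightarrow> gbdd w (\<lambda>k. u k + v k)"
  by (rule gbddI[of _ _ "gsup w u + gsup w v"]) (auto simp: gsum_add intro!: add_mono gsum_le_gsup)

lemma gsup_add: "gbdd w u \<Longrightarrow> gbdd w v \<Longrightarrow> gsup w (\<lambda>k. u k + v k) \<le> gsup w u + gsup w v"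
  by (rule gsup_le) (auto simp: gsum_add intro!: add_mono gsum_le_gsup)

lemma gbdd_cmult: "gbdd w u \<Longrightarrow> 0 \<le> c \<Longrightarrow> gbdd w (\<lambda>k. c * u k)"
  by (rule gbddI[of _ _ "c * gsup w u"]) (auto simp: gsum_cmult intro!: mult_left_mono gsum_le_gsup)

lemma gsup_cmult:
  assumes "gbdd w u" "0 \<le> c"
  shows "gsup w (\<lambda>k. c * u k) = c * gsup w u"
proof (rule antisym)
  show "gsup w (\<lambda>k. c * u k) \<le> c * gsup w u"
    by (rule gsup_le) (use assms in \<open>auto simp: gsum_cmult intro!: mult_left_mono gsum_le_gsup\<close>)
  show "c * gsup w u \<le> gsup w (\<lambda>k. c * u k)"
  proof (cases "c = 0")
    case True
    then show ?thesis using gsup_nonneg[OF gbdd_cmult[OF assms]] by simp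
  next
    case False
    then have "c > 0" using assms by simp
    have "gsup w u \<le> gsup w (\<lambda>k. c * u k) / c"
    proof (rule gsup_le)
      fix xs :: "nat list" assume "sorted_wrt (<) xs"
      then show "gsum w u 0 xs \<le> gsup w (\<lambda>k. c * u k) / c"
        using gsum_le_gsup[OF gbdd_cmult[OF assms], of xs] \<open>c > 0\<close>
        by (simp add: gsum_cmult pos_le_divide_eq mult.commute)
    qed
    then show ?thesis using \<open>c > 0\<close> by (simp add: pos_le_divide_eq mult.commute)
  qed
qed

lemma le_gsup: "gbdd w u \<Longrightarrow> u k \<le> gsup w u"
  using gsum_le_gsup[of w u "[k]"] by (simp add: w_one)

end

section \<open>Symmetric block sequences\<close>

text \<open>Here \<open>\<zeta> n\<close> stands for the \<open>p\<close>-th power of the modulus of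
  the \<open>n\<close>-th block and \<open>t j\<close> for that of a scalar coefficient. In
  \<open>symm\<close> the placements need only be injective, so the same coefficients may be laid
  out in any order on any blocks.\<close>

locale symmetric_blocks = weight +
  fixes \<zeta> :: "nat \<Rightarrow> nat \<Rightarrow> real" and K :: "nat \<Rightarrow> nat" and M c0 C :: real
  assumes z_nonneg: "\<And>n k. 0 \<le> \<zeta> n k"
    and z_supp: "\<And>n k. \<zeta> n k \<noteq> 0 \<Longrightarrow> K n \<le> k \<and> k < K (Suc n)"
    and K_mono: "mono K"
    and z_upper: "\<And>n. gsup w (\<zeta> n) \<le> M"
    and z_lower: "\<And>n. c0 \<le> gsup w (\<zeta> n)"
    and c0_pos: "0 < c0"
    and C_ge_1: "1 \<le> C"
    and symm: "\<And>(A :: nat set) \<sigma> \<tau> t. finite A \<Longrightarrow> inj_on \<sigma> A \<Longrightarrow> inj_on \<tau> A \<Longrightarrow> (\<And>j. 0 \<le> t j) \<Longrightarrow>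
      gsup w (\<lambda>k. \<Sum>j\<in>A. t j * \<zeta> (\<sigma> j) k) \<le> C * gsup w (\<lambda>k. \<Sum>j\<in>A. t j * \<zeta> (\<tau> j) k)"
begin

lemma z_finite: "finite {k. \<zeta> n k \<noteq> 0}"
  by (rule finite_subset[of _ "{..<K (Suc n)}"]) (use z_supp in auto)

lemma z_gbdd: "gbdd w (\<zeta> n)"
  by (rule gbdd_finite) (auto simp: z_finite z_nonneg)

lemma sum_z_nonneg: "(\<And>j. j \<in> A \<Longrightarrow> 0 \<le> t j) \<Longrightarrow> 0 \<le> (\<Sum>j\<in>A. t j * \<zeta> (\<sigma> j) k)"
  by (intro sum_nonneg mult_nonneg_nonneg z_nonneg)

lemma sum_z_gbdd:
  assumes "finite A" "\<And>j. j \<in> A \<Longrightarrow> 0 \<le> t j"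
  shows "gbdd w (\<lambda>k. \<Sum>j\<in>A. t j * \<zeta> (\<sigma> j) k)"
proof (rule gbdd_finite)
  have "{k. (\<Sum>j\<in>A. t j * \<zeta> (\<sigma> j) k) \<noteq> 0} \<subseteq> (\<Union>j\<in>A. {k. \<zeta> (\<sigma> j) k \<noteq> 0})"
    by (auto elim!: sum.not_neutral_contains_not_neutral)
  then show "finite {k. (\<Sum>j\<in>A. t j * \<zeta> (\<sigma> j) k) \<noteq> 0}"
    by (rule finite_subset) (use assms z_finite in auto)
qed (rule sum_z_nonneg[OF assms(2)])

lemma z_le_M: "\<zeta> n k \<le> M"
  using le_gsup[OF z_gbdd] z_upper order_trans by blast

lemma M_pos: "0 < M"
  using z_lower[of 0] z_upper[of 0] c0_pos by linarith

lemma z_disjoint: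
  assumes "\<zeta> n k \<noteq> 0" "m \<noteq> n" shows "\<zeta> m k = 0"
proof (rule ccontr)
  assume "\<zeta> m k \<noteq> 0"
  with assms have "k < K (Suc n)" "K n \<le> k" "k < K (Suc m)" "K m \<le> k" using z_supp by blast+
  moreover have "K (Suc n) \<le> K m \<or> K (Suc m) \<le> K n"
    using assms(2) monoD[OF K_mono, of "Suc n" m] monoD[OF K_mono, of "Suc m" n] by linarith
  ultimately show False by linarith
qed

section \<open>First alternative: blocks that keep norm after truncation\<close>

definition small :: "real \<Rightarrow> nat \<Rightarrow> nat \<Rightarrow> real"
  where "small \<epsilon> n k = (if \<zeta> n k \<le> \<epsilon> then \<zeta> n k else 0)"

lemma small_nonneg: "0 \<le> small \<epsilon> n k" by (simp add: small_def z_nonneg)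
lemma small_le: "small \<epsilon> n k \<le> \<zeta> n k" by (simp add: small_def z_nonneg)
lemma small_le_eps: "0 \<le> \<epsilon> \<Longrightarrow> small \<epsilon> n k \<le> \<epsilon>" by (simp add: small_def)
lemma small_gbdd: "gbdd w (small \<epsilon> n)"
  by (rule gbdd_mono[OF z_gbdd small_le])

text \<open>Since \<open>gsum\<close> is linear in the function, one selection \<open>xs\<close> can
  serve all coefficients \<open>t\<close> at once. It is built block by block, so
  \<open>\<sigma>\<close> and \<open>xs\<close> are fixed before \<open>t\<close> is known.\<close>

lemma lower_lp_initial:
  fixes L :: nat
  assumes d: "0 < \<delta>" and H: "\<And>\<epsilon> N. 0 < \<epsilon> \<Longrightarrow> \<exists>n\<ge>N. \<delta> \<le> gsup w (small \<epsilon> n)"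
  shows "\<exists>\<sigma> N xs. inj_on \<sigma> {..<L} \<and> \<sigma> ` {..<L} \<subseteq> {..<N} \<and> sorted_wrt (<) xs \<and> set xs \<subseteq> {..<K N} \<and>
     (\<forall>t. (\<forall>j. 0 \<le> t j) \<longrightarrow> \<delta> / 4 * (\<Sum>j<L. t j) \<le> gsum w (\<lambda>k. \<Sum>j<L. t j * \<zeta> (\<sigma> j) k) 0 xs)"
proof (induction L)
  case 0
  show ?case by (intro exI[of _ id] exI[of _ 0] exI[of _ "[]"]) auto
next
  case (Suc L)
  then obtain \<sigma> N xs where IH: "inj_on \<sigma> {..<L}" "\<sigma> ` {..<L} \<subseteq> {..<N}" "sorted_wrt (<) xs"
    "set xs \<subseteq> {..<K N}" and
    IHs: "\<And>t. (\<And>j. 0 \<le> t j) \<Longrightarrow> \<delta> / 4 * (\<Sum>j<L. t j) \<le> gsum w (\<lambda>k. \<Sum>j<L. t j * \<zeta> (\<sigma> j) k) 0 xs"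
    by blast
  define m where "m = length xs"
  \<comment> \<open>The \<open>m\<close> ranks used by \<open>xs\<close> then cost at most
    \<open>\<delta> / 4\<close>, out of the \<open>\<delta> / 2\<close> secured by a nearly optimal
    selection.\<close>
  define \<epsilon> where "\<epsilon> = \<delta> / (4 * (real m + 1))"
  have e: "0 < \<epsilon>" "\<epsilon> * m \<le> \<delta> / 4" using d by (auto simp: \<epsilon>_def field_simps)
  obtain n where n: "n \<ge> N" "\<delta> \<le> gsup w (small \<epsilon> n)" using H[OF e(1)] by blast
  then have "\<delta> / 2 < gsup w (small \<epsilon> n)" using d by linarith
  then obtain ys where ys: "sorted_wrt (<) ys" "\<delta> / 2 < gsum w (small \<epsilon> n) 0 ys" by (rule gsup_gtE)
  \<comment> \<open>Restricting to the support interval of block \<open>n\<close> loses nothing by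
    \<open>gsum_filter\<close> and places the new entries beyond all of \<open>xs\<close>.\<close>
  define zs where "zs = filter (\<lambda>k. K n \<le> k \<and> k < K (Suc n)) ys"
  have zs: "sorted_wrt (<) zs" unfolding zs_def by (simp add: ys sorted_wrt_filter)
  have "gsum w (small \<epsilon> n) 0 ys \<le> gsum w (small \<epsilon> n) 0 zs" unfolding zs_def
    by (rule gsum_filter) (use z_supp in \<open>auto simp: small_def z_nonneg\<close>)
  moreover have "gsum w (small \<epsilon> n) 0 zs - \<epsilon> * m \<le> gsum w (small \<epsilon> n) m (drop m zs)"
    by (rule gsum_drop) (use e small_le_eps in auto)
  ultimately have "\<delta> / 4 \<le> gsum w (small \<epsilon> n) m (drop m zs)" using ys e by linarith
  also have "\<dots> \<le> gsum w (\<zeta> n) m (drop m zs)" by (rule gsum_mono) (rule small_le)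
  finally have main: "\<delta> / 4 \<le> gsum w (\<zeta> n) m (drop m zs)" .
  have dz: "set (drop m zs) \<subseteq> {K n..<K (Suc n)}"
    using set_drop_subset[of m zs] by (auto simp: zs_def)
  have KNn: "K N \<le> K n" "K n \<le> K (Suc n)" using n by (auto intro!: monoD[OF K_mono])
  let ?\<sigma> = "\<sigma>(L := n)" and ?xs = "xs @ drop m zs"
  have "inj_on ?\<sigma> {..<Suc L}"
  proof -
    have "n \<notin> \<sigma> ` {..<L}" using IH(2) n by auto
    then show ?thesis unfolding lessThan_Suc using inj_on_fun_updI[OF IH(1)] by auto
  qed
  moreover have "?\<sigma> ` {..<Suc L} \<subseteq> {..<Suc n}"
  proof (intro image_subsetI)
    fix j assume "j \<in> {..<Suc L}"
    then show "?\<sigma> j \<in> {..<Suc n}" using subsetD[OF IH(2) imageI[of j]] n by (cases "j = L") auto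
  qed
  moreover have "sorted_wrt (<) ?xs"
    unfolding sorted_wrt_append
  proof (intro conjI ballI)
    show "sorted_wrt (<) (drop m zs)" using zs by (rule sorted_wrt_drop)
    fix x y assume "x \<in> set xs" "y \<in> set (drop m zs)"
    then have "x < K N" "K n \<le> y" using IH(4) dz by auto
    then show "x < y" using KNn by linarith
  qed (rule IH(3))
  moreover have "set ?xs \<subseteq> {..<K (Suc n)}"
  proof -
    have "set xs \<subseteq> {..<K (Suc n)}" using IH(4) KNn by (meson lessThan_subset_iff order_trans)
    moreover have "set (drop m zs) \<subseteq> {..<K (Suc n)}" using dz by auto
    ultimately show ?thesis by simp
  qed
  moreover have "\<delta> / 4 * (\<Sum>j<Suc L. t j) \<le> gsum w (\<lambda>k. \<Sum>j<Suc L. t j * \<zeta> (?\<sigma> j) k) 0 ?xs"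
    if t: "\<forall>j. 0 \<le> t j" for t
  proof -
    have eq: "(\<lambda>k. \<Sum>j<Suc L. t j * \<zeta> (?\<sigma> j) k) = (\<lambda>k. (\<Sum>j<L. t j * \<zeta> (\<sigma> j) k) + t L * \<zeta> n k)"
      by (auto intro!: sum.cong)
    have "gsum w (\<lambda>k. t L * \<zeta> n k) m (drop m zs) \<ge> t L * (\<delta> / 4)"
      unfolding gsum_cmult using main t by (intro mult_left_mono) auto
    moreover have "gsum w (\<lambda>k. t L * \<zeta> n k) 0 xs \<ge> 0"
      by (rule gsum_nonneg) (use t z_nonneg in auto)
    moreover have "gsum w (\<lambda>k. \<Sum>j<L. t j * \<zeta> (\<sigma> j) k) m (drop m zs) \<ge> 0"
      by (rule gsum_nonneg) (rule sum_z_nonneg, use t in auto)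
    ultimately show ?thesis using IHs[of t] t
      by (simp only: eq gsum_add gsum_append m_def[symmetric] sum.lessThan_Suc add_0 distrib_left)
         (simp add: algebra_simps)
  qed
  ultimately show ?case by blast
qed

text \<open>The previous lemma speaks of specially chosen, sparse blocks; symmetry carries its
  estimate to the blocks indexed by \<open>A\<close> at the cost of \<open>C\<close>.\<close>

lemma lower_lp:
  assumes d: "0 < \<delta>" and H: "\<And>\<epsilon> N. 0 < \<epsilon> \<Longrightarrow> \<exists>n\<ge>N. \<delta> \<le> gsup w (small \<epsilon> n)"
    and A: "finite A" and t: "\<And>j. 0 \<le> t j"
  shows "\<delta> / (4 * C) * (\<Sum>j\<in>A. t j) \<le> gsup w (\<lambda>k. \<Sum>j\<in>A. t j * \<zeta> j k)"
proof -
  obtain h where h: "bij_betw h {..<card A} A"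
    using ex_bij_betw_nat_finite[OF A] by (auto simp: atLeast0LessThan)
  obtain \<sigma> xs where s: "inj_on \<sigma> {..<card A}" "sorted_wrt (<) xs"
    "\<And>t. (\<And>j. 0 \<le> t j) \<Longrightarrow> \<delta> / 4 * (\<Sum>j<card A. t j) \<le> gsum w (\<lambda>k. \<Sum>j<card A. t j * \<zeta> (\<sigma> j) k) 0 xs"
    using lower_lp_initial[OF d H, of "card A"] by blast
  have "\<delta> / 4 * (\<Sum>j\<in>A. t j) = \<delta> / 4 * (\<Sum>j<card A. t (h j))"
    by (simp add: sum.reindex_bij_betw[OF h])
  also have "\<dots> \<le> gsum w (\<lambda>k. \<Sum>j<card A. t (h j) * \<zeta> (\<sigma> j) k) 0 xs" by (rule s(3)) (rule t)
  also have "\<dots> \<le> gsup w (\<lambda>k. \<Sum>j<card A. t (h j) * \<zeta> (\<sigma> j) k)"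
    by (intro gsum_le_gsup sum_z_gbdd s) (auto simp: t)
  also have "\<dots> \<le> C * gsup w (\<lambda>k. \<Sum>j<card A. t (h j) * \<zeta> (h j) k)"
    by (rule symm) (use s t h in \<open>auto simp: bij_betw_def\<close>)
  also have "(\<lambda>k. \<Sum>j<card A. t (h j) * \<zeta> (h j) k) = (\<lambda>k. \<Sum>j\<in>A. t j * \<zeta> j k)"
    by (rule ext, rule sum.reindex_bij_betw[OF h])
  finally show ?thesis using C_ge_1 by (simp add: field_simps)
qed

section \<open>Second alternative: blocks with boundedly many essential coordinates\<close>

lemma card_large:
  assumes "0 < \<epsilon>"
  shows "\<exists>h. \<forall>n. card {k. \<epsilon> < \<zeta> n k} \<le> h"
proof -
  obtain h where h: "M / \<epsilon> < (\<Sum>i<h. w i)" using w_sum_unbounded by blast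
  have "card {k. \<epsilon> < \<zeta> n k} \<le> h" for n
  proof (rule ccontr)
    let ?S = "{k. \<epsilon> < \<zeta> n k}"
    assume "\<not> ?thesis"
    then have c: "h \<le> card ?S" by simp
    have f: "finite ?S" by (rule finite_subset[OF _ z_finite[of n]]) (use assms in auto)
    define xs where "xs = sorted_list_of_set ?S"
    have xs: "sorted_wrt (<) xs" "set xs = ?S" "length xs = card ?S" by (auto simp: xs_def f)
    have "M < \<epsilon> * (\<Sum>i<h. w i)" using h assms by (simp add: field_simps)
    also have "\<dots> \<le> \<epsilon> * (\<Sum>i<length xs. w (0 + i))"
      using c xs assms by (auto intro!: mult_left_mono sum_mono2 w_nonneg)
    also have "\<dots> \<le> gsum w (\<zeta> n) 0 xs" by (rule gsum_ge_length) (use xs in auto)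
    also have "\<dots> \<le> M" using gsum_le_gsup[OF z_gbdd xs(1)] z_upper order_trans by blast
    finally show False by simp
  qed
  then show ?thesis by blast
qed

text \<open>A block whose truncation has norm below \<open>c0\<close> must have a coordinate above
  \<open>\<epsilon>\<close>. Selecting one such coordinate from each of many successive blocks
  collects \<open>\<epsilon>\<close> times a partial sum of the divergent weight.\<close>

lemma initial_unbounded:
  assumes H: "\<And>\<delta>. 0 < \<delta> \<Longrightarrow> \<exists>\<epsilon>>0. \<exists>N. \<forall>n\<ge>N. gsup w (small \<epsilon> n) < \<delta>"
  shows "\<exists>N>0. R < gsup w (\<lambda>k. \<Sum>j<N. \<zeta> j k)"
proof -
  obtain \<epsilon> N where e: "0 < \<epsilon>" "\<And>n. n \<ge> N \<Longrightarrow> gsup w (small \<epsilon> n) < c0" using H[OF c0_pos] by blast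
  have "\<exists>k. \<epsilon> < \<zeta> n k" if "n \<ge> N" for n
  proof (rule ccontr)
    assume "\<not> ?thesis"
    then have "small \<epsilon> n = \<zeta> n" by (auto simp: small_def fun_eq_iff not_less)
    then show False using e(2)[OF that] z_lower[of n] by simp
  qed
  then obtain \<kappa> where k: "\<And>n. n \<ge> N \<Longrightarrow> \<epsilon> < \<zeta> n (\<kappa> n)" by metis
  then have k_in: "K n \<le> \<kappa> n \<and> \<kappa> n < K (Suc n)" if "n \<ge> N" for n
    using z_supp[of n "\<kappa> n"] e(1) that by fastforce
  obtain h where h: "R / \<epsilon> < (\<Sum>i<h. w i)" using w_sum_unbounded by blast
  define xs where "xs = map \<kappa> [N..<N+Suc h]"
  have xs: "sorted_wrt (<) xs" unfolding xs_def sorted_wrt_map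
  proof (rule sorted_wrt_mono_rel[OF _ sorted_wrt_upt])
    fix x y assume "x \<in> set [N..<N+Suc h]" "y \<in> set [N..<N+Suc h]" "x < y"
    then have "\<kappa> x < K (Suc x)" "K (Suc x) \<le> K y" "K y \<le> \<kappa> y"
      using k_in by (auto intro!: monoD[OF K_mono])
    then show "\<kappa> x < \<kappa> y" by linarith
  qed
  have "R < \<epsilon> * (\<Sum>i<h. w i)" using h e by (simp add: field_simps)
  also have "\<dots> \<le> \<epsilon> * (\<Sum>i<length xs. w (0 + i))"
    using e by (auto simp: xs_def intro!: mult_left_mono sum_mono2 w_nonneg)
  also have "\<dots> \<le> gsum w (\<lambda>k. \<Sum>j<N+Suc h. \<zeta> j k) 0 xs"
  proof (rule gsum_ge_length)
    fix l assume "l \<in> set xs"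
    then obtain n where n: "n \<ge> N" "n < N + Suc h" "l = \<kappa> n" unfolding xs_def by (auto simp del: upt_Suc)
    have "\<epsilon> \<le> \<zeta> n l" using k n by (simp add: less_imp_le)
    also have "\<dots> \<le> (\<Sum>j<N+Suc h. \<zeta> j l)" by (rule member_le_sum) (use n z_nonneg in auto)
    finally show "\<epsilon> \<le> (\<Sum>j<N+Suc h. \<zeta> j l)" .
  qed
  also have "\<dots> \<le> gsup w (\<lambda>k. \<Sum>j<N+Suc h. \<zeta> j k)"
    using sum_z_gbdd[of "{..<N+Suc h}" "\<lambda>_. 1" id] by (intro gsum_le_gsup xs) auto
  finally show ?thesis by (intro exI[of _ "N + Suc h"]) auto
qed

text \<open>Coefficients form a list so that rearrangement is equality of multisets, and the start
  \<open>s\<close> is free so that a combination can be moved arbitrarily far out.\<close>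

definition comb :: "nat \<Rightarrow> real list \<Rightarrow> nat \<Rightarrow> real"
  where "comb s \<alpha> = (\<lambda>k. \<Sum>j<length \<alpha>. \<alpha> ! j * \<zeta> (s + j) k)"

lemma comb_nonneg: "(\<And>a. a \<in> set \<alpha> \<Longrightarrow> 0 \<le> a) \<Longrightarrow> 0 \<le> comb s \<alpha> k"
  unfolding comb_def by (intro sum_z_nonneg) auto

lemma comb_gbdd: "(\<And>a. a \<in> set \<alpha> \<Longrightarrow> 0 \<le> a) \<Longrightarrow> gbdd w (comb s \<alpha>)"
  unfolding comb_def by (rule sum_z_gbdd) auto

lemma comb_append: "comb s (\<alpha> @ \<beta>) k = comb s \<alpha> k + comb (s + length \<alpha>) \<beta> k"
proof -
  have "comb s (\<alpha> @ \<beta>) k = (\<Sum>j\<in>{..<length \<alpha>} \<union> {length \<alpha>..<length \<alpha> + length \<beta>}. (\<alpha> @ \<beta>) ! j * \<zeta> (s + j) k)"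
    unfolding comb_def by (rule sum.cong) auto
  also have "\<dots> = (\<Sum>j<length \<alpha>. (\<alpha> @ \<beta>) ! j * \<zeta> (s + j) k) +
      (\<Sum>j=0+length \<alpha>..<length \<beta>+length \<alpha>. (\<alpha> @ \<beta>) ! j * \<zeta> (s + j) k)"
    by (subst sum.union_disjoint) (auto simp: add.commute)
  also have "\<dots> = comb s \<alpha> k + comb (s + length \<alpha>) \<beta> k"
    unfolding sum.shift_bounds_nat_ivl comb_def
    by (auto simp: nth_append atLeast0LessThan algebra_simps intro!: arg_cong2[of _ _ _ _ "(+)"] sum.cong)
  finally show ?thesis .
qed

lemma comb_replicate: "comb s (replicate N b) k = b * (\<Sum>j<N. \<zeta> (s + j) k)"
  unfolding comb_def by (auto simp: sum_distrib_left intro!: sum.cong)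

lemma comb_supp:
  assumes "comb s \<alpha> k \<noteq> 0" shows "K s \<le> k \<and> k < K (s + length \<alpha>)"
proof -
  obtain j where j: "j < length \<alpha>" "\<zeta> (s + j) k \<noteq> 0"
    using assms unfolding comb_def by (auto elim!: sum.not_neutral_contains_not_neutral)
  then have "K (s + j) \<le> k" "k < K (Suc (s + j))" using z_supp by blast+
  moreover have "K s \<le> K (s + j)" "K (Suc (s + j)) \<le> K (s + length \<alpha>)"
    using j by (auto intro!: monoD[OF K_mono])
  ultimately show ?thesis by linarith
qed

lemma comb_symm:
  assumes "mset \<alpha> = mset \<beta>" "\<And>a. a \<in> set \<alpha> \<Longrightarrow> 0 \<le> a"
  shows "gsup w (comb s \<alpha>) \<le> C * gsup w (comb s' \<beta>)"
proof -
  obtain p where p: "p permutes {..<length \<beta>}" "permute_list p \<beta> = \<alpha>"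
    using mset_eq_permutation[OF assms(1)] .
  \<comment> \<open>The value 0 outside the list meets the demand of \<open>symm\<close> that
    \<open>t\<close> be nonnegative everywhere.\<close>
  define t where "t j = (if j < length \<beta> then \<beta> ! j else 0)" for j
  have len: "length \<alpha> = length \<beta>" using assms(1) by (rule mset_eq_length)
  \<comment> \<open>The terms are renumbered by their positions in \<open>\<beta>\<close>: the
    coefficient \<open>\<beta> ! j\<close> sits at position \<open>inv p j\<close> of
    \<open>\<alpha>\<close>.\<close>
  have c1: "comb s \<alpha> = (\<lambda>k. \<Sum>j<length \<beta>. t j * \<zeta> (s + inv p j) k)"
  proof
    fix k
    have "comb s \<alpha> k = (\<Sum>j<length \<beta>. \<beta> ! p j * \<zeta> (s + inv p (p j)) k)"
      unfolding comb_def len using p permutes_inverses(2)[OF p(1)]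
      by (intro sum.cong) (auto simp: permute_list_nth)
    also have "\<dots> = (\<Sum>j<length \<beta>. \<beta> ! j * \<zeta> (s + inv p j) k)"
      by (rule sum.reindex_bij_betw[OF permutes_imp_bij[OF p(1)], of "\<lambda>j. \<beta> ! j * \<zeta> (s + inv p j) k"])
    finally show "comb s \<alpha> k = (\<Sum>j<length \<beta>. t j * \<zeta> (s + inv p j) k)" by (simp add: t_def)
  qed
  have c2: "comb s' \<beta> = (\<lambda>k. \<Sum>j<length \<beta>. t j * \<zeta> (s' + j) k)"
    by (simp add: comb_def t_def)
  have i1: "inj_on (\<lambda>j. s + inv p j) {..<length \<beta>}"
    using permutes_inj[OF permutes_inv[OF p(1)]] by (auto simp: inj_on_def)
  have t: "0 \<le> t j" for j
    using assms mset_eq_setD[OF assms(1)] by (auto simp: t_def)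
  have i2: "inj_on (\<lambda>j. s' + j) {..<length \<beta>}" by (auto simp: inj_on_def)
  show ?thesis
    unfolding c1 c2 by (rule symm[OF finite_lessThan i1 i2 t])
qed

end

context symmetric_blocks
begin

text \<open>This is where \<open>w \<longlonglongrightarrow> 0\<close> enters. Far out, a block
  consists of a remainder of negligible norm and of at most \<open>h\<close> coordinates above
  \<open>\<epsilon>\<close>; selected from rank \<open>m\<close> on, the latter give at most
  \<open>w m * M * h\<close>. For fixed \<open>\<beta>\<close> the threshold \<open>m\<close> is
  uniform in the start \<open>s\<close>.\<close>

lemma gsum_small_tail:
  assumes H: "\<And>\<delta>. 0 < \<delta> \<Longrightarrow> \<exists>\<epsilon>>0. \<exists>N. \<forall>n\<ge>N. gsup w (small \<epsilon> n) < \<delta>"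
    and pos: "\<And>a. a \<in> set \<beta> \<Longrightarrow> 0 \<le> a" and e: "0 < \<eta>"
  shows "\<exists>m s0. \<forall>s\<ge>s0. \<forall>m'\<ge>m. \<forall>xs. sorted_wrt (<) xs \<longrightarrow> gsum w (comb s \<beta>) m' xs \<le> \<eta>"
proof -
  \<comment> \<open>The summand 1 keeps \<open>S\<close> positive when \<open>\<beta>\<close> is
    empty or zero.\<close>
  define S where "S = sum_list \<beta> + 1"
  have S: "1 \<le> S" using pos by (simp add: S_def sum_list_nonneg)
  obtain \<epsilon> s0 where eps: "0 < \<epsilon>" "\<And>n. n \<ge> s0 \<Longrightarrow> gsup w (small \<epsilon> n) < \<eta> / (2 * S)"
    using H[of "\<eta> / (2 * S)"] e S by auto
  obtain h where h: "\<And>n. card {k. \<epsilon> < \<zeta> n k} \<le> h" using card_large[OF eps(1)] by blast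
  define q where "q = \<eta> / (2 * S * M * (real h + 1))"
  have q: "0 < q" using e S M_pos by (simp add: q_def)
  obtain m where m: "w m < q"
    using order_tendstoD(2)[OF w_lim q] by (auto simp: eventually_sequentially)
  have one: "gsum w (\<zeta> n) m' xs \<le> \<eta> / S" if n: "n \<ge> s0" and m': "m' \<ge> m" and xs: "sorted_wrt (<) xs" for n m' xs
  proof -
    let ?big = "\<lambda>k. if \<zeta> n k \<le> \<epsilon> then 0 else \<zeta> n k"
    have fin: "finite {k. \<epsilon> < \<zeta> n k}" by (rule finite_subset[OF _ z_finite[of n]]) (use eps in auto)
    have "\<zeta> n = (\<lambda>k. small \<epsilon> n k + ?big k)" by (auto simp: small_def)
    then have "gsum w (\<zeta> n) m' xs = gsum w (small \<epsilon> n) m' xs + gsum w ?big m' xs"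
      by (metis gsum_add)
    moreover have "gsum w (small \<epsilon> n) m' xs \<le> \<eta> / (2 * S)"
    proof -
      have "gsum w (small \<epsilon> n) m' xs \<le> gsum w (small \<epsilon> n) 0 xs"
        by (rule gsum_shift) (auto simp: small_nonneg)
      also have "\<dots> \<le> gsup w (small \<epsilon> n)" by (rule gsum_le_gsup[OF small_gbdd xs])
      finally show ?thesis using eps(2)[OF n] by linarith
    qed
    moreover have "gsum w ?big m' xs \<le> \<eta> / (2 * S)"
    proof -
      have "gsum w ?big m' xs \<le> w m' * M * card {k. \<epsilon> < \<zeta> n k}"
        by (rule gsum_le_card[OF strict_sorted_distinct[OF xs] fin])
           (use z_nonneg z_le_M M_pos in \<open>auto simp: less_imp_le not_less\<close>)
      also have "\<dots> \<le> q * M * (real h + 1)"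
        using h[of n] w_antimono[OF m'] m M_pos q w_nonneg by (intro mult_mono) auto
      also have "\<dots> = \<eta> / (2 * S)"
      proof -
        have "real h + 1 \<noteq> 0" by linarith
        then show ?thesis using M_pos S unfolding q_def by (simp add: divide_simps)
      qed
      finally show ?thesis .
    qed
    ultimately show ?thesis using S by (simp add: field_simps)
  qed
  have "gsum w (comb s \<beta>) m' xs \<le> \<eta>" if s: "s \<ge> s0" and m': "m' \<ge> m" and xs: "sorted_wrt (<) xs" for s m' xs
  proof -
    have "gsum w (comb s \<beta>) m' xs = (\<Sum>j<length \<beta>. \<beta> ! j * gsum w (\<zeta> (s + j)) m' xs)"
      unfolding comb_def gsum_sum gsum_cmult ..
    also have "\<dots> \<le> (\<Sum>j<length \<beta>. \<beta> ! j * (\<eta> / S))"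
      by (intro sum_mono mult_left_mono one) (use s m' xs pos in auto)
    also have "\<dots> = sum_list \<beta> * (\<eta> / S)"
      by (simp add: sum_list_sum_nth atLeast0LessThan sum_distrib_right sum_divide_distrib)
    also have "\<dots> \<le> S * (\<eta> / S)" by (rule mult_right_mono) (use e S in \<open>auto simp: S_def\<close>)
    finally show ?thesis using S by simp
  qed
  then show ?thesis by blast
qed

text \<open>The new stretch goes last in one arrangement and first in the other. The order of
  choices matters: \<open>\<beta>\<close> determines \<open>m\<close>, \<open>xs\<close> determines
  its length \<open>r\<close>, and only then are \<open>N\<close> and \<open>a\<close> chosen, with
  \<open>a\<close> so small that neither \<open>m\<close> nor \<open>r\<close> places of the stretch
  are worth much. The lower bound therefore gains \<open>1 / (4 * C)\<close> while the upper one
  grows by \<open>\<eta>\<close> only.\<close>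

lemma two_arrangements_step:
  assumes H: "\<And>\<delta>. 0 < \<delta> \<Longrightarrow> \<exists>\<epsilon>>0. \<exists>N. \<forall>n\<ge>N. gsup w (small \<epsilon> n) < \<delta>"
    and e: "0 < \<eta>" and ms: "mset \<alpha> = mset \<beta>" and pos: "\<And>a. a \<in> set \<alpha> \<Longrightarrow> 0 \<le> a"
    and xs: "sorted_wrt (<) xs" "set xs \<subseteq> {..<K (length \<alpha>)}" "R \<le> gsum w (comb 0 \<alpha>) 0 xs"
    and up: "\<And>s. s \<ge> s0 \<Longrightarrow> gsup w (comb s \<beta>) \<le> C + \<eta>"
  shows "\<exists>a\<ge>0. \<exists>N zs s1. sorted_wrt (<) zs \<and> set zs \<subseteq> {..<K (length (\<alpha> @ replicate N a))} \<and>
      R + 1 / (4 * C) \<le> gsum w (comb 0 (\<alpha> @ replicate N a)) 0 zs \<and>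
      (\<forall>s\<ge>s1. gsup w (comb s (replicate N a @ \<beta>)) \<le> C + 2 * \<eta>)"
proof -
  have posb: "0 \<le> a" if "a \<in> set \<beta>" for a using pos that mset_eq_setD[OF ms] by auto
  obtain m s1 where ms1: "\<And>s m' ys. s \<ge> s1 \<Longrightarrow> m' \<ge> m \<Longrightarrow> sorted_wrt (<) ys \<Longrightarrow> gsum w (comb s \<beta>) m' ys \<le> \<eta>"
    using gsum_small_tail[OF H posb e] by metis
  define l where "l = length \<alpha>"
  define r where "r = length xs"
  \<comment> \<open>With \<open>a = 1 / G\<close> and \<open>G > Q\<close>, the first summand gives
    \<open>a * M * m \<le> \<eta>\<close> and the second gives
    \<open>a * M * r \<le> 1 / (4 * C)\<close>.\<close>
  define Q where "Q = M * m / \<eta> + 4 * C * M * r"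
  obtain N where N: "0 < N" "Q + 1 < gsup w (\<lambda>k. \<Sum>j<N. \<zeta> j k)"
    using initial_unbounded[OF H, of "Q + 1"] by blast
  define G where "G = gsup w (\<lambda>k. \<Sum>j<N. \<zeta> j k)"
  define a where "a = 1 / G"
  have "0 \<le> Q" using M_pos C_ge_1 e by (simp add: Q_def)
  then have G: "1 < G" "Q < G" using N by (auto simp: G_def)
  have a: "0 < a" using G by (simp add: a_def)
  have gb: "gbdd w (\<lambda>k. \<Sum>j<N. \<zeta> (s + j) k)" for s
    using sum_z_gbdd[of "{..<N}" "\<lambda>_. 1" "\<lambda>j. s + j"] by simp
  have aM1: "a * M * m \<le> \<eta>"
  proof -
    have "M * m / \<eta> \<le> G" using G C_ge_1 M_pos by (simp add: Q_def) (smt (verit) mult_nonneg_nonneg of_nat_0_le_iff)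
    then show ?thesis using G e by (simp add: a_def field_simps)
  qed
  have aM2: "a * M * r \<le> 1 / (4 * C)"
  proof -
    have "4 * C * M * r \<le> Q" using M_pos e by (simp add: Q_def)
    then have "4 * C * M * r \<le> G" using G by linarith
    then show ?thesis using G C_ge_1 by (simp add: a_def field_simps)
  qed
  have rep: "comb s (replicate N a) = (\<lambda>k. a * (\<Sum>j<N. \<zeta> (s + j) k))" for s
    by (simp add: comb_replicate fun_eq_iff)
  have rep_nonneg: "0 \<le> comb s (replicate N a) k" for s k by (rule comb_nonneg) (use a in auto)
  have rep_gbdd: "gbdd w (comb s (replicate N a))" for s by (rule comb_gbdd) (use a in auto)
  \<comment> \<open>Supports are disjoint, so at each coordinate at most one block of the stretch is
    nonzero.\<close>
  have rep_le: "comb s (replicate N a) k \<le> a * M" for s k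
  proof -
    have "(\<Sum>j<N. \<zeta> (s + j) k) \<le> M"
    proof (cases "\<exists>i<N. \<zeta> (s + i) k \<noteq> 0")
      case True
      then obtain i where i: "i < N" "\<zeta> (s + i) k \<noteq> 0" by blast
      have "(\<Sum>j<N. \<zeta> (s + j) k) = (\<Sum>j\<in>{i}. \<zeta> (s + j) k)"
        by (rule sum.mono_neutral_right) (use i z_disjoint[OF i(2)] in auto)
      then show ?thesis using z_le_M by simp
    next
      case False
      then show ?thesis using M_pos by (simp add: sum.neutral)
    qed
    then show ?thesis using a by (simp add: rep)
  qed
  \<comment> \<open>The stretch is normalised to norm 1 at start 0; at any other start symmetry
    allows a factor \<open>C\<close> in either direction.\<close>
  have G_up: "gsup w (comb s (replicate N a)) \<le> C" for s
  proof -
    have "gsup w (comb s (replicate N a)) \<le> C * gsup w (comb 0 (replicate N a))"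
      by (rule comb_symm) (use a in auto)
    also have "gsup w (comb 0 (replicate N a)) = 1"
      unfolding rep using gsup_cmult[OF gb, of a 0] a G by (simp add: G_def a_def)
    finally show ?thesis by simp
  qed
  have G_low: "1 / C \<le> gsup w (comb s (replicate N a))" for s
  proof -
    have "1 = gsup w (comb 0 (replicate N a))"
      unfolding rep using gsup_cmult[OF gb, of a 0] a G by (simp add: G_def a_def)
    also have "\<dots> \<le> C * gsup w (comb s (replicate N a))"
      by (rule comb_symm) (use a in auto)
    finally show ?thesis using C_ge_1 by (simp add: field_simps)
  qed
  \<comment> \<open>Of the norm \<open>1 / C\<close>, half is given up to obtain a finite selection
    and a quarter to skip the \<open>r\<close> ranks taken by \<open>xs\<close>.\<close>
  have "1 / (2 * C) < 1 / C" using C_ge_1 by (simp add: field_simps)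
  then have "1 / (2 * C) < gsup w (comb l (replicate N a))" using G_low[of l] by linarith
  then obtain ys where ys: "sorted_wrt (<) ys" "1 / (2 * C) < gsum w (comb l (replicate N a)) 0 ys"
    by (rule gsup_gtE)
  define ys' where "ys' = filter (\<lambda>k. K l \<le> k \<and> k < K (l + N)) ys"
  have ys': "sorted_wrt (<) ys'" unfolding ys'_def by (simp add: ys sorted_wrt_filter)
  have "gsum w (comb l (replicate N a)) 0 ys \<le> gsum w (comb l (replicate N a)) 0 ys'"
    unfolding ys'_def by (rule gsum_filter[OF rep_nonneg]) (use comb_supp[of l "replicate N a"] in auto)
  moreover have "gsum w (comb l (replicate N a)) 0 ys' - a * M * r \<le> gsum w (comb l (replicate N a)) r (drop r ys')"
    by (rule gsum_drop) (use rep_le a M_pos in auto)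
  moreover have "1 / (2 * C) - 1 / (4 * C) = 1 / (4 * C)" using C_ge_1 by (simp add: field_simps)
  ultimately have low: "1 / (4 * C) \<le> gsum w (comb l (replicate N a)) r (drop r ys')"
    using ys aM2 by linarith
  define zs where "zs = xs @ drop r ys'"
  have dset: "set (drop r ys') \<subseteq> {K l..<K (l + N)}"
    using set_drop_subset[of r ys'] by (auto simp: ys'_def)
  have "sorted_wrt (<) zs" unfolding zs_def sorted_wrt_append
  proof (intro conjI ballI)
    show "sorted_wrt (<) (drop r ys')" using ys' by (rule sorted_wrt_drop)
    fix x y assume "x \<in> set xs" "y \<in> set (drop r ys')"
    then have "x < K l" "K l \<le> y" using xs dset by (auto simp: l_def)
    then show "x < y" by linarith
  qed (rule xs)
  moreover have "set zs \<subseteq> {..<K (length (\<alpha> @ replicate N a))}"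
  proof -
    have "K l \<le> K (l + N)" by (rule monoD[OF K_mono]) simp
    then have "set xs \<subseteq> {..<K (l + N)}" using xs(2) unfolding l_def by (meson lessThan_subset_iff order_trans)
    moreover have "set (drop r ys') \<subseteq> {..<K (l + N)}" using dset by auto
    ultimately show ?thesis by (simp add: zs_def l_def)
  qed
  moreover have "R + 1 / (4 * C) \<le> gsum w (comb 0 (\<alpha> @ replicate N a)) 0 zs"
  proof -
    have eq: "comb 0 (\<alpha> @ replicate N a) = (\<lambda>k. comb 0 \<alpha> k + comb l (replicate N a) k)"
      by (simp add: comb_append l_def fun_eq_iff)
    have "0 \<le> gsum w (comb 0 \<alpha>) r (drop r ys')" by (rule gsum_nonneg) (rule comb_nonneg[OF pos])
    moreover have "0 \<le> gsum w (comb l (replicate N a)) 0 xs" by (rule gsum_nonneg[OF rep_nonneg])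
    ultimately show ?thesis using low xs(3)
      unfolding eq gsum_add zs_def gsum_append r_def[symmetric] add_0 by linarith
  qed
  moreover have "gsup w (comb s (replicate N a @ \<beta>)) \<le> C + 2 * \<eta>" if s: "s \<ge> s0 + s1" for s
  proof (rule gsup_le)
    fix us :: "nat list" assume us: "sorted_wrt (<) us"
    \<comment> \<open>An increasing selection splits at \<open>K (s + N)\<close>: before it only the
      stretch is nonzero, after it only the part carrying \<open>\<beta>\<close>.\<close>
    let ?P = "\<lambda>k. k < K (s + N)"
    define u1 where "u1 = takeWhile ?P us"
    define u2 where "u2 = dropWhile ?P us"
    have u12: "us = u1 @ u2" by (simp add: u1_def u2_def)
    then have so: "sorted_wrt (<) u1" "sorted_wrt (<) u2" using us by (auto simp: sorted_wrt_append)
    have u1: "k < K (s + N)" if "k \<in> set u1" for k using that set_takeWhileD unfolding u1_def by metis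
    have u2: "K (s + N) \<le> k" if k: "k \<in> set u2" for k
    proof -
      have ne: "u2 \<noteq> []" using k by auto
      then have "K (s + N) \<le> hd u2" using hd_dropWhile[of ?P us] unfolding u2_def by auto
      moreover have "hd u2 \<le> k"
        using so(2) k by (cases u2) auto
      ultimately show ?thesis by simp
    qed
    have eq: "comb s (replicate N a @ \<beta>) = (\<lambda>k. comb s (replicate N a) k + comb (s + N) \<beta> k)"
      by (simp add: comb_append fun_eq_iff)
    have z1: "gsum w (comb (s + N) \<beta>) 0 u1 = 0"
    proof -
      have "gsum w (comb (s + N) \<beta>) 0 u1 = gsum w (\<lambda>k. 0) 0 u1"
      proof (rule gsum_cong)
        fix k assume "k \<in> set u1"
        then show "comb (s + N) \<beta> k = 0" using comb_supp[of "s + N" \<beta> k] u1[of k] by fastforce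
      qed
      then show ?thesis by simp
    qed
    have z2: "gsum w (comb s (replicate N a)) i u2 = 0" for i
    proof -
      have "gsum w (comb s (replicate N a)) i u2 = gsum w (\<lambda>k. 0) i u2"
      proof (rule gsum_cong)
        fix k assume "k \<in> set u2"
        then show "comb s (replicate N a) k = 0"
          using comb_supp[of s "replicate N a" k] u2[of k] by fastforce
      qed
      then show ?thesis by simp
    qed
    have tot: "gsum w (comb s (replicate N a @ \<beta>)) 0 us =
        gsum w (comb s (replicate N a)) 0 u1 + gsum w (comb (s + N) \<beta>) (length u1) u2"
      unfolding eq gsum_add u12 gsum_append using z1 z2 by simp
    show "gsum w (comb s (replicate N a @ \<beta>)) 0 us \<le> C + 2 * \<eta>"
    \<comment> \<open>The contributions never add up in full: either the stretch adds at most
      \<open>\<eta>\<close> to the old bound \<open>C + \<eta>\<close>, or the old part shrinks to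
      \<open>\<eta>\<close> and the stretch gives at most \<open>C\<close>. This keeps the upper
      bound independent of the number of stretches.\<close>
    proof (cases "length u1 \<le> m")
      case True
      have "gsum w (comb s (replicate N a)) 0 u1 \<le> a * M * length u1"
        by (rule gsum_le_length') (use rep_le a M_pos in auto)
      also have "\<dots> \<le> a * M * m" using True a M_pos by (intro mult_left_mono) auto
      also have "\<dots> \<le> \<eta>" by (rule aM1)
      finally have "gsum w (comb s (replicate N a)) 0 u1 \<le> \<eta>" .
      moreover have "gsum w (comb (s + N) \<beta>) (length u1) u2 \<le> gsum w (comb (s + N) \<beta>) 0 u2"
        by (rule gsum_shift[OF comb_nonneg[OF posb]]) auto
      moreover have "\<dots> \<le> gsup w (comb (s + N) \<beta>)"
        by (rule gsum_le_gsup[OF comb_gbdd[OF posb] so(2)])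
      moreover have "\<dots> \<le> C + \<eta>" by (rule up) (use s in auto)
      ultimately show ?thesis unfolding tot by linarith
    next
      case False
      have "gsum w (comb s (replicate N a)) 0 u1 \<le> C"
        using gsum_le_gsup[OF rep_gbdd so(1), of s] G_up[of s] by linarith
      moreover have "gsum w (comb (s + N) \<beta>) (length u1) u2 \<le> \<eta>"
        by (rule ms1) (use s False so in auto)
      ultimately show ?thesis unfolding tot using e by linarith
    qed
  qed
  ultimately show ?thesis using a by (meson less_imp_le)
qed

lemma two_arrangements:
  assumes H: "\<And>\<delta>. 0 < \<delta> \<Longrightarrow> \<exists>\<epsilon>>0. \<exists>N. \<forall>n\<ge>N. gsup w (small \<epsilon> n) < \<delta>"
    and "0 < \<eta>"
  shows "\<exists>\<alpha> \<beta> xs s0. mset \<alpha> = mset \<beta> \<and> (\<forall>a\<in>set \<alpha>. 0 \<le> a) \<and> sorted_wrt (<) xs \<and>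
      set xs \<subseteq> {..<K (length \<alpha>)} \<and> real n * (1 / (4 * C)) \<le> gsum w (comb 0 \<alpha>) 0 xs \<and>
      (\<forall>s\<ge>s0. gsup w (comb s \<beta>) \<le> C + \<eta>)"
  using \<open>0 < \<eta>\<close>
proof (induction n arbitrary: \<eta>)
  case 0
  have "gsup w (comb s []) \<le> C + \<eta>" for s
    by (rule gsup_le) (use 0 C_ge_1 in \<open>simp add: comb_def\<close>)
  then show ?case by (intro exI[of _ "[]"] exI[of _ 0]) auto
next
  case (Suc n)
  \<comment> \<open>One step turns the error \<open>\<eta>\<close> into \<open>2 * \<eta>\<close>,
    so the induction hypothesis is taken at half the error.\<close>
  have half: "0 < \<eta> / 2" using Suc.prems by simp
  obtain \<alpha> \<beta> xs s0 where IH: "mset \<alpha> = mset \<beta>" "\<And>a. a \<in> set \<alpha> \<Longrightarrow> 0 \<le> a" "sorted_wrt (<) xs"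
    "set xs \<subseteq> {..<K (length \<alpha>)}" "real n * (1 / (4 * C)) \<le> gsum w (comb 0 \<alpha>) 0 xs"
    "\<And>s. s \<ge> s0 \<Longrightarrow> gsup w (comb s \<beta>) \<le> C + \<eta> / 2"
    using Suc.IH[OF half] by blast
  obtain a N zs s1 where st: "a \<ge> 0" "sorted_wrt (<) zs" "set zs \<subseteq> {..<K (length (\<alpha> @ replicate N a))}"
      "real n * (1 / (4 * C)) + 1 / (4 * C) \<le> gsum w (comb 0 (\<alpha> @ replicate N a)) 0 zs"
      "\<And>s. s \<ge> s1 \<Longrightarrow> gsup w (comb s (replicate N a @ \<beta>)) \<le> C + 2 * (\<eta> / 2)"
    using two_arrangements_step[OF H half IH] by blast
  have "mset (\<alpha> @ replicate N a) = mset (replicate N a @ \<beta>)" using IH(1) by simp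
  moreover have "\<forall>b\<in>set (\<alpha> @ replicate N a). 0 \<le> b" using IH(2) st(1) by auto
  moreover have "real (Suc n) * (1 / (4 * C)) \<le> gsum w (comb 0 (\<alpha> @ replicate N a)) 0 zs"
    using st(4) by (simp add: distrib_right add.commute add_divide_distrib)
  moreover have "\<forall>s\<ge>s1. gsup w (comb s (replicate N a @ \<beta>)) \<le> C + \<eta>" using st(5) by simp
  ultimately show ?case using st(2,3) by blast
qed

text \<open>The two alternatives for \<open>small\<close> are complementary. The second is
  contradictory, because the same coefficients would have norm growing with \<open>n\<close> in one
  order and at most \<open>C + 1\<close> in the other.\<close>

theorem lower_lp_estimate:
  "\<exists>c>0. \<forall>A t. finite A \<longrightarrow> (\<forall>j. 0 \<le> t j) \<longrightarrow> c * (\<Sum>j\<in>A. t j) \<le> gsup w (\<lambda>k. \<Sum>j\<in>A. t j * \<zeta> j k)"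
proof (cases "\<exists>\<delta>>0. \<forall>\<epsilon>>0. \<forall>N. \<exists>n\<ge>N. \<delta> \<le> gsup w (small \<epsilon> n)")
  case True
  then obtain \<delta> where d: "0 < \<delta>" "\<And>\<epsilon> N. 0 < \<epsilon> \<Longrightarrow> \<exists>n\<ge>N. \<delta> \<le> gsup w (small \<epsilon> n)" by blast
  have "0 < \<delta> / (4 * C)" using d C_ge_1 by simp
  then show ?thesis using lower_lp[OF d] by blast
next
  case False
  then have H: "\<exists>\<epsilon>>0. \<exists>N. \<forall>n\<ge>N. gsup w (small \<epsilon> n) < \<delta>" if "0 < \<delta>" for \<delta>
    using that by (meson not_less)
  \<comment> \<open>Large enough to refute \<open>n / (4 * C) \<le> C * (C + 1)\<close>.\<close>
  obtain n :: nat where n: "4 * C * (C * (C + 1)) < n" using reals_Archimedean2 by blast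
  obtain \<alpha> \<beta> xs s0 where ab: "mset \<alpha> = mset \<beta>" "\<And>a. a \<in> set \<alpha> \<Longrightarrow> 0 \<le> a" "sorted_wrt (<) xs"
    "real n * (1 / (4 * C)) \<le> gsum w (comb 0 \<alpha>) 0 xs" "\<And>s. s \<ge> s0 \<Longrightarrow> gsup w (comb s \<beta>) \<le> C + 1"
    using two_arrangements[OF H zero_less_one, of n] by blast
  have "real n * (1 / (4 * C)) \<le> gsup w (comb 0 \<alpha>)"
    by (rule order_trans[OF ab(4) gsum_le_gsup[OF comb_gbdd ab(3)]]) (rule ab(2))
  also have "\<dots> \<le> C * gsup w (comb s0 \<beta>)" by (rule comb_symm[OF ab(1,2)])
  also have "\<dots> \<le> C * (C + 1)" using ab(5)[of s0] C_ge_1 by (intro mult_left_mono) auto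
  finally have "real n \<le> 4 * C * (C * (C + 1))" using C_ge_1 by (simp add: field_simps)
  with n show ?thesis by simp
qed

end

section \<open>Basic sequences in complete F-normed sequence spaces\<close>

lemma seq_scale_zero [simp]: "seq_scale 0 x = 0" "seq_scale c 0 = 0"
  by (auto simp: seq_scale_def fun_eq_iff)

text \<open>Homogeneity of degree \<open>r\<close> together with subadditivity makes
  \<open>nm (x - y)\<close> a metric on \<open>V\<close>, so category arguments apply even where the
  space is only quasi-normed. Nonnegativity and symmetry are demanded of all sequences, which the
  intended \<open>nm\<close>, a power of a quantity depending on absolute values, satisfies.\<close>

locale fspace =
  fixes V :: "(nat \<Rightarrow> 'a::{real_normed_field, heine_borel}) set"
    and nm :: "(nat \<Rightarrow> 'a) \<Rightarrow> real" and r :: real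
  assumes r_pos: "0 < r"
    and V_zero: "0 \<in> V"
    and V_add: "x \<in> V \<Longrightarrow> y \<in> V \<Longrightarrow> x + y \<in> V"
    and V_scale: "x \<in> V \<Longrightarrow> seq_scale c x \<in> V"
    and nm_nonneg: "0 \<le> nm x"
    and nm_uminus: "nm (- x) = nm x"
    and nm_eq_0: "x \<in> V \<Longrightarrow> nm x = 0 \<Longrightarrow> x = 0"
    and nm_add: "x \<in> V \<Longrightarrow> y \<in> V \<Longrightarrow> nm (x + y) \<le> nm x + nm y"
    and nm_scale: "x \<in> V \<Longrightarrow> nm (seq_scale c x) = norm c powr r * nm x"
    and complete: "(\<And>n. X n \<in> V) \<Longrightarrow> (\<And>e. 0 < e \<Longrightarrow> \<exists>N. \<forall>m\<ge>N. \<forall>n\<ge>N. nm (X m - X n) < e) \<Longrightarrow>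
      \<exists>x\<in>V. (\<lambda>n. nm (X n - x)) \<longlonglongrightarrow> 0"
begin

lemma nm_zero: "nm 0 = 0"
  using nm_scale[OF V_zero, of 0] r_pos by simp

lemma uminus_scale: "- x = seq_scale (- 1) (x :: nat \<Rightarrow> 'a)"
  by (simp add: seq_scale_def fun_eq_iff)

lemma V_uminus: "x \<in> V \<Longrightarrow> - x \<in> V"
  unfolding uminus_scale by (rule V_scale)

lemma V_diff: "x \<in> V \<Longrightarrow> y \<in> V \<Longrightarrow> x - y \<in> V"
  using V_add[of x "- y"] V_uminus by simp

lemma V_sum: "(\<And>j. j \<in> A \<Longrightarrow> f j \<in> V) \<Longrightarrow> sum f A \<in> V"
  by (induction A rule: infinite_finite_induct) (auto intro: V_zero V_add)

lemma nm_diff_le: "x \<in> V \<Longrightarrow> y \<in> V \<Longrightarrow> nm (x - y) \<le> nm x + nm y"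
  using nm_add[of x "- y"] V_uminus nm_uminus by simp

lemma nm_commute: "nm (x - y) = nm (y - x)"
  using nm_uminus[of "x - y"] by simp

lemma nm_triangle: "x \<in> V \<Longrightarrow> y \<in> V \<Longrightarrow> z \<in> V \<Longrightarrow> nm (x - z) \<le> nm (x - y) + nm (y - z)"
  using nm_add[of "x - y" "y - z"] V_diff by simp

lemma nm_le_add_diff: "x \<in> V \<Longrightarrow> y \<in> V \<Longrightarrow> nm x \<le> nm y + nm (x - y)"
  using nm_add[of "y" "x - y"] V_diff by simp

lemma nm_sum: "(\<And>j. j \<in> A \<Longrightarrow> f j \<in> V) \<Longrightarrow> nm (sum f A) \<le> (\<Sum>j\<in>A. nm (f j))"
proof (induction A rule: infinite_finite_induct)
  case (insert x F)
  then have "nm (f x + sum f F) \<le> nm (f x) + nm (sum f F)" by (intro nm_add V_sum) auto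
  moreover have "nm (sum f F) \<le> (\<Sum>j\<in>F. nm (f j))" using insert by auto
  ultimately show ?case unfolding sum.insert[OF insert.hyps] by linarith
qed (auto simp: nm_zero)

lemma nm_scale_real:
  assumes "x \<in> V" "0 < c"
  shows "nm (seq_scale (of_real (c powr (1 / r))) x) = c * nm x"
  using assms r_pos by (simp add: nm_scale powr_powr)

lemma nm_tendsto_scale:
  assumes "x \<in> V" "c \<longlonglongrightarrow> l"
  shows "(\<lambda>n. nm (seq_scale (c n) x - seq_scale l x)) \<longlonglongrightarrow> 0"
proof -
  have "(\<lambda>n. norm (c n - l)) \<longlonglongrightarrow> 0" using assms(2) by (simp add: tendsto_norm_zero_iff LIM_zero)
  then have "(\<lambda>n. norm (c n - l) powr r) \<longlonglongrightarrow> 0 powr r"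
    by (rule tendsto_powr') (use r_pos in auto)
  then have "(\<lambda>n. norm (c n - l) powr r * nm x) \<longlonglongrightarrow> 0 powr r * nm x" by (rule tendsto_mult_right)
  moreover have "seq_scale (c n) x - seq_scale l x = seq_scale (c n - l) x" for n
    by (simp add: seq.scale_left_diff_distrib)
  ultimately show ?thesis using assms(1) r_pos by (simp add: nm_scale)
qed

lemma V_span: "S \<subseteq> V \<Longrightarrow> seq.span S \<subseteq> V"
  by (rule seq.span_minimal) (auto simp: seq.subspace_def V_zero V_add V_scale)

end

locale fspace_basic = fspace V nm r
  for V :: "(nat \<Rightarrow> 'a::{real_normed_field, heine_borel}) set" and nm r +
  fixes B :: "nat \<Rightarrow> nat \<Rightarrow> 'a"
  assumes basic: "basic_sequence V nm B"
begin

abbreviation "Y \<equiv> closed_span V nm (range B)"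
abbreviation "expands \<equiv> series_converges_to V nm B"
abbreviation "ps a n \<equiv> (\<Sum>j<n. seq_scale (a j) (B j))"

lemma B_in: "B n \<in> V"
  using basic by (auto simp: basic_sequence_def)

lemma span_in: "x \<in> seq.span (range B) \<Longrightarrow> x \<in> V"
  using V_span[of "range B"] B_in by auto

lemma ps_span: "(\<Sum>j\<in>A. seq_scale (a j) (B (\<sigma> j))) \<in> seq.span (range B)"
  by (intro seq.span_sum seq.span_scale seq.span_base) auto

lemma ps_in: "(\<Sum>j\<in>A. seq_scale (a j) (B (\<sigma> j))) \<in> V"
  by (rule span_in[OF ps_span])

lemma span_Y: "x \<in> seq.span (range B) \<Longrightarrow> x \<in> Y"
  using span_in by (auto simp: closed_span_def nm_zero intro!: bexI[of _ x])

lemma Y_V: "x \<in> Y \<Longrightarrow> x \<in> V" by (simp add: closed_span_def)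

lemma Y_closed:
  assumes "\<And>n. X n \<in> Y" "x \<in> V" "(\<lambda>n. nm (X n - x)) \<longlonglongrightarrow> 0"
  shows "x \<in> Y"
  unfolding closed_span_def
proof (intro CollectI conjI allI impI assms)
  fix e :: real assume e: "0 < e"
  then obtain n where n: "nm (X n - x) < e / 2"
    using order_tendstoD(2)[OF assms(3), of "e / 2"] by (auto simp: eventually_sequentially)
  obtain y where y: "y \<in> seq.span (range B)" "nm (y - X n) < e / 2"
    using assms(1)[of n] e half_gt_zero[OF e] unfolding closed_span_def by blast
  have "nm (y - x) < e" using nm_triangle[of y "X n" x] n y span_in Y_V assms by fastforce
  with y show "\<exists>y\<in>seq.span (range B). nm (y - x) < e" by blast
qed

lemma expands_Y: "expands a x \<Longrightarrow> x \<in> Y"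
  unfolding series_converges_to_def by (rule Y_closed[of "ps a"]) (auto intro: span_Y ps_span)

lemma Y_expands: "x \<in> Y \<Longrightarrow> \<exists>a. expands a x"
  using basic by (auto simp: basic_sequence_def schauder_basis_of_def)

lemma expands_unique: "expands a x \<Longrightarrow> expands b x \<Longrightarrow> a = b"
  using basic expands_Y unfolding basic_sequence_def schauder_basis_of_def by blast

lemma expands_V: "expands a x \<Longrightarrow> x \<in> V" by (simp add: series_converges_to_def)

lemma ps_add: "ps (\<lambda>j. a j + b j) n = ps a n + ps b n"
  by (simp add: seq.scale_left_distrib sum.distrib)

lemma ps_diff: "ps (\<lambda>j. a j - b j) n = ps a n - ps b n"
  by (simp add: seq.scale_left_diff_distrib sum_subtractf)

lemma ps_cmult: "ps (\<lambda>j. c * a j) n = seq_scale c (ps a n)"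
  by (simp add: seq.scale_sum_right)

lemma expands_add:
  assumes "expands a x" "expands b y" shows "expands (\<lambda>j. a j + b j) (x + y)"
proof -
  have V: "x \<in> V" "y \<in> V" using assms expands_V by auto
  have l: "(\<lambda>n. nm (ps a n - x) + nm (ps b n - y)) \<longlonglongrightarrow> 0"
    using tendsto_add[of "\<lambda>n. nm (ps a n - x)" 0 sequentially "\<lambda>n. nm (ps b n - y)" 0] assms
    by (simp add: series_converges_to_def)
  have "nm (ps (\<lambda>j. a j + b j) n - (x + y)) \<le> nm (ps a n - x) + nm (ps b n - y)" for n
    using nm_add[OF V_diff[OF ps_in[of a id] V(1)] V_diff[OF ps_in[of b id] V(2)], of "{..<n}" "{..<n}"]
    unfolding ps_add by (simp add: add_diff_add)
  then have "(\<lambda>n. nm (ps (\<lambda>j. a j + b j) n - (x + y))) \<longlonglongrightarrow> 0"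
    by (intro tendsto_sandwich[OF _ _ tendsto_const l] always_eventually allI nm_nonneg)
  then show ?thesis using V V_add by (simp add: series_converges_to_def)
qed

lemma expands_cmult:
  assumes "expands a x" shows "expands (\<lambda>j. c * a j) (seq_scale c x)"
proof -
  have V: "x \<in> V" using assms expands_V by auto
  have "nm (ps (\<lambda>j. c * a j) n - seq_scale c x) = norm c powr r * nm (ps a n - x)" for n
    unfolding ps_cmult seq.scale_right_diff_distrib[symmetric] by (rule nm_scale) (intro V_diff ps_in V)
  moreover have "(\<lambda>n. norm c powr r * nm (ps a n - x)) \<longlonglongrightarrow> norm c powr r * 0"
    using assms by (intro tendsto_mult_left) (simp add: series_converges_to_def)
  ultimately show ?thesis using V V_scale by (simp add: series_converges_to_def)
qed

lemma expands_diff: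
  assumes "expands a x" "expands b y" shows "expands (\<lambda>j. a j - b j) (x - y)"
  using expands_add[OF assms(1) expands_cmult[OF assms(2), of "- 1"]]
  by (simp add: uminus_scale[symmetric])

lemma expands_zero: "expands (\<lambda>j. 0) 0"
  by (simp add: series_converges_to_def nm_zero V_zero)

lemma expands_finite: "expands (\<lambda>j. if j < n then a j else 0) (ps a n)"
proof -
  have "ps (\<lambda>j. if j < n then a j else 0) m = ps a n" if "m \<ge> n" for m
    using that by (intro sum.mono_neutral_cong_right) auto
  then have "nm (ps (\<lambda>j. if j < n then a j else 0) m - ps a n) = 0" if "m \<ge> n" for m
    using that by (simp only: diff_self nm_zero)
  then have "\<forall>\<^sub>F m in sequentially. nm (ps (\<lambda>j. if j < n then a j else 0) m - ps a n) = 0"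
    unfolding eventually_sequentially by blast
  then show ?thesis by (auto simp: series_converges_to_def ps_in intro: tendsto_eventually)
qed

text \<open>Otherwise 0 would have two expansions.\<close>

lemma B_nonzero: "B n \<noteq> 0"
proof
  assume "B n = 0"
  then have "ps (\<lambda>j. if j = n then 1 else 0) m = 0" for m
    by (intro sum.neutral) auto
  then have "expands (\<lambda>j. if j = n then 1 else 0) 0"
    by (simp add: series_converges_to_def nm_zero V_zero)
  from expands_unique[OF this expands_zero] show False by (metis zero_neq_one)
qed

lemma nm_B_pos: "0 < nm (B n)"
  using nm_eq_0[OF B_in] B_nonzero nm_nonneg[of "B n"] by fastforce

lemma Y_zero: "0 \<in> Y" by (rule expands_Y[OF expands_zero])

lemma Y_diff: "x \<in> Y \<Longrightarrow> y \<in> Y \<Longrightarrow> x - y \<in> Y"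
  by (blast dest: Y_expands intro: expands_Y expands_diff)

lemma Y_add: "x \<in> Y \<Longrightarrow> y \<in> Y \<Longrightarrow> x + y \<in> Y"
  by (blast dest: Y_expands intro: expands_Y expands_add)

lemma Y_scale: "x \<in> Y \<Longrightarrow> seq_scale c x \<in> Y"
  by (blast dest: Y_expands intro: expands_Y expands_cmult)

lemma ps_bounded: "expands a x \<Longrightarrow> \<exists>k. \<forall>n. nm (ps a n) \<le> k"
proof -
  assume a: "expands a x"
  then have "convergent (\<lambda>n. nm (ps a n - x))" unfolding series_converges_to_def convergent_def by blast
  from convergent_imp_Bseq[OF this] obtain k where k: "\<And>n. norm (nm (ps a n - x)) \<le> k"
    unfolding Bseq_def by blast
  have "nm (ps a n) \<le> nm x + k" for n
    using nm_le_add_diff[OF ps_in[of a id] expands_V[OF a], of "{..<n}"] k[of n] by simp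
  then show ?thesis by blast
qed

text \<open>First half of the open mapping theorem, for the map sending a coefficient sequence to its sum.\<close>

lemma approximate_expansion:
  "\<exists>C>0. \<forall>y s e. y \<in> Y \<longrightarrow> nm y < s \<longrightarrow> 0 < e \<longrightarrow>
     (\<exists>a t. expands a t \<and> (\<forall>n. nm (ps a n) \<le> C * s) \<and> nm (y - t) < e)"
proof -
  interpret M: Metric_space Y "\<lambda>x y. nm (x - y)"
  proof
    show "nm (x - y) = 0 \<longleftrightarrow> x = y" if "x \<in> Y" "y \<in> Y" for x y
      using nm_eq_0[OF V_diff[OF Y_V[OF that(1)] Y_V[OF that(2)]]] by (auto simp: nm_zero)
    show "nm (x - y) = nm (y - x)" for x y by (rule nm_commute)
  qed (auto simp: nm_nonneg intro: nm_triangle Y_V)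
  have cmpl: "M.mcomplete"
    unfolding M.mcomplete_def
  proof (intro allI impI)
    fix X assume X: "M.MCauchy X"
    then have XY: "X n \<in> Y" for n by (auto simp: M.MCauchy_def)
    obtain x where x: "x \<in> V" "(\<lambda>n. nm (X n - x)) \<longlonglongrightarrow> 0"
      using complete[of X] X XY Y_V unfolding M.MCauchy_def by meson
    then show "\<exists>x. limitin M.mtopology X x sequentially"
      using Y_closed[OF XY x] XY by (auto simp: M.limitin_metric_dist_null)
  qed
  \<comment> \<open>Partial sums of a convergent expansion are bounded, so the sets
    \<open>T k\<close> cover \<open>Y\<close>. By Baire, the closure of one of them contains a
    ball.\<close>
  define T where "T k = {x. \<exists>a. expands a x \<and> (\<forall>n. nm (ps a n) \<le> real k)}" for k
  have TY: "T k \<subseteq> Y" for k by (auto simp: T_def intro: expands_Y)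
  have "\<exists>k. M.mtopology interior_of (M.mtopology closure_of T k) \<noteq> {}"
  proof (rule ccontr)
    assume "\<not> ?thesis"
    then have "M.mtopology interior_of \<Union>(range (\<lambda>k. M.mtopology closure_of T k)) = {}"
      by (intro M.metric_Baire_category_alt cmpl) auto
    moreover have "\<Union>(range (\<lambda>k. M.mtopology closure_of T k)) = Y"
    proof
      show "\<Union>(range (\<lambda>k. M.mtopology closure_of T k)) \<subseteq> Y"
        using closure_of_subset_topspace[of M.mtopology] by (simp add: UN_subset_iff)
      show "Y \<subseteq> \<Union>(range (\<lambda>k. M.mtopology closure_of T k))"
      proof
        fix y assume y: "y \<in> Y"
        obtain a where a: "expands a y" using Y_expands[OF y] by blast
        obtain k where k: "\<And>n. nm (ps a n) \<le> k" using ps_bounded[OF a] by blast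
        obtain k' :: nat where "k \<le> k'" using real_arch_simple by blast
        then have "nm (ps a n) \<le> real k'" for n using k[of n] by linarith
        then have "y \<in> T k'" using a by (auto simp: T_def)
        moreover have "T k' \<subseteq> M.mtopology closure_of T k'" using TY by (intro closure_of_subset) simp
        ultimately show "y \<in> \<Union>(range (\<lambda>k. M.mtopology closure_of T k))" by blast
      qed
    qed
    ultimately have "Y = {}" using interior_of_topspace[of M.mtopology] by simp
    then show False using Y_zero by blast
  qed
  then obtain k x0 where "x0 \<in> M.mtopology interior_of (M.mtopology closure_of T k)" by blast
  then obtain \<rho> where x0: "x0 \<in> Y" and rho: "0 < \<rho>" "M.mball x0 \<rho> \<subseteq> M.mtopology closure_of T k"
    unfolding M.in_interior_of_mball by blast
  have near: "\<exists>t\<in>T k. nm (z - t) < e" if "z \<in> Y" "nm (x0 - z) < \<rho>" "0 < e" for z e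
  proof -
    have "z \<in> M.mball x0 \<rho>" using that x0 by (simp add: M.in_mball)
    then have "z \<in> M.mtopology closure_of T k" using rho(2) by blast
    then show ?thesis using that(3) unfolding M.metric_closure_of M.in_mball by blast
  qed
  \<comment> \<open>The ball around \<open>x0\<close> is recentred at 0 by writing
    \<open>y = (x0 + y) - x0\<close> and subtracting approximants of the two points, which doubles
    the bound \<open>k\<close>.\<close>
  have unscaled: "\<exists>a t. expands a t \<and> (\<forall>n. nm (ps a n) \<le> 2 * real k) \<and> nm (y - t) < e"
    if y: "y \<in> Y" "nm y < \<rho>" "0 < e" for y e
  proof -
    have e2: "0 < e / 2" using y by simp
    have "nm (x0 - (x0 + y)) < \<rho>" using y nm_uminus by simp
    then obtain t1 where t1: "t1 \<in> T k" "nm (x0 + y - t1) < e / 2"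
      using near[OF Y_add[OF x0 y(1)] _ e2] by blast
    obtain t2 where t2: "t2 \<in> T k" "nm (x0 - t2) < e / 2"
      using near[OF x0 _ e2] rho by (auto simp: nm_zero)
    obtain a1 a2 where a: "expands a1 t1" "expands a2 t2" "\<And>n. nm (ps a1 n) \<le> k" "\<And>n. nm (ps a2 n) \<le> k"
      using t1(1) t2(1) by (auto simp: T_def)
    have "nm (y - (t1 - t2)) = nm ((x0 + y - t1) - (x0 - t2))" by (simp add: algebra_simps)
    also have "\<dots> \<le> nm (x0 + y - t1) + nm (x0 - t2)"
      using a expands_V x0 y Y_V by (intro nm_diff_le V_diff V_add) auto
    also have "\<dots> < e" using t1 t2 by linarith
    finally have "nm (y - (t1 - t2)) < e" .
    moreover have "nm (ps (\<lambda>j. a1 j - a2 j) n) \<le> 2 * real k" for n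
      unfolding ps_diff using nm_diff_le[OF ps_in[of a1 id] ps_in[of a2 id], of "{..<n}" "{..<n}"] a(3,4)[of n]
      by simp
    ultimately show ?thesis using expands_diff[OF a(1,2)] by blast
  qed
  \<comment> \<open>Scaling from radius \<open>\<rho>\<close> to radius \<open>s\<close> multiplies
    the bound by \<open>s / \<rho>\<close>; the summand 1 makes \<open>C\<close> positive when
    \<open>k = 0\<close>.\<close>
  define C where "C = (2 * real k + 1) / \<rho>"
  have "C > 0" using rho by (simp add: C_def)
  moreover have "\<exists>a t. expands a t \<and> (\<forall>n. nm (ps a n) \<le> C * s) \<and> nm (y - t) < e"
    if y: "y \<in> Y" "nm y < s" "0 < e" for y s e
  proof -
    have s: "0 < s" using y nm_nonneg[of y] by linarith
    define c where "c = of_real ((\<rho> / s) powr (1 / r)) * (1 :: 'a)"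
    define d where "d = of_real ((s / \<rho>) powr (1 / r)) * (1 :: 'a)"
    have c: "nm (seq_scale c x) = \<rho> / s * nm x" if "x \<in> V" for x
      using nm_scale_real[OF that, of "\<rho> / s"] rho s by (simp add: c_def)
    have d: "nm (seq_scale d x) = s / \<rho> * nm x" if "x \<in> V" for x
      using nm_scale_real[OF that, of "s / \<rho>"] rho s by (simp add: d_def)
    have "(s / \<rho>) powr (1 / r) * (\<rho> / s) powr (1 / r) = 1"
      using rho s by (subst powr_mult[symmetric]) auto
    then have dc: "d * c = 1" by (simp add: c_def d_def flip: of_real_mult)
    have "nm (seq_scale c y) < \<rho>" using y s rho by (simp add: c Y_V field_simps)
    then obtain a t where a: "expands a t" "\<And>n. nm (ps a n) \<le> 2 * real k" "nm (seq_scale c y - t) < e * \<rho> / s"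
      using unscaled[OF Y_scale[OF y(1)], of c "e * \<rho> / s"] y rho s by auto
    have "y - seq_scale d t = seq_scale d (seq_scale c y - t)"
      using dc by (simp add: seq.scale_right_diff_distrib)
    then have "nm (y - seq_scale d t) = s / \<rho> * nm (seq_scale c y - t)"
      using d V_diff V_scale y a Y_V expands_V by simp
    also have "\<dots> < s / \<rho> * (e * \<rho> / s)" using a s rho by (intro mult_strict_left_mono) auto
    also have "\<dots> = e" using s rho by simp
    finally have "nm (y - seq_scale d t) < e" .
    moreover have "nm (ps (\<lambda>j. d * a j) n) \<le> C * s" for n
    proof -
      have "nm (ps (\<lambda>j. d * a j) n) = s / \<rho> * nm (ps a n)"
        unfolding ps_cmult using d[OF ps_in[of a id]] by simp
      also have "\<dots> \<le> s / \<rho> * (2 * real k + 1)" using a(2)[of n] s rho by (intro mult_left_mono) auto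
      finally show ?thesis by (simp add: C_def mult.commute)
    qed
    ultimately show ?thesis using expands_cmult[OF a(1)] by blast
  qed
  ultimately show ?thesis by blast
qed

end

context fspace_basic
begin

lemma ps_V: "ps a n \<in> V"
  using ps_in[of a id] by simp

text \<open>Second half of the open mapping theorem: successive approximation.\<close>

lemma bounded_expansion:
  "\<exists>C>0. \<forall>y s. y \<in> Y \<longrightarrow> nm y < s \<longrightarrow> (\<exists>a. expands a y \<and> (\<forall>n. nm (ps a n) \<le> C * s))"
proof -
  obtain C where C: "0 < C" "\<And>y s e. y \<in> Y \<Longrightarrow> nm y < s \<Longrightarrow> 0 < e \<Longrightarrow>
     \<exists>a t. expands a t \<and> (\<forall>n. nm (ps a n) \<le> C * s) \<and> nm (y - t) < e"
    using approximate_expansion by blast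
  have "\<exists>a. expands a y \<and> (\<forall>n. nm (ps a n) \<le> 2 * C * s)" if y: "y \<in> Y" "nm y < s" for y s
  proof -
    have s: "0 < s" using y nm_nonneg[of y] by linarith
    \<comment> \<open>Here \<open>z i\<close> is the remainder after \<open>i\<close>
      approximations: it has norm below \<open>s / 2 ^ i\<close>, and its next approximant is
      \<open>z i - z (Suc i)\<close>.\<close>
    have "\<exists>z. \<forall>i. (z i \<in> Y \<and> nm (z i) < s / 2 ^ i \<and> (i = 0 \<longrightarrow> z i = y)) \<and>
       (\<exists>a. expands a (z i - z (Suc i)) \<and> (\<forall>n. nm (ps a n) \<le> C * (s / 2 ^ i)))"
    proof (rule dependent_nat_choice)
      show "\<exists>z. z \<in> Y \<and> nm z < s / 2 ^ 0 \<and> ((0::nat) = 0 \<longrightarrow> z = y)" using y by auto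
      fix z i assume z: "z \<in> Y \<and> nm z < s / 2 ^ i \<and> (i = 0 \<longrightarrow> z = y)"
      obtain a t where a: "expands a t" "\<And>n. nm (ps a n) \<le> C * (s / 2 ^ i)" "nm (z - t) < s / 2 ^ Suc i"
        using C(2)[of z "s / 2 ^ i" "s / 2 ^ Suc i"] z s by auto
      have "z - t \<in> Y" using z a(1) expands_Y Y_diff by blast
      moreover have "expands a (z - (z - t))" using a by simp
      ultimately show "\<exists>z'. (z' \<in> Y \<and> nm z' < s / 2 ^ Suc i \<and> (Suc i = 0 \<longrightarrow> z' = y)) \<and>
          (\<exists>a. expands a (z - z') \<and> (\<forall>n. nm (ps a n) \<le> C * (s / 2 ^ i)))"
        using a by blast
    qed
    then obtain z where z: "\<And>i. z i \<in> Y" "\<And>i. nm (z i) < s / 2 ^ i" "z 0 = y"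
      and "\<And>i. \<exists>a. expands a (z i - z (Suc i)) \<and> (\<forall>n. nm (ps a n) \<le> C * (s / 2 ^ i))"
      by blast
    then obtain a where a: "\<And>i. expands (a i) (z i - z (Suc i))" "\<And>i n. nm (ps (a i) n) \<le> C * (s / 2 ^ i)"
      by metis
    define b where "b i j = (\<Sum>i'<i. a i' j)" for i j
    have bSuc: "b (Suc i) = (\<lambda>j. b i j + a i j)" for i by (simp add: b_def fun_eq_iff)
    have b_exp: "expands (b i) (y - z i)" for i
    proof (induction i)
      case 0
      then show ?case using expands_zero z(3) by (simp add: b_def zero_fun_def)
    next
      case (Suc i)
      have "(y - z i) + (z i - z (Suc i)) = y - z (Suc i)" by (simp add: fun_eq_iff)
      then show ?case using expands_add[OF Suc a(1)[of i]] unfolding bSuc by (simp only:)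
    qed
    \<comment> \<open>The geometric sum is stated in closed form so that the induction on
      \<open>k\<close> telescopes.\<close>
    have b_diff: "nm (ps (b (i + k)) n - ps (b i) n) \<le> 2 * C * s / 2 ^ i - 2 * C * s / 2 ^ (i + k)" for i k n
    proof (induction k)
      case 0
      then show ?case using nm_zero by (simp add: zero_fun_def)
    next
      case (Suc k)
      have "ps (b (i + Suc k)) n - ps (b i) n = (ps (b (i + k)) n - ps (b i) n) + ps (a (i + k)) n"
        unfolding add_Suc_right bSuc ps_add by simp
      then have "nm (ps (b (i + Suc k)) n - ps (b i) n)
          \<le> nm (ps (b (i + k)) n - ps (b i) n) + nm (ps (a (i + k)) n)"
        by (simp only: nm_add V_diff ps_V)
      also have "\<dots> \<le> 2 * C * s / 2 ^ i - 2 * C * s / 2 ^ (i + k) + C * (s / 2 ^ (i + k))"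
        by (intro add_mono Suc a(2))
      also have "\<dots> = 2 * C * s / 2 ^ i - 2 * C * s / 2 ^ (i + Suc k)" by (simp add: field_simps)
      finally show ?case .
    qed
    have b_le: "nm (ps (b i') n - ps (b i) n) \<le> 2 * C * s / 2 ^ i" if "i \<le> i'" for i i' n
    proof -
      from that obtain k where k: "i' = i + k" by (auto simp: le_iff_add)
      have "0 \<le> 2 * C * s / 2 ^ (i + k)" using C s by simp
      then show ?thesis using b_diff[of i k n] unfolding k by linarith
    qed
    have tail0: "(\<lambda>i. 4 * C * s / 2 ^ i) \<longlonglongrightarrow> 0"
      using tendsto_mult_left[OF LIMSEQ_realpow_zero[of "1/2"], of "4 * C * s"] by (simp add: power_divide)
    \<comment> \<open>The \<open>n\<close>-th coefficient is read off from two consecutive partial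
      sums, so the uniform Cauchy estimate for partial sums passes to each coefficient;
      \<open>B n\<close> being nonzero allows the division.\<close>
    have "convergent (\<lambda>i. b i n)" for n
    proof (rule Cauchy_convergent, rule CauchyI')
      fix e :: real assume e: "0 < e"
      then obtain i where i: "4 * C * s / 2 ^ i < e powr r * nm (B n)"
        using order_tendstoD(2)[OF tail0, of "e powr r * nm (B n)"] nm_B_pos[of n]
        by (auto simp: eventually_sequentially)
      have "norm (b k n - b l n) < e" if kl: "i \<le> k" "k < l" for k l
      proof -
        have "norm (b k n - b l n) powr r * nm (B n) = nm (seq_scale (b k n - b l n) (B n))"
          by (rule nm_scale[OF B_in, symmetric])
        also have "seq_scale (b k n - b l n) (B n) = (ps (b k) (Suc n) - ps (b l) (Suc n)) - (ps (b k) n - ps (b l) n)"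
          by (simp add: seq.scale_left_diff_distrib)
        also have "nm \<dots> \<le> nm (ps (b k) (Suc n) - ps (b l) (Suc n)) + nm (ps (b k) n - ps (b l) n)"
          by (intro nm_diff_le V_diff) (rule ps_V)+
        also have "\<dots> \<le> 2 * C * s / 2 ^ k + 2 * C * s / 2 ^ k"
          using b_le[of k l n] b_le[of k l "Suc n"] kl by (intro add_mono) (simp_all only: nm_commute[of "ps (b k) _"] less_imp_le)
        also have "\<dots> = 4 * C * s * (1 / 2 ^ k)" by simp
        also have "\<dots> \<le> 4 * C * s * (1 / 2 ^ i)"
          using C s kl by (intro mult_left_mono) (auto simp: field_simps)
        also have "\<dots> < e powr r * nm (B n)" using i by simp
        finally have "norm (b k n - b l n) powr r < e powr r" using nm_B_pos[of n] by simp
        then show ?thesis using e r_pos powr_mono2[of r e "norm (b k n - b l n)"] by linarith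
      qed
      then show "\<exists>M. \<forall>m\<ge>M. \<forall>l>m. dist (b m n) (b l n) < e" unfolding dist_norm by blast
    qed
    then obtain c where c: "\<And>n. (\<lambda>i. b i n) \<longlonglongrightarrow> c n" unfolding convergent_def by metis
    have lim: "(\<lambda>i. nm (ps (b i) n - ps c n)) \<longlonglongrightarrow> 0" for n
    proof (rule tendsto_sandwich[OF _ _ tendsto_const])
      show "(\<lambda>i. \<Sum>j<n. nm (seq_scale (b i j) (B j) - seq_scale (c j) (B j))) \<longlonglongrightarrow> 0"
        by (rule tendsto_null_sum) (rule nm_tendsto_scale[OF B_in c])
      show "\<forall>\<^sub>F i in sequentially. nm (ps (b i) n - ps c n) \<le> (\<Sum>j<n. nm (seq_scale (b i j) (B j) - seq_scale (c j) (B j)))"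
        unfolding sum_subtractf[symmetric] by (intro always_eventually allI nm_sum V_diff V_scale B_in)
    qed (simp add: nm_nonneg)
    have c_b: "nm (ps c n - ps (b i) n) \<le> 2 * C * s / 2 ^ i" for n i
    proof -
      have "nm (ps c n - ps (b i) n) \<le> nm (ps (b i') n - ps c n) + 2 * C * s / 2 ^ i" if "i \<le> i'" for i'
      proof -
        have "nm (ps c n - ps (b i) n) \<le> nm (ps c n - ps (b i') n) + nm (ps (b i') n - ps (b i) n)"
          by (rule nm_triangle) (rule ps_V)+
        then show ?thesis using b_le[OF that, of n] nm_commute[of "ps c n"] by simp
      qed
      then have "nm (ps c n - ps (b i) n) \<le> 0 + 2 * C * s / 2 ^ i"
        by (intro tendsto_lowerbound[OF tendsto_add[OF lim tendsto_const]])
           (auto simp: eventually_sequentially)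
      then show ?thesis by simp
    qed
    have "nm (ps c n) \<le> 2 * C * s" for n
      using c_b[of n 0] by (simp add: b_def)
    \<comment> \<open>The error splits into the distance from \<open>c\<close> to
      \<open>b i\<close>, uniform in \<open>n\<close>, the convergence of \<open>b i\<close> to
      \<open>y - z i\<close>, and the norm of \<open>z i\<close>.\<close>
    moreover have "(\<lambda>n. nm (ps c n - y)) \<longlonglongrightarrow> 0"
    proof (rule LIMSEQ_I)
      fix e :: real assume e: "0 < e"
      have "(\<lambda>i. s / 2 ^ i) \<longlonglongrightarrow> 0"
        using tendsto_mult_left[OF LIMSEQ_realpow_zero[of "1/2"], of s] by (simp add: power_divide)
      then have "\<forall>\<^sub>F i in sequentially. 4 * C * s / 2 ^ i < e / 3 \<and> s / 2 ^ i < e / 3"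
        using e by (intro eventually_conj order_tendstoD(2)[OF tail0] order_tendstoD(2)) auto
      then obtain i where i: "4 * C * s / 2 ^ i < e / 3" "s / 2 ^ i < e / 3"
        by (auto simp: eventually_sequentially)
      have "(\<lambda>n. nm (ps (b i) n - (y - z i))) \<longlonglongrightarrow> 0" using b_exp[of i] by (simp add: series_converges_to_def)
      then obtain N where N: "\<And>n. n \<ge> N \<Longrightarrow> nm (ps (b i) n - (y - z i)) < e / 3"
        using order_tendstoD(2)[of _ 0 sequentially "e / 3"] e by (auto simp: eventually_sequentially)
      have "nm (ps c n - y) < e" if n: "n \<ge> N" for n
      proof -
        have V: "y \<in> V" "z i \<in> V" "ps c n \<in> V" "ps (b i) n \<in> V" using y z Y_V ps_V by auto
        have "nm (ps c n - y) \<le> nm (ps c n - ps (b i) n) + nm (ps (b i) n - y)" by (rule nm_triangle) (rule V)+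
        moreover have "nm (ps (b i) n - y) \<le> nm (ps (b i) n - (y - z i)) + nm ((y - z i) - y)"
          by (rule nm_triangle) (intro V V_diff)+
        moreover have "nm ((y - z i) - y) = nm (z i)" using nm_uminus[of "z i"] by simp
        moreover have "2 * C * s / 2 ^ i \<le> 4 * C * s / 2 ^ i" using C s by (intro divide_right_mono) auto
        ultimately show ?thesis using c_b[of n i] i N[OF n] z(2)[of i] by linarith
      qed
      then show "\<exists>N. \<forall>n\<ge>N. norm (nm (ps c n - y) - 0) < e" by (auto simp: nm_nonneg)
    qed
    ultimately show ?thesis using y Y_V by (auto simp: series_converges_to_def)
  qed
  then show ?thesis using C(1) by (intro exI[of _ "2 * C"]) auto
qed

text \<open>By uniqueness, the expansion with controlled partial sums that
  \<open>bounded_expansion\<close> supplies for a finite combination is the combination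
  itself.\<close>

lemma basis_constant:
  "\<exists>K\<ge>1. \<forall>A a m. finite A \<longrightarrow>
     nm (\<Sum>j\<in>A \<inter> {..<m}. seq_scale (a j) (B j)) \<le> K * nm (\<Sum>j\<in>A. seq_scale (a j) (B j))"
proof -
  obtain C where C: "0 < C" "\<And>y s. y \<in> Y \<Longrightarrow> nm y < s \<Longrightarrow> \<exists>a. expands a y \<and> (\<forall>n. nm (ps a n) \<le> C * s)"
    using bounded_expansion by blast
  have "nm (\<Sum>j\<in>A \<inter> {..<m}. seq_scale (a j) (B j)) \<le> (C + 1) * nm (\<Sum>j\<in>A. seq_scale (a j) (B j))"
    if A: "finite A" for A a m
  proof -
    define n where "n = Suc (Max (insert 0 A))"
    have n: "A \<subseteq> {..<n}" using A by (auto simp: n_def le_imp_less_Suc)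
    define c where "c j = (if j \<in> A then a j else 0)" for j
    have dc: "(\<lambda>j. if j < n then c j else 0) = c" using n by (auto simp: c_def fun_eq_iff)
    have psc: "ps c k = (\<Sum>j\<in>A \<inter> {..<k}. seq_scale (a j) (B j))" for k
      by (rule sum.mono_neutral_cong_right) (auto simp: c_def)
    have psn: "ps c n = (\<Sum>j\<in>A. seq_scale (a j) (B j))"
      unfolding psc using n by (simp add: Int_absorb2)
    have ex: "expands c (ps c n)" using expands_finite[of n c] unfolding dc .
    have "nm (ps c m) / C \<le> nm (ps c n)"
    \<comment> \<open>The bound is available for each \<open>s\<close> strictly above the norm and
      is then taken to the limit.\<close>
    proof (rule dense_ge)
      fix s assume "nm (ps c n) < s"
      then obtain b where b: "expands b (ps c n)" "\<And>n. nm (ps b n) \<le> C * s"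
        using C(2)[OF expands_Y[OF ex]] by blast
      then have "b = c" using expands_unique ex by blast
      then show "nm (ps c m) / C \<le> s" using b(2)[of m] C(1) by (simp add: pos_divide_le_eq mult.commute)
    qed
    then have "nm (ps c m) \<le> C * nm (ps c n)" using C(1) by (simp add: pos_divide_le_eq mult.commute)
    then show ?thesis using nm_nonneg[of "ps c n"] unfolding psn[symmetric] psc[symmetric] distrib_right by simp
  qed
  then show ?thesis using C(1) by (intro exI[of _ "C + 1"]) auto
qed

end

section \<open>Uniform symmetry\<close>

text \<open>\<open>A\<close> and its image have equally many elements, hence so have their
  complements in \<open>S\<close>, and any bijection between the complements completes
  \<open>\<sigma>\<close>.\<close>

lemma extend_to_permutation:
  assumes "finite S" "A \<subseteq> S" "inj_on \<sigma> A" "\<sigma> ` A \<subseteq> S"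
  shows "\<exists>\<pi>. \<pi> permutes S \<and> (\<forall>a\<in>A. \<pi> a = \<sigma> a)"
proof -
  have fin: "finite A" "finite (\<sigma> ` A)" using assms finite_subset by blast+
  have "card (S - A) = card (S - \<sigma> ` A)"
    using assms fin by (simp add: card_Diff_subset card_image)
  then obtain f where f: "bij_betw f (S - A) (S - \<sigma> ` A)"
    using finite_same_card_bij[of "S - A" "S - \<sigma> ` A"] assms(1) by blast
  define \<pi> where "\<pi> x = (if x \<in> A then \<sigma> x else if x \<in> S then f x else x)" for x
  have "bij_betw \<pi> (A \<union> (S - A)) (\<sigma> ` A \<union> (S - \<sigma> ` A))"
  proof (rule bij_betw_combine)
    show "bij_betw \<pi> A (\<sigma> ` A)"
      using inj_on_imp_bij_betw[OF assms(3)] by (rule bij_betw_cong[THEN iffD1, rotated]) (simp add: \<pi>_def)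
    show "bij_betw \<pi> (S - A) (S - \<sigma> ` A)"
      using f by (rule bij_betw_cong[THEN iffD1, rotated]) (simp add: \<pi>_def)
  qed blast
  moreover have "A \<union> (S - A) = S" "\<sigma> ` A \<union> (S - \<sigma> ` A) = S" using assms by auto
  ultimately have "bij_betw \<pi> S S" by simp
  then have "\<pi> permutes S" by (rule bij_imp_permutes) (use assms in \<open>auto simp: \<pi>_def\<close>)
  then show ?thesis by (auto simp: \<pi>_def)
qed

context fspace
begin

text \<open>In Cauchy form, convergence can be proved and refuted through sums over intervals,
  without naming a limit.\<close>

lemma series_Cauchy:
  assumes "\<And>j. X j \<in> V"
  shows "series_converges V nm X a \<longleftrightarrow> (\<forall>e>0. \<exists>N. \<forall>n\<ge>N. \<forall>m\<ge>N.
    nm ((\<Sum>j<n. seq_scale (a j) (X j)) - (\<Sum>j<m. seq_scale (a j) (X j))) < e)" (is "_ \<longleftrightarrow> ?C")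
proof -
  define S where "S n = (\<Sum>j<n. seq_scale (a j) (X j))" for n
  have S: "S n \<in> V" for n unfolding S_def by (intro V_sum V_scale assms)
  show ?thesis unfolding S_def[symmetric]
  proof
    assume "series_converges V nm X a"
    then obtain x where x: "x \<in> V" "(\<lambda>n. nm (S n - x)) \<longlonglongrightarrow> 0"
      by (auto simp: series_converges_def series_converges_to_def S_def)
    show "\<forall>e>0. \<exists>N. \<forall>n\<ge>N. \<forall>m\<ge>N. nm (S n - S m) < e"
    proof (intro allI impI)
      fix e :: real assume "0 < e"
      then obtain N where N: "\<And>n. n \<ge> N \<Longrightarrow> nm (S n - x) < e / 2"
        using order_tendstoD(2)[OF x(2), of "e / 2"] by (auto simp: eventually_sequentially)
      have "nm (S n - S m) < e" if "n \<ge> N" "m \<ge> N" for n m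
        using nm_triangle[OF S x(1) S, of n m] nm_commute[of x "S m"] N[OF that(1)] N[OF that(2)] by linarith
      then show "\<exists>N. \<forall>n\<ge>N. \<forall>m\<ge>N. nm (S n - S m) < e" by blast
    qed
  next
    assume "\<forall>e>0. \<exists>N. \<forall>n\<ge>N. \<forall>m\<ge>N. nm (S n - S m) < e"
    then have "\<exists>x\<in>V. (\<lambda>n. nm (S n - x)) \<longlonglongrightarrow> 0" by (intro complete S) blast
    then show "series_converges V nm X a"
      by (auto simp: series_converges_def series_converges_to_def S_def)
  qed
qed

end

locale fspace_symmetric = fspace_basic V nm r B
  for V :: "(nat \<Rightarrow> 'a::{real_normed_field, heine_borel}) set" and nm r B +
  assumes symm: "bij \<pi> \<Longrightarrow> equivalent_sequences V nm (B \<circ> \<pi>) V nm B"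
begin

abbreviation "comb a \<sigma> A \<equiv> (\<Sum>j\<in>A. seq_scale (a j) (B (\<sigma> j)))"

lemma comb_V: "comb a \<sigma> A \<in> V" by (rule ps_in)

lemma comb_scale: "comb (\<lambda>j. c * a j) \<sigma> A = seq_scale c (comb a \<sigma> A)"
  by (simp add: seq.scale_sum_right)

text \<open>If no constant works for permutations of the indices beyond \<open>n\<close>, whatever \<open>n\<close> is, then the
  offending finite combinations can be placed on successive intervals, and together they define one
  permutation and one coefficient sequence that contradict symmetry.\<close>

lemma tail_symmetric:
  "\<exists>n C. 0 < C \<and> (\<forall>m \<sigma> a. \<sigma> permutes {n..<m} \<longrightarrow> nm (comb a \<sigma> {n..<m}) \<le> C * nm (comb a id {n..<m}))"
proof (rule ccontr)
  assume "\<not> ?thesis"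
  then have neg: "\<And>n C. 0 < C \<Longrightarrow> \<exists>m \<sigma> a. \<sigma> permutes {n..<m} \<and> C * nm (comb a id {n..<m}) < nm (comb a \<sigma> {n..<m})"
    by (meson not_le)
  \<comment> \<open>The refuted constant is \<open>2 ^ k\<close>; after scaling, the permuted sum
    has norm 1 and the unpermuted one is below \<open>1 / 2 ^ k\<close>.\<close>
  define Q where "Q n k m \<sigma> a \<longleftrightarrow> n < m \<and> \<sigma> permutes {n..<m} \<and>
      nm (comb a \<sigma> {n..<m}) = 1 \<and> nm (comb a id {n..<m}) < 1 / 2 ^ k" for n k m \<sigma> a
  have "\<exists>m \<sigma> a. Q n k m \<sigma> a" for n k
  proof -
    obtain m \<sigma> a where a: "\<sigma> permutes {n..<m}" "2 ^ k * nm (comb a id {n..<m}) < nm (comb a \<sigma> {n..<m})"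
      using neg[of "2 ^ k" n] by auto
    define v where "v = nm (comb a \<sigma> {n..<m})"
    have "0 \<le> 2 ^ k * nm (comb a id {n..<m})" by (simp add: nm_nonneg)
    then have v: "0 < v" using a unfolding v_def by linarith
    have nm0: "n < m"
    proof (rule ccontr)
      assume "\<not> n < m"
      then show False using v nm_zero by (simp add: v_def)
    qed
    define c where "c = of_real ((1 / v) powr (1 / r)) * (1 :: 'a)"
    have c: "nm (seq_scale c x) = nm x / v" if "x \<in> V" for x
      using nm_scale_real[OF that, of "1 / v"] v by (simp add: c_def)
    have n1: "nm (comb (\<lambda>j. c * a j) \<sigma> {n..<m}) = 1"
      unfolding comb_scale c[OF comb_V] using v by (simp add: v_def)
    have n2: "nm (comb (\<lambda>j. c * a j) id {n..<m}) < 1 / 2 ^ k"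
      unfolding comb_scale c[OF comb_V] using a(2) v
      by (simp add: v_def[symmetric] divide_simps mult.commute)
    show ?thesis unfolding Q_def
      by (intro exI[of _ m] exI[of _ \<sigma>] exI[of _ "\<lambda>j. c * a j"] conjI nm0 a(1) n1 n2)
  qed
  then obtain fm fs fa where "\<And>n k. Q n k (fm n k) (fs n k) (fa n k)" by metis
  then have f: "\<And>n k. n < fm n k" "\<And>n k. fs n k permutes {n..<fm n k}"
    "\<And>n k. nm (comb (fa n k) (fs n k) {n..<fm n k}) = 1" "\<And>n k. nm (comb (fa n k) id {n..<fm n k}) < 1 / 2 ^ k"
    unfolding Q_def by blast+
  \<comment> \<open>Interval number \<open>k\<close> runs from \<open>\<nu> k\<close> to
    \<open>\<nu> (Suc k)\<close>, each starting where the last one ended, and \<open>k\<close> is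
    also its precision.\<close>
  define \<nu> where "\<nu> = rec_nat 0 (\<lambda>k n. fm n k)"
  have nu0: "\<nu> 0 = 0" and nuS: "\<nu> (Suc k) = fm (\<nu> k) k" for k by (auto simp: \<nu>_def)
  have mono: "strict_mono \<nu>" by (rule strict_monoI_Suc) (simp add: nuS f)
  define \<kappa> where "\<kappa> j = (LEAST k. j < \<nu> (Suc k))" for j
  have kap: "\<nu> (\<kappa> j) \<le> j \<and> j < \<nu> (Suc (\<kappa> j))" for j
  proof
    have "\<exists>k. j < \<nu> (Suc k)" using strict_mono_imp_increasing[OF mono, of "Suc j"] by (auto simp: Suc_le_eq)
    then show "j < \<nu> (Suc (\<kappa> j))" unfolding \<kappa>_def by (rule LeastI_ex)
    show "\<nu> (\<kappa> j) \<le> j"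
    proof (cases "\<kappa> j")
      case 0
      then show ?thesis by (simp add: nu0)
    next
      case (Suc l)
      then have "\<not> j < \<nu> (Suc l)" using not_less_Least[of l "\<lambda>k. j < \<nu> (Suc k)"] by (simp add: \<kappa>_def)
      then show ?thesis using Suc by simp
    qed
  qed
  have kap_eq: "\<kappa> j = k" if "\<nu> k \<le> j" "j < \<nu> (Suc k)" for j k
  proof -
    have "\<not> Suc k \<le> \<kappa> j" "\<not> Suc (\<kappa> j) \<le> k"
      using that kap[of j] strict_mono_less_eq[OF mono] by (meson leD le_trans not_le)+
    then show ?thesis by linarith
  qed
  define \<pi> where "\<pi> j = fs (\<nu> (\<kappa> j)) (\<kappa> j) j" for j
  define a where "a j = fa (\<nu> (\<kappa> j)) (\<kappa> j) j" for j
  have perm: "fs (\<nu> k) k permutes {\<nu> k..<\<nu> (Suc k)}" for k using f(2) by (simp add: nuS)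
  have pi_in: "\<nu> (\<kappa> j) \<le> \<pi> j \<and> \<pi> j < \<nu> (Suc (\<kappa> j))" for j
    using permutes_in_image[OF perm[of "\<kappa> j"], of j] kap[of j] by (simp add: \<pi>_def)
  have kap_pi: "\<kappa> (\<pi> j) = \<kappa> j" for j using pi_in kap_eq by blast
  have "bij \<pi>"
  proof (rule bijI)
    show "inj \<pi>"
    proof (rule injI)
      fix i j assume e: "\<pi> i = \<pi> j"
      then have "\<kappa> i = \<kappa> j" using kap_pi by metis
      then show "i = j" using e injD[OF permutes_inj[OF perm[of "\<kappa> j"]]] by (simp add: \<pi>_def)
    qed
    show "surj \<pi>"
    proof (rule surjI)
      fix j
      have "inv (fs (\<nu> (\<kappa> j)) (\<kappa> j)) j \<in> {\<nu> (\<kappa> j)..<\<nu> (Suc (\<kappa> j))}"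
        using permutes_in_image[OF permutes_inv[OF perm[of "\<kappa> j"]], of j] kap[of j] by simp
      then have "\<kappa> (inv (fs (\<nu> (\<kappa> j)) (\<kappa> j)) j) = \<kappa> j" using kap_eq by simp
      then show "\<pi> (inv (fs (\<nu> (\<kappa> j)) (\<kappa> j)) j) = j"
        unfolding \<pi>_def by (simp add: permutes_inverses(1)[OF perm])
    qed
  qed
  have blk1: "nm (comb a \<pi> {\<nu> k..<\<nu> (Suc k)}) = 1" for k
  proof -
    have "comb a \<pi> {\<nu> k..<\<nu> (Suc k)} = comb (fa (\<nu> k) k) (fs (\<nu> k) k) {\<nu> k..<\<nu> (Suc k)}"
      by (rule sum.cong) (auto simp: a_def \<pi>_def kap_eq)
    then show ?thesis using f(3) by (simp add: nuS)
  qed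
  have blk2: "nm (comb a id {\<nu> k..<\<nu> (Suc k)}) < 1 / 2 ^ k" for k
  proof -
    have "comb a id {\<nu> k..<\<nu> (Suc k)} = comb (fa (\<nu> k) k) id {\<nu> k..<\<nu> (Suc k)}"
      by (rule sum.cong) (auto simp: a_def kap_eq)
    then show ?thesis using f(4) by (simp add: nuS)
  qed
  \<comment> \<open>Only sums over whole intervals are known to be small; a sum that stops inside an
    interval is controlled by the basis constant.\<close>
  obtain K where K: "1 \<le> K" "\<And>A a m. finite A \<Longrightarrow>
     nm (\<Sum>j\<in>A \<inter> {..<m}. seq_scale (a j) (B j)) \<le> K * nm (\<Sum>j\<in>A. seq_scale (a j) (B j))"
    using basis_constant by blast
  have comb_split: "comb a \<sigma> {..<n} - comb a \<sigma> {..<m} = comb a \<sigma> {m..<n}" if "m \<le> n" for m n \<sigma>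
  proof -
    have "{..<n} - {..<m} = {m..<n}" by auto
    then show ?thesis using sum_diff[of "{..<n}" "{..<m}" "\<lambda>j. seq_scale (a j) (B (\<sigma> j))"] that by auto
  qed
  have part: "nm (comb a id {..<n} - comb a id {..<\<nu> l}) \<le> K * (1 / 2 ^ l)" if "\<nu> l \<le> n" "n < \<nu> (Suc l)" for n l
  proof -
    have "{\<nu> l..<n} = {\<nu> l..<\<nu> (Suc l)} \<inter> {..<n}" using that by auto
    then have "nm (comb a id {\<nu> l..<n}) \<le> K * nm (comb a id {\<nu> l..<\<nu> (Suc l)})"
      using K(2)[of "{\<nu> l..<\<nu> (Suc l)}" a n] by simp
    also have "\<dots> \<le> K * (1 / 2 ^ l)" using K(1) blk2[of l] by (intro mult_left_mono) auto
    finally show ?thesis using comb_split[OF that(1)] by simp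
  qed
  have whole: "nm (comb a id {..<\<nu> (k + d)} - comb a id {..<\<nu> k}) \<le> 2 / 2 ^ k - 2 / 2 ^ (k + d)" for k d
  proof (induction d)
    case 0
    then show ?case using nm_zero by (simp add: zero_fun_def)
  next
    case (Suc d)
    have "nm (comb a id {..<\<nu> (k + Suc d)} - comb a id {..<\<nu> k})
      \<le> nm (comb a id {..<\<nu> (k + Suc d)} - comb a id {..<\<nu> (k + d)}) + nm (comb a id {..<\<nu> (k + d)} - comb a id {..<\<nu> k})"
      by (rule nm_triangle) (rule comb_V)+
    moreover have "nm (comb a id {..<\<nu> (k + Suc d)} - comb a id {..<\<nu> (k + d)}) \<le> 1 / 2 ^ (k + d)"
      using blk2[of "k + d"] strict_mono_less_eq[OF mono, of "k + d" "k + Suc d"]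
      by (subst comb_split) (auto simp: add_Suc_right less_imp_le)
    moreover have "(2::real) / 2 ^ (k + d) = 2 / 2 ^ (k + Suc d) + 1 / 2 ^ (k + d)" by (simp add: field_simps)
    ultimately show ?case using Suc by linarith
  qed
  have tail: "nm (comb a id {..<n} - comb a id {..<\<nu> k}) \<le> (K + 2) / 2 ^ k" if n: "\<nu> k \<le> n" for n k
  proof -
    have "k \<le> \<kappa> n"
    proof (rule ccontr)
      assume "\<not> k \<le> \<kappa> n"
      then have "\<nu> (Suc (\<kappa> n)) \<le> \<nu> k" using strict_mono_less_eq[OF mono] by simp
      then show False using kap[of n] n by linarith
    qed
    then obtain d where d: "\<kappa> n = k + d" by (auto simp: le_iff_add)
    have "nm (comb a id {..<n} - comb a id {..<\<nu> k})
      \<le> nm (comb a id {..<n} - comb a id {..<\<nu> (k + d)}) + nm (comb a id {..<\<nu> (k + d)} - comb a id {..<\<nu> k})"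
      by (rule nm_triangle) (rule comb_V)+
    also have "\<dots> \<le> K * (1 / 2 ^ (k + d)) + (2 / 2 ^ k - 2 / 2 ^ (k + d))"
      using part[of "k + d" n] kap[of n] whole[of k d] unfolding d by (intro add_mono) auto
    also have "\<dots> \<le> K * (1 / 2 ^ k) + 2 / 2 ^ k"
    proof -
      have "K * (1 / 2 ^ (k + d)) \<le> K * (1 / 2 ^ k)"
        using K(1) by (intro mult_left_mono) (auto simp: field_simps)
      moreover have "0 \<le> (2::real) / 2 ^ (k + d)" by simp
      ultimately show ?thesis by linarith
    qed
    finally show ?thesis by (simp add: add_divide_distrib)
  qed
  have "series_converges V nm B a"
    unfolding series_Cauchy[of B, OF B_in]
  proof (intro allI impI)
    fix e :: real assume e: "0 < e"
    have "(\<lambda>k. (K + 2) / 2 ^ k) \<longlonglongrightarrow> 0"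
      using tendsto_mult_left[OF LIMSEQ_realpow_zero[of "1/2"], of "K + 2"] by (simp add: power_divide)
    then have "\<forall>\<^sub>F k in sequentially. (K + 2) / 2 ^ k < e / 2" by (rule order_tendstoD(2)) (use e in simp)
    from eventually_happens'[OF sequentially_bot this] obtain k where k: "(K + 2) / 2 ^ k < e / 2" by blast
    have "nm (ps a n - ps a m) < e" if "n \<ge> \<nu> k" "m \<ge> \<nu> k" for n m
    proof -
      have "nm (ps a n - ps a m) \<le> nm (ps a n - ps a (\<nu> k)) + nm (ps a (\<nu> k) - ps a m)"
        by (rule nm_triangle) (rule ps_V)+
      then show ?thesis using tail[OF that(1)] tail[OF that(2)] nm_commute[of "ps a (\<nu> k)" "ps a m"] k
        unfolding id_def by linarith
    qed
    then show "\<exists>N. \<forall>n\<ge>N. \<forall>m\<ge>N. nm (ps a n - ps a m) < e" by blast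
  qed
  \<comment> \<open>Symmetry transfers convergence to the permuted series. Its sums over whole
    intervals all have norm 1, which violates the Cauchy property.\<close>
  then have "series_converges V nm (B \<circ> \<pi>) a"
    using symm[OF \<open>bij \<pi>\<close>] by (simp add: equivalent_sequences_def)
  moreover have "(B \<circ> \<pi>) j \<in> V" for j by (simp add: B_in)
  ultimately have "\<forall>e>0. \<exists>N. \<forall>n\<ge>N. \<forall>m\<ge>N. nm (comb a \<pi> {..<n} - comb a \<pi> {..<m}) < e"
    using series_Cauchy[of "B \<circ> \<pi>" a] by (simp only: comp_apply)
  then obtain N where N: "\<And>n m. n \<ge> N \<Longrightarrow> m \<ge> N \<Longrightarrow> nm (comb a \<pi> {..<n} - comb a \<pi> {..<m}) < 1"
    using zero_less_one by blast
  have "N \<le> \<nu> N" by (rule strict_mono_imp_increasing[OF mono])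
  moreover have "\<nu> N \<le> \<nu> (Suc N)" using strict_mono_less_eq[OF mono] by simp
  ultimately have "nm (comb a \<pi> {\<nu> N..<\<nu> (Suc N)}) < 1"
    using N[of "\<nu> (Suc N)" "\<nu> N"] comb_split[of "\<nu> N" "\<nu> (Suc N)" \<pi>] by simp
  then show False using blk1[of N] by simp
qed

end

context fspace_basic
begin

text \<open>A single term is the difference of two consecutive truncations, whence the factor
  \<open>2 * K\<close>.\<close>

lemma coefficient_bound:
  "\<exists>K\<ge>1. \<forall>A a j. finite A \<longrightarrow> j \<in> A \<longrightarrow>
     norm (a j) powr r * nm (B j) \<le> K * nm (\<Sum>j\<in>A. seq_scale (a j) (B j))"
proof -
  obtain K where K: "1 \<le> K" "\<And>A a m. finite A \<Longrightarrow>
     nm (\<Sum>j\<in>A \<inter> {..<m}. seq_scale (a j) (B j)) \<le> K * nm (\<Sum>j\<in>A. seq_scale (a j) (B j))"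
    using basis_constant by blast
  have "norm (a j) powr r * nm (B j) \<le> 2 * K * nm (\<Sum>j\<in>A. seq_scale (a j) (B j))"
    if A: "finite A" "j \<in> A" for A a j
  proof -
    let ?S = "\<lambda>m. \<Sum>j\<in>A \<inter> {..<m}. seq_scale (a j) (B j)"
    have S: "?S m \<in> V" for m using ps_in[of a id] by simp
    have "A \<inter> {..<Suc j} = insert j (A \<inter> {..<j})" using A by auto
    then have "?S (Suc j) - ?S j = seq_scale (a j) (B j)" by (simp add: A(1))
    then have "norm (a j) powr r * nm (B j) = nm (?S (Suc j) - ?S j)" by (simp only: nm_scale[OF B_in])
    also have "\<dots> \<le> nm (?S (Suc j)) + nm (?S j)" by (rule nm_diff_le) (rule S)+
    also have "\<dots> \<le> K * nm (\<Sum>j\<in>A. seq_scale (a j) (B j)) + K * nm (\<Sum>j\<in>A. seq_scale (a j) (B j))"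
      by (intro add_mono K(2) A)
    finally show ?thesis by simp
  qed
  then show ?thesis using K(1) by (intro exI[of _ "2 * K"]) auto
qed

end

context fspace_symmetric
begin

lemma comb_union:
  "finite A \<Longrightarrow> E \<subseteq> A \<Longrightarrow> comb a \<sigma> A = comb a \<sigma> E + comb a \<sigma> (A - E)"
  by (simp add: sum.subset_diff add.commute)

text \<open>An injection between finite sets beyond \<open>n\<close> extends to a permutation of an
  interval, and the coefficients are extended by 0.\<close>

lemma tail_symmetric_injection:
  "\<exists>n C. 0 < C \<and> (\<forall>A \<sigma> a. finite A \<longrightarrow> inj_on \<sigma> A \<longrightarrow> A \<subseteq> {n..} \<longrightarrow> \<sigma> ` A \<subseteq> {n..} \<longrightarrow>
     nm (comb a \<sigma> A) \<le> C * nm (comb a id A))"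
proof -
  obtain n C where C: "0 < C" "\<And>m \<sigma> a. \<sigma> permutes {n..<m} \<Longrightarrow> nm (comb a \<sigma> {n..<m}) \<le> C * nm (comb a id {n..<m})"
    using tail_symmetric by blast
  have "nm (comb a \<sigma> A) \<le> C * nm (comb a id A)"
    if A: "finite A" "inj_on \<sigma> A" "A \<subseteq> {n..}" "\<sigma> ` A \<subseteq> {n..}" for A \<sigma> a
  proof -
    define m where "m = Suc (Max (insert 0 (A \<union> \<sigma> ` A)))"
    have "x < m" if "x \<in> A \<union> \<sigma> ` A" for x
      unfolding m_def less_Suc_eq_le by (rule Max_ge) (use that A in auto)
    then have m: "A \<subseteq> {n..<m}" "\<sigma> ` A \<subseteq> {n..<m}" using A by auto
    obtain \<pi> where p: "\<pi> permutes {n..<m}" "\<And>x. x \<in> A \<Longrightarrow> \<pi> x = \<sigma> x"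
      using extend_to_permutation[OF _ m(1) A(2) m(2)] by auto
    define c where "c j = (if j \<in> A then a j else 0)" for j
    have "comb c \<pi> {n..<m} = comb a \<sigma> A"
      by (rule sum.mono_neutral_cong_right) (use m p in \<open>auto simp: c_def\<close>)
    moreover have "comb c id {n..<m} = comb a id A"
      by (rule sum.mono_neutral_cong_right) (use m p in \<open>auto simp: c_def\<close>)
    ultimately show ?thesis using C(2)[OF p(1), of c] by (simp only:)
  qed
  then show ?thesis using C(1) by blast
qed

text \<open>Beyond \<open>n\<close>, singletons in the previous lemma compare every
  \<open>B j\<close> with \<open>B n\<close>; the finitely many earlier vectors are nonzero.\<close>

lemma seminormalized: "\<exists>b>0. \<exists>b'>0. \<forall>n. b \<le> nm (B n) \<and> nm (B n) \<le> b'"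
proof -
  obtain n C where C: "0 < C" "\<And>A \<sigma> a. finite A \<Longrightarrow> inj_on \<sigma> A \<Longrightarrow> A \<subseteq> {n..} \<Longrightarrow> \<sigma> ` A \<subseteq> {n..} \<Longrightarrow>
     nm (comb a \<sigma> A) \<le> C * nm (comb a id A)"
    using tail_symmetric_injection by blast
  have comp: "nm (B l) \<le> C * nm (B i)" if "n \<le> l" "n \<le> i" for l i
    using C(2)[of "{i}" "\<lambda>_. l" "\<lambda>_. 1"] that by simp
  define F where "F = (\<lambda>j. nm (B j)) ` {..n}"
  have F: "finite F" "F \<noteq> {}" "x \<in> F \<Longrightarrow> 0 < x" for x by (auto simp: F_def nm_B_pos)
  have lo: "min (Min F) (nm (B n) / C) \<le> nm (B j)" and hi: "nm (B j) \<le> max (Max F) (C * nm (B n))" for j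
  proof -
    have "Min F \<le> nm (B j) \<and> nm (B j) \<le> Max F" if "j \<le> n" using F that by (auto simp: F_def)
    moreover have "nm (B n) / C \<le> nm (B j) \<and> nm (B j) \<le> C * nm (B n)" if "n \<le> j"
      using comp[of n j] comp[of j n] that C(1) by (simp add: pos_divide_le_eq mult.commute)
    ultimately show "min (Min F) (nm (B n) / C) \<le> nm (B j)" "nm (B j) \<le> max (Max F) (C * nm (B n))"
      using linear[of j n] by auto
  qed
  have "0 < min (Min F) (nm (B n) / C)" using F C(1) nm_B_pos by simp
  moreover have "0 < max (Max F) (C * nm (B n))" using C(1) nm_B_pos by (simp add: less_max_iff_disj)
  ultimately show ?thesis using lo hi by blast
qed

text \<open>The tail lemma fails only at indices with \<open>j < n\<close> or
  \<open>\<sigma> j < n\<close>. There are at most \<open>2 * n\<close> of them, and their terms are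
  estimated one by one through their coefficients.\<close>

lemma symmetric_constant_id:
  "\<exists>C\<ge>1. \<forall>A \<sigma> a. finite A \<longrightarrow> inj_on \<sigma> A \<longrightarrow> nm (comb a \<sigma> A) \<le> C * nm (comb a id A)"
proof -
  obtain n C where C: "0 < C" "\<And>A \<sigma> a. finite A \<Longrightarrow> inj_on \<sigma> A \<Longrightarrow> A \<subseteq> {n..} \<Longrightarrow> \<sigma> ` A \<subseteq> {n..} \<Longrightarrow>
     nm (comb a \<sigma> A) \<le> C * nm (comb a id A)"
    using tail_symmetric_injection by blast
  obtain K where K: "1 \<le> K" "\<And>A a j. finite A \<Longrightarrow> j \<in> A \<Longrightarrow> norm (a j) powr r * nm (B j) \<le> K * nm (comb a id A)"
    using coefficient_bound unfolding id_def by blast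
  obtain b b' where b: "0 < b" "0 < b'" "\<And>n. b \<le> nm (B n)" "\<And>n. nm (B n) \<le> b'"
    using seminormalized by blast
  \<comment> \<open>At most \<open>2 * n\<close> exceptional terms, each with coefficient factor at
    most \<open>K / b\<close> times the total norm and with vector of norm at most
    \<open>b'\<close>.\<close>
  define D where "D = 2 * n * (K / b * b')"
  have D: "0 \<le> D" using K b by (simp add: D_def)
  have "nm (comb a \<sigma> A) \<le> (D + C * (1 + D) + 1) * nm (comb a id A)"
    if A: "finite A" "inj_on \<sigma> A" for A \<sigma> a
  proof -
    define f where "f = nm (comb a id A)"
    have f: "0 \<le> f" by (simp add: f_def nm_nonneg)
    define E where "E = {j \<in> A. j < n \<or> \<sigma> j < n}"
    have E: "E \<subseteq> A" "finite E" using A by (auto simp: E_def)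
    have "card E \<le> card {j \<in> A. j < n} + card {j \<in> A. \<sigma> j < n}"
    proof -
      have "E = {j \<in> A. j < n} \<union> {j \<in> A. \<sigma> j < n}" by (auto simp: E_def)
      then show ?thesis using card_Un_le by metis
    qed
    also have "\<dots> \<le> n + n"
    proof (rule add_mono)
      show "card {j \<in> A. j < n} \<le> n" using card_mono[of "{..<n}" "{j \<in> A. j < n}"] by auto
      have "card {j \<in> A. \<sigma> j < n} = card (\<sigma> ` {j \<in> A. \<sigma> j < n})"
        using A(2) by (intro card_image[symmetric]) (auto simp: inj_on_def)
      also have "\<dots> \<le> card {..<n}" by (intro card_mono) auto
      finally show "card {j \<in> A. \<sigma> j < n} \<le> n" by simp
    qed
    finally have cE: "real (card E) \<le> 2 * n" by simp
    have coef: "norm (a j) powr r \<le> K / b * f" if "j \<in> A" for j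
    proof -
      have "norm (a j) powr r * b \<le> norm (a j) powr r * nm (B j)" by (intro mult_left_mono b) simp
      also have "\<dots> \<le> K * f" unfolding f_def by (rule K(2)[OF A(1) that])
      finally show ?thesis using b(1) by (simp add: pos_le_divide_eq)
    qed
    have exc: "nm (comb a \<tau> E) \<le> D * f" for \<tau>
    proof -
      have "nm (comb a \<tau> E) \<le> (\<Sum>j\<in>E. nm (seq_scale (a j) (B (\<tau> j))))" by (intro nm_sum V_scale B_in)
      also have "\<dots> \<le> (\<Sum>j\<in>E. K / b * f * b')"
        unfolding nm_scale[OF B_in] using coef E(1) b K(1) f by (intro sum_mono mult_mono) (auto simp: nm_nonneg)
      also have "\<dots> = card E * (K / b * b' * f)" by simp
      also have "\<dots> \<le> 2 * n * (K / b * b' * f)" using cE K b f by (intro mult_right_mono) auto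
      finally show ?thesis by (simp add: D_def mult.assoc)
    qed
    have "nm (comb a \<sigma> (A - E)) \<le> C * nm (comb a id (A - E))"
      by (rule C(2)) (use A in \<open>auto simp: E_def inj_on_def\<close>)
    also have "nm (comb a id (A - E)) \<le> nm (comb a id A) + nm (comb a id E)"
    proof -
      have eq: "comb a id (A - E) = comb a id A - comb a id E"
        unfolding comb_union[OF A(1) E(1), of a id] by (simp add: fun_eq_iff)
      show ?thesis unfolding eq by (rule nm_diff_le[OF comb_V comb_V])
    qed
    also have "\<dots> \<le> f + D * f" using exc by (simp add: f_def)
    finally have rest: "nm (comb a \<sigma> (A - E)) \<le> C * (f + D * f)" using C(1) by simp
    have "nm (comb a \<sigma> A) \<le> nm (comb a \<sigma> E) + nm (comb a \<sigma> (A - E))"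
      unfolding comb_union[OF A(1) E(1), of a \<sigma>] by (rule nm_add[OF comb_V comb_V])
    also have "\<dots> \<le> D * f + C * (f + D * f)" by (rule add_mono[OF exc rest])
    also have "\<dots> \<le> (D + C * (1 + D) + 1) * f" using f by (simp add: algebra_simps)
    finally show ?thesis by (simp add: f_def)
  qed
  then show ?thesis using C(1) D by (intro exI[of _ "D + C * (1 + D) + 1"]) auto
qed

text \<open>Relabelling the coefficients along the inverse of \<open>\<tau>\<close> turns
  \<open>\<tau>\<close> into the identity.\<close>

lemma symmetric_constant:
  "\<exists>C\<ge>1. \<forall>(A::nat set) \<sigma> \<tau> a. finite A \<longrightarrow> inj_on \<sigma> A \<longrightarrow> inj_on \<tau> A \<longrightarrow> nm (comb a \<sigma> A) \<le> C * nm (comb a \<tau> A)"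
proof -
  obtain C where C: "1 \<le> C" "\<And>A \<sigma> a. finite A \<Longrightarrow> inj_on \<sigma> A \<Longrightarrow> nm (comb a \<sigma> A) \<le> C * nm (comb a id A)"
    using symmetric_constant_id by blast
  have "nm (comb a \<sigma> A) \<le> C * nm (comb a \<tau> A)"
    if A: "finite A" "inj_on \<sigma> A" "inj_on \<tau> A" for A :: "nat set" and \<sigma> \<tau> a
  proof -
    define g where "g = the_inv_into A \<tau>"
    have g: "g (\<tau> x) = x" if "x \<in> A" for x using the_inv_into_f_f[OF A(3) that] by (simp add: g_def)
    have "comb (a \<circ> g) (\<sigma> \<circ> g) (\<tau> ` A) = comb a \<sigma> A" "comb (a \<circ> g) id (\<tau> ` A) = comb a \<tau> A"
      unfolding sum.reindex[OF A(3)] by (rule sum.cong, auto simp: g)+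
    moreover have "inj_on (\<sigma> \<circ> g) (\<tau> ` A)" using A(2) g by (auto simp: inj_on_def)
    ultimately show ?thesis using C(2)[of "\<tau> ` A" "\<sigma> \<circ> g" "a \<circ> g"] A(1) by (simp only: finite_imageI)
  qed
  then show ?thesis using C(1) by blast
qed

text \<open>Unconditionality follows from symmetry: an injection fixes \<open>E\<close> and moves
  the rest of \<open>A\<close> beyond an index \<open>m\<close>, and truncation at \<open>m\<close>
  then leaves exactly the \<open>E\<close> part.\<close>

lemma suppression_constant:
  "\<exists>C\<ge>1. \<forall>A E a. finite A \<longrightarrow> E \<subseteq> A \<longrightarrow> nm (comb a id E) \<le> C * nm (comb a id A)"
proof -
  obtain C where C: "1 \<le> C" "\<And>(A::nat set) \<sigma> \<tau> a. finite A \<Longrightarrow> inj_on \<sigma> A \<Longrightarrow> inj_on \<tau> A \<Longrightarrow> nm (comb a \<sigma> A) \<le> C * nm (comb a \<tau> A)"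
    using symmetric_constant by blast
  obtain K where K: "1 \<le> K" "\<And>A a m. finite A \<Longrightarrow>
     nm (\<Sum>j\<in>A \<inter> {..<m}. seq_scale (a j) (B j)) \<le> K * nm (\<Sum>j\<in>A. seq_scale (a j) (B j))"
    using basis_constant by blast
  have "nm (comb a id E) \<le> C * K * nm (comb a id A)" if A: "finite A" "E \<subseteq> A" for A E a
  proof -
    define m where "m = Suc (Max (insert 0 A))"
    have m: "x < m" if "x \<in> A" for x
      unfolding m_def less_Suc_eq_le by (rule Max_ge) (use that A in auto)
    define \<rho> where "\<rho> x = (if x \<in> E then x else x + m)" for x
    define g where "g y = (if y < m then y else y - m)" for y
    have g: "g (\<rho> x) = x" if "x \<in> A" for x using m[OF that] by (simp add: g_def \<rho>_def)
    have inj: "inj_on \<rho> A" using g by (rule inj_on_inverseI)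
    have "\<rho> ` A \<inter> {..<m} = E" using A(2) m by (auto simp: \<rho>_def image_iff split: if_splits)
    then have "comb a id E = comb (a \<circ> g) id (\<rho> ` A \<inter> {..<m})"
      using m A(2) by (intro sum.cong) (auto simp: g_def)
    moreover have "nm (comb (a \<circ> g) id (\<rho> ` A \<inter> {..<m})) \<le> K * nm (comb (a \<circ> g) id (\<rho> ` A))"
      unfolding id_apply by (rule K(2)) (use A in simp)
    moreover have "comb (a \<circ> g) id (\<rho> ` A) = comb a \<rho> A"
      unfolding sum.reindex[OF inj] by (rule sum.cong) (auto simp: g)
    moreover have "K * nm (comb a \<rho> A) \<le> K * (C * nm (comb a id A))"
      using K(1) by (intro mult_left_mono C A inj) auto
    ultimately show ?thesis by (simp only: mult.assoc mult.left_commute[of C K])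
  qed
  then show ?thesis using C(1) K(1) by (intro exI[of _ "C * K"]) (auto intro: mult_ge1_I)
qed

end

section \<open>Garling spaces as F-normed spaces\<close>

lemma powr_add_le:
  fixes a b p :: real
  assumes "0 \<le> a" "0 \<le> b" "0 < p" "p \<le> 1"
  shows "(a + b) powr p \<le> a powr p + b powr p"
proof (cases "a = 0 \<or> b = 0")
  case True
  then show ?thesis using assms by auto
next
  case False
  then have ab: "0 < a" "0 < b" using assms by auto
  have split: "x powr p = x * x powr (p - 1)" if "0 < x" for x :: real
    using that powr_add[of x 1 "p - 1"] by simp
  have "(a + b) powr p = a * (a + b) powr (p - 1) + b * (a + b) powr (p - 1)"
    using ab by (subst split) (auto simp: distrib_right)
  also have "\<dots> \<le> a * a powr (p - 1) + b * b powr (p - 1)"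
    using ab assms by (intro add_mono mult_left_mono powr_mono2') auto
  finally show ?thesis using ab split by metis
qed

text \<open>When \<open>a\<close> or \<open>b\<close> is 0 the claim reduces to
  \<open>s powr p \<le> s\<close> on the unit interval; for positive values it is convexity of the
  power.\<close>

lemma powr_convex_nonneg:
  fixes a b p t :: real
  assumes "0 \<le> a" "0 \<le> b" "1 \<le> p" "0 \<le> t" "t \<le> 1"
  shows "(t * a + (1 - t) * b) powr p \<le> t * a powr p + (1 - t) * b powr p"
proof -
  have shrink: "(s * c) powr p \<le> s * c powr p" if "0 \<le> s" "s \<le> 1" "0 \<le> c" for s c :: real
  proof -
    have "s powr p \<le> s powr 1" if "0 < s" using that \<open>s \<le> 1\<close> assms(3) by (intro powr_mono') auto
    then have "s powr p \<le> s" using that(1) by (cases "s = 0") auto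
    then show ?thesis using that by (simp add: powr_mult mult_right_mono)
  qed
  consider "a = 0" | "b = 0" | "0 < a" "0 < b" using assms by linarith
  then show ?thesis
  proof cases
    case 1
    then show ?thesis using shrink[of "1 - t" b] assms by simp
  next
    case 2
    then show ?thesis using shrink[of t a] assms by simp
  next
    case 3
    then show ?thesis using convex_onD[OF powr_convex[OF assms(3)], of t b a] assms
      by (simp add: algebra_simps)
  qed
qed

lemma gsum_map_upt: "gsum w u m (map \<phi> [0..<n]) = (\<Sum>j<n. u (\<phi> j) * w (m + j))"
  by (induction n) (auto simp: gsum_append mult.commute)

lemma strict_sorted_extend:
  assumes "sorted_wrt (<) (xs :: nat list)"
  shows "\<exists>\<phi>. strict_mono \<phi> \<and> map \<phi> [0..<length xs] = xs"
proof -
  \<comment> \<open>The sum of the list dominates each of its entries, so the continuation starts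
    above all of them.\<close>
  define \<phi> where "\<phi> j = (if j < length xs then xs ! j else Suc (sum_list xs + j))" for j
  have "strict_mono \<phi>"
  proof (rule strict_monoI_Suc)
    fix n
    have "xs ! n \<le> sum_list xs" if "n < length xs" using that by (intro member_le_sum_list) auto
    then show "\<phi> n < \<phi> (Suc n)"
      using sorted_wrt_nth_less[OF assms, of n "Suc n"] by (fastforce simp: \<phi>_def)
  qed
  moreover have "map \<phi> [0..<length xs] = xs" by (rule nth_equalityI) (auto simp: \<phi>_def)
  ultimately show ?thesis by blast
qed

lemma tendsto_gsum:
  assumes "\<And>k. (\<lambda>n. f n k) \<longlonglongrightarrow> g k"
  shows "(\<lambda>n. gsum w (f n) m xs) \<longlonglongrightarrow> gsum w g m xs"
  by (induction xs arbitrary: m) (auto intro!: tendsto_intros assms)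

locale garling = weight w for w + fixes p :: real assumes p_pos: "0 < p"
begin

definition mod_pow :: "(nat \<Rightarrow> 'a::{real_normed_field, heine_borel}) \<Rightarrow> nat \<Rightarrow> real"
  where "mod_pow x k = norm (x k) powr p"

definition D :: "(nat \<Rightarrow> 'a::{real_normed_field, heine_borel}) \<Rightarrow> real"
  where "D x = gsup w (mod_pow x)"

text \<open>The power \<open>min 1 p\<close> of the quasi-norm satisfies the triangle inequality.\<close>

definition gnm :: "(nat \<Rightarrow> 'a::{real_normed_field, heine_borel}) \<Rightarrow> real"
  where "gnm x = garling_norm w p x powr min 1 p"

lemma mod_pow_nonneg: "0 \<le> mod_pow x k" by (simp add: mod_pow_def)

lemma partial_sum_gsum:
  "(\<Sum>j<n. norm (x (\<phi> j)) powr p * w j) = gsum w (mod_pow x) 0 (map \<phi> [0..<n])"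
  by (simp add: gsum_map_upt mod_pow_def)

lemma gbdd_suminf_le:
  assumes "gbdd w (mod_pow x)" "strict_mono \<phi>"
  shows "summable (\<lambda>j. norm (x (\<phi> j)) powr p * w j)"
    and "(\<Sum>j. norm (x (\<phi> j)) powr p * w j) \<le> D x"
proof -
  have le: "(\<Sum>j<n. norm (x (\<phi> j)) powr p * w j) \<le> D x" for n
    unfolding partial_sum_gsum D_def
    by (rule gsum_le_gsup[OF assms(1)])
       (use assms(2) in \<open>auto simp: sorted_wrt_map strict_mono_def intro: sorted_wrt_mono_rel[OF _ sorted_wrt_upt]\<close>)
  show s: "summable (\<lambda>j. norm (x (\<phi> j)) powr p * w j)"
    by (rule summableI_nonneg_bounded[OF _ le]) (simp add: w_nonneg)
  show "(\<Sum>j. norm (x (\<phi> j)) powr p * w j) \<le> D x"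
    by (rule suminf_le_const[OF s le])
qed

lemma gsum_le_suminf:
  assumes "\<And>\<phi>. strict_mono \<phi> \<Longrightarrow> summable (\<lambda>j. norm (x (\<phi> j)) powr p * w j)"
    and "sorted_wrt (<) xs"
  shows "\<exists>\<phi>. strict_mono \<phi> \<and> gsum w (mod_pow x) 0 xs \<le> (\<Sum>j. norm (x (\<phi> j)) powr p * w j)"
proof -
  obtain \<phi> where ph: "strict_mono \<phi>" "map \<phi> [0..<length xs] = xs" using strict_sorted_extend[OF assms(2)] by blast
  have "gsum w (mod_pow x) 0 xs = (\<Sum>j<length xs. norm (x (\<phi> j)) powr p * w j)"
    unfolding partial_sum_gsum ph(2) ..
  also have "\<dots> \<le> (\<Sum>j. norm (x (\<phi> j)) powr p * w j)"
    by (rule sum_le_suminf[OF assms(1)[OF ph(1)]]) (simp_all add: w_nonneg)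
  finally show ?thesis by (intro exI[of _ \<phi>] conjI ph(1))
qed

lemma gsum_powr_le:
  assumes "\<And>\<phi>. strict_mono \<phi> \<Longrightarrow> summable (\<lambda>j. norm (x (\<phi> j)) powr p * w j)"
    and "\<And>\<phi>. strict_mono \<phi> \<Longrightarrow> (\<Sum>j. norm (x (\<phi> j)) powr p * w j) powr (1 / p) \<le> M"
    and "sorted_wrt (<) xs"
  shows "gsum w (mod_pow x) 0 xs \<le> M powr p"
proof -
  have "\<exists>\<phi>. strict_mono \<phi> \<and> gsum w (mod_pow x) 0 xs \<le> (\<Sum>j. norm (x (\<phi> j)) powr p * w j)"
    by (rule gsum_le_suminf, rule assms(1), assumption, rule assms(3))
  then obtain \<phi> where ph: "strict_mono \<phi>" "gsum w (mod_pow x) 0 xs \<le> (\<Sum>j. norm (x (\<phi> j)) powr p * w j)"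
    by (elim exE conjE)
  have nn: "0 \<le> (\<Sum>j. norm (x (\<phi> j)) powr p * w j)"
    by (rule suminf_nonneg[OF assms(1)[OF ph(1)]]) (simp add: w_nonneg)
  have "((\<Sum>j. norm (x (\<phi> j)) powr p * w j) powr (1 / p)) powr p \<le> M powr p"
    by (rule powr_mono2[OF less_imp_le[OF p_pos] powr_ge_zero assms(2)[OF ph(1)]])
  then have "(\<Sum>j. norm (x (\<phi> j)) powr p * w j) \<le> M powr p" using nn p_pos by (simp add: powr_powr)
  with ph(2) show ?thesis by (rule order_trans)
qed

text \<open>This lemma and \<open>garling_norm_eq\<close> pass from infinite increasing maps to
  finite selections: every finite selection extends to such a map, and partial sums along a map are
  finite selections.\<close>

lemma garling_space_iff: "x \<in> garling_space w p \<longleftrightarrow> gbdd w (mod_pow x)"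
proof
  assume x: "x \<in> garling_space w p"
  then obtain M where M: "\<And>\<phi>. strict_mono \<phi> \<Longrightarrow> (\<Sum>j. norm (x (\<phi> j)) powr p * w j) powr (1 / p) \<le> M"
    by (auto simp: garling_space_def bdd_above_def)
  show "gbdd w (mod_pow x)"
    by (rule gbddI[of _ _ "M powr p"], rule gsum_powr_le) (use x M in \<open>auto simp: garling_space_def\<close>)
next
  assume g: "gbdd w (mod_pow x)"
  have "(\<Sum>j. norm (x (\<phi> j)) powr p * w j) powr (1 / p) \<le> D x powr (1 / p)" if "strict_mono \<phi>" for \<phi>
    using gbdd_suminf_le[OF g that] p_pos by (intro powr_mono2 suminf_nonneg) (auto simp: w_nonneg)
  then show "x \<in> garling_space w p"
    using gbdd_suminf_le(1)[OF g] by (auto simp: garling_space_def bdd_above_def)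
qed

lemma D_nonneg: "x \<in> garling_space w p \<Longrightarrow> 0 \<le> D x"
  unfolding garling_space_iff D_def by (rule gsup_nonneg)

lemma garling_norm_eq:
  assumes "x \<in> garling_space w p"
  shows "garling_norm w p x = D x powr (1 / p)"
proof (rule antisym)
  have g: "gbdd w (mod_pow x)" using assms by (simp add: garling_space_iff)
  have le: "(\<Sum>j. norm (x (\<phi> j)) powr p * w j) powr (1 / p) \<le> D x powr (1 / p)" if "strict_mono \<phi>" for \<phi>
    using gbdd_suminf_le[OF g that] p_pos by (intro powr_mono2 suminf_nonneg) (auto simp: w_nonneg)
  have ne: "{\<phi>. strict_mono (\<phi> :: nat \<Rightarrow> nat)} \<noteq> {}" using strict_mono_id by blast
  show "garling_norm w p x \<le> D x powr (1 / p)"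
    unfolding garling_norm_def by (rule cSUP_least[OF ne]) (use le in auto)
  have up: "(\<Sum>j. norm (x (\<phi> j)) powr p * w j) powr (1 / p) \<le> garling_norm w p x" if "strict_mono \<phi>" for \<phi>
    unfolding garling_norm_def by (rule cSUP_upper) (use that assms in \<open>auto simp: garling_space_def\<close>)
  have "D x \<le> garling_norm w p x powr p"
    unfolding D_def by (rule gsup_le, rule gsum_powr_le) (use up gbdd_suminf_le(1)[OF g] in auto)
  then have "D x powr (1 / p) \<le> (garling_norm w p x powr p) powr (1 / p)"
    using p_pos D_nonneg[OF assms] by (intro powr_mono2) auto
  moreover have "0 \<le> garling_norm w p x"
    using up[OF strict_mono_id] powr_ge_zero order_trans by blast
  ultimately show "D x powr (1 / p) \<le> garling_norm w p x" using p_pos by (simp add: powr_powr)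
qed

text \<open>The exponent arises as \<open>min 1 p / p = 1 / max 1 p\<close>.\<close>

lemma gnm_eq: "x \<in> garling_space w p \<Longrightarrow> gnm x = D x powr (1 / max 1 p)"
  using p_pos by (auto simp: gnm_def garling_norm_eq powr_powr min_def max_def)

lemma D_eq: "x \<in> garling_space w p \<Longrightarrow> D x = gnm x powr max 1 p"
  using p_pos D_nonneg[of x] by (simp add: gnm_eq powr_powr)

lemma gsum_le_D: "x \<in> garling_space w p \<Longrightarrow> sorted_wrt (<) xs \<Longrightarrow> gsum w (mod_pow x) 0 xs \<le> D x"
  unfolding garling_space_iff D_def by (rule gsum_le_gsup)

lemma garling_spaceI: "(\<And>xs. sorted_wrt (<) xs \<Longrightarrow> gsum w (mod_pow x) 0 xs \<le> M) \<Longrightarrow> x \<in> garling_space w p"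
  unfolding garling_space_iff by (rule gbddI)

lemma D_leI: "(\<And>xs. sorted_wrt (<) xs \<Longrightarrow> gsum w (mod_pow x) 0 xs \<le> M) \<Longrightarrow> D x \<le> M"
  unfolding D_def by (rule gsup_le)

lemma garling_space_mono:
  assumes "y \<in> garling_space w p" "\<And>k. norm (x k) \<le> norm (y k)"
  shows "x \<in> garling_space w p" "D x \<le> D y"
proof -
  have le: "mod_pow x k \<le> mod_pow y k" for k
    unfolding mod_pow_def using assms(2) p_pos by (intro powr_mono2) auto
  show "x \<in> garling_space w p" using gbdd_mono[OF _ le] assms(1) by (simp add: garling_space_iff)
  show "D x \<le> D y" unfolding D_def using gsup_mono[OF _ le] assms(1) by (simp add: garling_space_iff)
qed

lemma mod_pow_le_D: "x \<in> garling_space w p \<Longrightarrow> mod_pow x k \<le> D x"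
  unfolding D_def garling_space_iff by (rule le_gsup)

lemma mod_pow_scale: "mod_pow (seq_scale c x) k = norm c powr p * mod_pow x k"
  by (simp add: mod_pow_def seq_scale_def norm_mult powr_mult)

lemma mod_pow_add: "mod_pow (x + y) k \<le> 2 powr p * (mod_pow x k + mod_pow y k)"
proof -
  define M where "M = max (norm (x k)) (norm (y k))"
  have "norm (x k + y k) \<le> 2 * M" using norm_triangle_ineq[of "x k" "y k"] by (simp add: M_def)
  then have "mod_pow (x + y) k \<le> (2 * M) powr p" unfolding mod_pow_def using p_pos by (intro powr_mono2) auto
  also have "\<dots> = 2 powr p * M powr p" by (subst powr_mult) (auto simp: M_def)
  also have "M powr p \<le> mod_pow x k + mod_pow y k" by (simp add: M_def max_def mod_pow_def)
  finally show ?thesis by simp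
qed

lemma garling_space_add:
  fixes x y :: "nat \<Rightarrow> 'a::{real_normed_field, heine_borel}"
  assumes "x \<in> garling_space w p" "y \<in> garling_space w p"
  shows "x + y \<in> garling_space w p"
proof -
  have "gbdd w (\<lambda>k. 2 powr p * (mod_pow x k + mod_pow y k))"
    using assms by (intro gbdd_cmult gbdd_add) (auto simp: garling_space_iff)
  then show ?thesis unfolding garling_space_iff by (rule gbdd_mono) (rule mod_pow_add)
qed

lemma garling_space_scale:
  fixes x :: "nat \<Rightarrow> 'a::{real_normed_field, heine_borel}"
  shows "x \<in> garling_space w p \<Longrightarrow> seq_scale c x \<in> garling_space w p"
  unfolding garling_space_iff mod_pow_scale[abs_def] by (intro gbdd_cmult) auto

lemma D_scale: "x \<in> garling_space w p \<Longrightarrow> D (seq_scale c x) = norm c powr p * D x"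
  unfolding garling_space_iff D_def mod_pow_scale[abs_def] by (intro gsup_cmult) auto

lemma garling_norm_uminus: "garling_norm w p (- x) = garling_norm w p x"
  by (simp add: garling_norm_def)

text \<open>For \<open>p \<le> 1\<close> the functional \<open>gnm\<close> is \<open>D\<close>
  itself, and the \<open>p\<close>-th power is subadditive at each coordinate.\<close>

lemma gnm_add_small:
  fixes x y :: "nat \<Rightarrow> 'a::{real_normed_field, heine_borel}"
  assumes x: "x \<in> garling_space w p" and y: "y \<in> garling_space w p" and p: "p \<le> 1"
  shows "gnm (x + y) \<le> gnm x + gnm y"
proof -
  have le: "mod_pow (x + y) k \<le> mod_pow x k + mod_pow y k" for k
  proof -
    have "mod_pow (x + y) k \<le> (norm (x k) + norm (y k)) powr p"
      unfolding mod_pow_def using p_pos norm_triangle_ineq by (intro powr_mono2) auto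
    also have "\<dots> \<le> mod_pow x k + mod_pow y k"
      unfolding mod_pow_def using p_pos p by (intro powr_add_le) auto
    finally show ?thesis .
  qed
  have "gsup w (mod_pow (x + y)) \<le> gsup w (\<lambda>k. mod_pow x k + mod_pow y k)"
    by (rule gsup_mono[OF gbdd_add le]) (use x y in \<open>auto simp: garling_space_iff\<close>)
  also have "\<dots> \<le> gsup w (mod_pow x) + gsup w (mod_pow y)"
    by (rule gsup_add) (use x y in \<open>auto simp: garling_space_iff\<close>)
  finally have "D (x + y) \<le> D x + D y" by (simp add: D_def)
  moreover have "gnm z = D z" if "z \<in> garling_space w p" for z :: "nat \<Rightarrow> 'a"
    using gnm_eq[OF that] D_nonneg[OF that] p by (simp add: max_absorb1)
  ultimately show ?thesis using x y garling_space_add[OF x y] by simp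
qed

text \<open>Minkowski's inequality from convexity: the sum of the moduli is
  \<open>\<alpha> + \<beta>\<close> times a convex combination of the moduli divided by
  \<open>\<alpha>\<close> and \<open>\<beta>\<close>, and a selection is linear in the
  \<open>p\<close>-th powers.\<close>

lemma gnm_add_large:
  assumes x: "x \<in> garling_space w p" and y: "y \<in> garling_space w p" and p: "1 \<le> p"
  shows "gnm (x + y) \<le> gnm x + gnm y"
proof (rule field_le_epsilon)
  fix e :: real assume e: "0 < e"
  \<comment> \<open>The margin \<open>e / 2\<close> makes the divisors positive even when
    \<open>x\<close> or \<open>y\<close> is 0.\<close>
  define \<alpha> where "\<alpha> = gnm x + e / 2"
  define \<beta> where "\<beta> = gnm y + e / 2"
  define t where "t = \<alpha> / (\<alpha> + \<beta>)"
  have ab: "0 < \<alpha>" "0 < \<beta>" using e by (auto simp: \<alpha>_def \<beta>_def gnm_def add_nonneg_pos)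
  have t: "0 \<le> t" "t \<le> 1" "1 - t = \<beta> / (\<alpha> + \<beta>)" using ab by (auto simp: t_def field_simps)
  have Dx: "D x \<le> \<alpha> powr p" and Dy: "D y \<le> \<beta> powr p"
    using p x y e by (auto simp: D_eq max_def \<alpha>_def \<beta>_def gnm_def intro!: powr_mono2)
  define s where "s = (\<alpha> + \<beta>) powr p"
  have s: "0 < s" using ab by (simp add: s_def)
  have pt: "mod_pow (x + y) k \<le> s * t / \<alpha> powr p * mod_pow x k + s * (1 - t) / \<beta> powr p * mod_pow y k" for k
  proof -
    have "mod_pow (x + y) k \<le> (norm (x k) + norm (y k)) powr p"
      unfolding mod_pow_def using p_pos norm_triangle_ineq by (intro powr_mono2) auto
    also have "norm (x k) + norm (y k) = (\<alpha> + \<beta>) * (t * (norm (x k) / \<alpha>) + (1 - t) * (norm (y k) / \<beta>))"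
    proof -
      have "(\<alpha> + \<beta>) * t = \<alpha>" using ab by (simp add: t_def)
      moreover from this have "(\<alpha> + \<beta>) * (1 - t) = \<beta>" by (simp add: right_diff_distrib)
      ultimately have "(\<alpha> + \<beta>) * (t * (norm (x k) / \<alpha>) + (1 - t) * (norm (y k) / \<beta>)) =
          \<alpha> * (norm (x k) / \<alpha>) + \<beta> * (norm (y k) / \<beta>)"
        unfolding distrib_left mult.assoc[symmetric] by (simp only:)
      then show ?thesis using ab by simp
    qed
    also have "\<dots> powr p = s * (t * (norm (x k) / \<alpha>) + (1 - t) * (norm (y k) / \<beta>)) powr p"
      unfolding s_def using ab t by (simp add: powr_mult)
    also have "\<dots> \<le> s * (t * (norm (x k) / \<alpha>) powr p + (1 - t) * (norm (y k) / \<beta>) powr p)"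
      using s ab t p by (intro mult_left_mono powr_convex_nonneg) auto
    also have "\<dots> = s * t / \<alpha> powr p * mod_pow x k + s * (1 - t) / \<beta> powr p * mod_pow y k"
      using ab by (simp add: powr_divide mod_pow_def field_simps)
    finally show ?thesis .
  qed
  have "D (x + y) \<le> s"
  proof (rule D_leI)
    fix xs :: "nat list" assume xs: "sorted_wrt (<) xs"
    have "gsum w (mod_pow (x + y)) 0 xs
      \<le> gsum w (\<lambda>k. s * t / \<alpha> powr p * mod_pow x k + s * (1 - t) / \<beta> powr p * mod_pow y k) 0 xs"
      by (rule gsum_mono) (rule pt)
    also have "\<dots> = s * t / \<alpha> powr p * gsum w (mod_pow x) 0 xs + s * (1 - t) / \<beta> powr p * gsum w (mod_pow y) 0 xs"
      unfolding gsum_add gsum_cmult ..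
    also have "\<dots> \<le> s * t / \<alpha> powr p * \<alpha> powr p + s * (1 - t) / \<beta> powr p * \<beta> powr p"
      using gsum_le_D[OF x xs] gsum_le_D[OF y xs] Dx Dy s t ab
      by (intro add_mono mult_left_mono) (auto intro: divide_nonneg_nonneg)
    also have "\<dots> = s" using ab by (simp add: field_simps)
    finally show "gsum w (mod_pow (x + y)) 0 xs \<le> s" .
  qed
  then have "D (x + y) powr (1 / p) \<le> s powr (1 / p)"
    using p D_nonneg[OF garling_space_add[OF x y]] by (intro powr_mono2) auto
  also have "s powr (1 / p) = \<alpha> + \<beta>" using ab p by (simp add: s_def powr_powr)
  finally show "gnm (x + y) \<le> gnm x + gnm y + e"
    using p garling_space_add[OF x y] by (simp add: gnm_eq max_def \<alpha>_def \<beta>_def)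
qed

lemma norm_le_gnm: "x \<in> garling_space w p \<Longrightarrow> norm (x k) powr min 1 p \<le> gnm x"
proof -
  assume x: "x \<in> garling_space w p"
  have "(norm (x k) powr p) powr (1 / max 1 p) \<le> D x powr (1 / max 1 p)"
    using mod_pow_le_D[OF x, of k] by (intro powr_mono2) (auto simp: mod_pow_def)
  moreover have "p * (1 / max 1 p) = min 1 p" using p_pos by (auto simp: min_def max_def)
  ultimately show ?thesis using gnm_eq[OF x] by (simp add: powr_powr)
qed

text \<open>Coordinates are controlled by \<open>gnm\<close>, so a pointwise limit exists. Each
  finite selection is continuous in finitely many coordinates, so the Cauchy bounds pass to the
  limit before the supremum is taken.\<close>

lemma gnm_complete:
  fixes X :: "nat \<Rightarrow> nat \<Rightarrow> 'a::{real_normed_field, heine_borel}"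
  assumes X: "\<And>n. X n \<in> garling_space w p"
    and C: "\<And>e. 0 < e \<Longrightarrow> \<exists>N. \<forall>m\<ge>N. \<forall>n\<ge>N. gnm (X m - X n) < e"
  shows "\<exists>x\<in>garling_space w p. (\<lambda>n. gnm (X n - x)) \<longlonglongrightarrow> 0"
proof -
  have minus: "x - y \<in> garling_space w p" if "x \<in> garling_space w p" "y \<in> garling_space w p" for x y :: "nat \<Rightarrow> 'a"
    using garling_space_add[OF that(1) garling_space_scale[OF that(2), of "- 1"]]
    by (simp add: seq_scale_def plus_fun_def fun_diff_def)
  have "convergent (\<lambda>n. X n k)" for k
  proof (rule Cauchy_convergent, rule CauchyI)
    fix e :: real assume e: "0 < e"
    obtain N where N: "\<And>m n. m \<ge> N \<Longrightarrow> n \<ge> N \<Longrightarrow> gnm (X m - X n) < e powr min 1 p"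
      using C[of "e powr min 1 p"] e by auto
    have "norm (X m k - X n k) < e" if "m \<ge> N" "n \<ge> N" for m n
    proof (rule ccontr)
      assume "\<not> ?thesis"
      then have "e powr min 1 p \<le> norm ((X m - X n) k) powr min 1 p"
        using e p_pos by (intro powr_mono2) auto
      then show False using norm_le_gnm[OF minus[OF X X], of m n k] N[OF that] by linarith
    qed
    then show "\<exists>M. \<forall>m\<ge>M. \<forall>n\<ge>M. norm (X m k - X n k) < e" by blast
  qed
  then obtain x where x: "\<And>k. (\<lambda>n. X n k) \<longlonglongrightarrow> x k" unfolding convergent_def by metis
  have lim: "(\<lambda>m. mod_pow (X m - X n) k) \<longlonglongrightarrow> mod_pow (x - X n) k" for n k
    unfolding mod_pow_def fun_diff_def
    by (rule tendsto_powr') (use p_pos in \<open>auto intro!: tendsto_intros x\<close>)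
  have key: "\<exists>N. \<forall>n\<ge>N. x - X n \<in> garling_space w p \<and> gnm (x - X n) \<le> e" if e: "0 < e" for e
  proof -
    obtain N where N: "\<And>m n. m \<ge> N \<Longrightarrow> n \<ge> N \<Longrightarrow> gnm (X m - X n) < e" using C[OF e] by blast
    have gs: "gsum w (mod_pow (x - X n)) 0 xs \<le> e powr max 1 p" if "n \<ge> N" "sorted_wrt (<) xs" for n xs
    proof (rule tendsto_upperbound[OF tendsto_gsum[OF lim]])
      have "gsum w (mod_pow (X m - X n)) 0 xs \<le> e powr max 1 p" if "m \<ge> N" for m
      proof -
        have "gsum w (mod_pow (X m - X n)) 0 xs \<le> D (X m - X n)" by (rule gsum_le_D[OF minus[OF X X]]) fact
        also have "\<dots> \<le> e powr max 1 p"
          unfolding D_eq[OF minus[OF X X]] using N[OF that \<open>n \<ge> N\<close>]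
          by (intro powr_mono2) (auto simp: gnm_def)
        finally show ?thesis .
      qed
      then show "\<forall>\<^sub>F m in sequentially. gsum w (mod_pow (X m - X n)) 0 xs \<le> e powr max 1 p"
        by (auto simp: eventually_sequentially)
    qed simp
    have "x - X n \<in> garling_space w p \<and> gnm (x - X n) \<le> e" if "n \<ge> N" for n
    proof
      show g: "x - X n \<in> garling_space w p" by (rule garling_spaceI[OF gs[OF that]])
      have "D (x - X n) \<le> e powr max 1 p" by (rule D_leI[OF gs[OF that]])
      then have "D (x - X n) powr (1 / max 1 p) \<le> (e powr max 1 p) powr (1 / max 1 p)"
        using D_nonneg[OF g] by (intro powr_mono2) auto
      moreover have "max 1 p \<noteq> 0" by (simp add: max_def)
      ultimately show "gnm (x - X n) \<le> e" using e g by (simp add: gnm_eq powr_powr)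
    qed
    then show ?thesis by blast
  qed
  obtain n where "x - X n \<in> garling_space w p" using key[OF zero_less_one] by blast
  from garling_space_add[OF this X[of n]] have xV: "x \<in> garling_space w p" by (simp add: plus_fun_def fun_diff_def)
  have "(\<lambda>n. gnm (X n - x)) \<longlonglongrightarrow> 0"
  proof (rule LIMSEQ_I)
    fix e :: real assume e: "0 < e"
    obtain N where "\<forall>n\<ge>N. gnm (x - X n) \<le> e / 2" using key[of "e / 2"] e by auto
    moreover have "gnm (X n - x) = gnm (x - X n)" for n
      using garling_norm_uminus[of "x - X n"] by (simp add: gnm_def)
    ultimately have "\<forall>n\<ge>N. norm (gnm (X n - x) - 0) < e" using e by (force simp: gnm_def)
    then show "\<exists>N. \<forall>n\<ge>N. norm (gnm (X n - x) - 0) < e" by blast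
  qed
  with xV show ?thesis by blast
qed

lemma gnm_fspace: "fspace (garling_space w p :: (nat \<Rightarrow> 'a::{real_normed_field, heine_borel}) set) gnm (min 1 p)"
proof
  show "0 \<in> (garling_space w p :: (nat \<Rightarrow> 'a) set)"
    by (rule garling_spaceI[of _ 0]) (simp add: mod_pow_def[abs_def])
  show "x = 0" if "x \<in> garling_space w p" "gnm x = 0" for x :: "nat \<Rightarrow> 'a"
  proof
    fix k
    have "norm (x k) powr min 1 p \<le> 0" using norm_le_gnm[OF that(1), of k] that(2) by simp
    then show "x k = 0 k" by (simp add: zero_fun_def)
  qed
  show "gnm (x + y) \<le> gnm x + gnm y" if "x \<in> garling_space w p" "y \<in> garling_space w p" for x y :: "nat \<Rightarrow> 'a"
    using gnm_add_small[OF that] gnm_add_large[OF that] by linarith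
  show "gnm (seq_scale c x) = norm c powr min 1 p * gnm x" if x: "x \<in> garling_space w p" for c and x :: "nat \<Rightarrow> 'a"
  proof -
    have "p * (1 / max 1 p) = min 1 p" using p_pos by (auto simp: min_def max_def)
    then show ?thesis
      using D_nonneg[OF x] garling_space_scale[OF x] x by (simp add: gnm_eq D_scale powr_mult powr_powr)
  qed
  show "\<exists>x\<in>garling_space w p. (\<lambda>n. gnm (X n - x)) \<longlonglongrightarrow> 0"
    if X: "\<And>n. X n \<in> garling_space w p"
      and C: "\<And>e. 0 < e \<Longrightarrow> \<exists>N. \<forall>m\<ge>N. \<forall>n\<ge>N. gnm (X m - X n) < e" for X :: "nat \<Rightarrow> nat \<Rightarrow> 'a"
    by (rule gnm_complete, rule X, erule C)
qed (use p_pos in \<open>auto simp: gnm_def garling_norm_uminus garling_space_add garling_space_scale\<close>)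

end

section \<open>Approximation by blocks\<close>

context weight
begin

lemma finite_large:
  assumes "gbdd w u" "\<And>k. 0 \<le> u k" "0 < \<epsilon>"
  shows "finite {k. \<epsilon> \<le> u k}"
proof (rule ccontr)
  assume inf: "infinite {k. \<epsilon> \<le> u k}"
  obtain h where h: "gsup w u / \<epsilon> < (\<Sum>i<h. w i)" using w_sum_unbounded by blast
  obtain S where S: "S \<subseteq> {k. \<epsilon> \<le> u k}" "card S = h" "finite S"
    using infinite_arbitrarily_large[OF inf, of h] by blast
  define xs where "xs = sorted_list_of_set S"
  have xs: "sorted_wrt (<) xs" "set xs = S" "length xs = h" using S by (auto simp: xs_def)
  have "gsup w u < \<epsilon> * (\<Sum>i<h. w i)" using h assms(3) by (simp add: field_simps)
  also have "\<dots> \<le> gsum w u 0 xs" using gsum_ge_length[of xs \<epsilon> u 0] S(1) xs by auto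
  also have "\<dots> \<le> gsup w u" by (rule gsum_le_gsup[OF assms(1) xs(1)])
  finally show False by simp
qed

text \<open>In the space this says that finitely supported sequences are dense. If all tails had
  norm at least \<open>\<delta>\<close>, selections from later and later tails could be
  concatenated: far out all coordinates are tiny, so starting late costs at most
  \<open>\<delta> / 4\<close>, and the total would exceed \<open>gsup w u\<close>.\<close>

lemma gsup_tail_small:
  assumes u: "gbdd w u" "\<And>k. 0 \<le> u k" and e: "0 < \<delta>"
  shows "\<exists>n\<ge>n0. gsup w (\<lambda>k. if k < n then 0 else u k) < \<delta>"
proof (rule ccontr)
  define tl where "tl n k = (if k < n then 0 else u k)" for n k :: nat
  assume "\<not> ?thesis"
  then have big: "\<delta> \<le> gsup w (tl n)" if "n \<ge> n0" for n using that unfolding tl_def by (meson not_le)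
  have tl: "0 \<le> tl n k" "tl n k \<le> u k" for n k using u by (auto simp: tl_def)
  have many: "\<exists>xs. sorted_wrt (<) xs \<and> real L * (\<delta> / 4) \<le> gsum w u 0 xs" for L
  proof (induction L)
    case 0
    show ?case by (intro exI[of _ "[]"]) auto
  next
    case (Suc L)
    then obtain xs where xs: "sorted_wrt (<) xs" "real L * (\<delta> / 4) \<le> gsum w u 0 xs" by blast
    define m where "m = length xs"
    define \<epsilon> where "\<epsilon> = \<delta> / (4 * (real m + 1))"
    have eps: "0 < \<epsilon>" "\<epsilon> * m \<le> \<delta> / 4" using e by (auto simp: \<epsilon>_def field_simps)
    \<comment> \<open>Beyond \<open>n\<close> lie no entries of \<open>xs\<close> and no coordinates
      of size \<open>\<epsilon>\<close>, the latter being finitely many by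
      \<open>finite_large\<close>.\<close>
    define n where "n = Suc (Max (insert n0 (set xs \<union> {k. \<epsilon> \<le> u k})))"
    have fin: "finite (insert n0 (set xs \<union> {k. \<epsilon> \<le> u k}))" using finite_large[OF u eps(1)] by simp
    have lt: "k < n" if "k \<in> insert n0 (set xs \<union> {k. \<epsilon> \<le> u k})" for k
      unfolding n_def less_Suc_eq_le by (rule Max_ge[OF fin that])
    have n: "n \<ge> n0" "\<And>k. k \<in> set xs \<Longrightarrow> k < n" "\<And>k. n \<le> k \<Longrightarrow> u k < \<epsilon>"
      using lt by (auto simp: less_imp_le) (meson lt UnCI insertI2 leD mem_Collect_eq not_le)
    have "\<delta> / 2 < gsup w (tl n)" using big[OF n(1)] e by linarith
    then obtain ys where ys: "sorted_wrt (<) ys" "\<delta> / 2 < gsum w (tl n) 0 ys" by (rule gsup_gtE)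
    define zs where "zs = filter (\<lambda>k. n \<le> k) ys"
    have zs: "sorted_wrt (<) zs" unfolding zs_def by (simp add: ys sorted_wrt_filter)
    have "gsum w (tl n) 0 ys \<le> gsum w (tl n) 0 zs" unfolding zs_def
      by (rule gsum_filter[OF tl(1)]) (simp add: tl_def)
    moreover have "gsum w (tl n) 0 zs - \<epsilon> * m \<le> gsum w (tl n) m (drop m zs)"
      by (rule gsum_drop) (use eps n(3) in \<open>auto simp: tl_def less_imp_le not_less\<close>)
    moreover have "gsum w (tl n) m (drop m zs) \<le> gsum w u m (drop m zs)"
      by (rule gsum_mono) (rule tl)
    ultimately have "\<delta> / 4 \<le> gsum w u m (drop m zs)" using ys eps by linarith
    then have "real (Suc L) * (\<delta> / 4) \<le> gsum w u 0 (xs @ drop m zs)"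
      using xs(2) by (simp add: gsum_append m_def[symmetric] algebra_simps)
    moreover have "sorted_wrt (<) (xs @ drop m zs)"
      unfolding sorted_wrt_append
    proof (intro conjI ballI)
      show "sorted_wrt (<) (drop m zs)" using zs by (rule sorted_wrt_drop)
      fix x y assume "x \<in> set xs" "y \<in> set (drop m zs)"
      then have "x < n" "n \<le> y" using n(2) set_drop_subset[of m zs] by (auto simp: zs_def)
      then show "x < y" by linarith
    qed (rule xs)
    ultimately show ?case by blast
  qed
  obtain L :: nat where "gsup w u / (\<delta> / 4) < L" using reals_Archimedean2 by blast
  then have L: "gsup w u < real L * (\<delta> / 4)" using e by (simp add: pos_divide_less_eq)
  obtain xs where "sorted_wrt (<) xs" "real L * (\<delta> / 4) \<le> gsum w u 0 xs" using many by blast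
  then show False using gsum_le_gsup[OF u(1), of xs] L by linarith
qed

end

section \<open>Compactness in finitely many coordinates\<close>

lemma common_convergent_subsequence:
  fixes f :: "nat \<Rightarrow> nat \<Rightarrow> 'a::heine_borel"
  assumes "\<And>j. bounded (range (\<lambda>n. f n j))"
  shows "\<exists>s. strict_mono s \<and> (\<forall>j<k. convergent (\<lambda>n. f (s n) j))"
proof (induction k)
  case 0
  show ?case by (intro exI[of _ id]) (auto simp: strict_mono_def)
next
  case (Suc k)
  then obtain s :: "nat \<Rightarrow> nat" where s: "strict_mono s" "\<And>j. j < k \<Longrightarrow> convergent (\<lambda>n. f (s n) j)" by blast
  have "bounded (range (\<lambda>n. f (s n) k))" by (rule bounded_subset[OF assms[of k]]) auto
  then obtain l q where q: "strict_mono q" "((\<lambda>n. f (s n) k) \<circ> q) \<longlonglongrightarrow> l"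
    using bounded_imp_convergent_subsequence by blast
  have "convergent (\<lambda>n. f ((s \<circ> q) n) j)" if "j < Suc k" for j
  proof (cases "j = k")
    case True
    then show ?thesis using q(2) by (auto simp: convergent_def comp_def)
  next
    case False
    then show ?thesis using convergent_subseq_convergent[OF s(2) q(1), of j] that by (simp add: comp_def)
  qed
  then show ?case using strict_mono_compose[OF s(1) q(1)] by (auto simp: comp_def)
qed

text \<open>Along a subsequence that converges in the first \<open>k\<close> coordinates,
  consecutive terms become close there.\<close>

lemma close_pair:
  fixes f :: "nat \<Rightarrow> nat \<Rightarrow> 'a::{heine_borel, real_normed_vector}"
  assumes "\<And>j. bounded (range (\<lambda>n. f n j))" "0 < \<epsilon>"
  shows "\<exists>i>i0. \<exists>l>i. \<forall>j<k. norm (f i j - f l j) < \<epsilon>"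
proof -
  obtain s where s: "strict_mono s" "\<And>j. j < k \<Longrightarrow> convergent (\<lambda>n. f (s n) j)"
    using common_convergent_subsequence[of f k, OF assms(1)] by blast
  have "\<forall>\<^sub>F n in sequentially. \<forall>j\<in>{..<k}. norm (f (s n) j - f (s (Suc n)) j) < \<epsilon>"
  proof (rule eventually_ball_finite)
    show "\<forall>j\<in>{..<k}. \<forall>\<^sub>F n in sequentially. norm (f (s n) j - f (s (Suc n)) j) < \<epsilon>"
    proof
      fix j assume "j \<in> {..<k}"
      then obtain l where l: "(\<lambda>n. f (s n) j) \<longlonglongrightarrow> l" using s(2) by (auto simp: convergent_def)
      have "(\<lambda>n. norm (f (s n) j - f (s (Suc n)) j)) \<longlonglongrightarrow> norm (l - l)"
        by (intro tendsto_intros l LIMSEQ_Suc[OF l])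
      then show "\<forall>\<^sub>F n in sequentially. norm (f (s n) j - f (s (Suc n)) j) < \<epsilon>"
        by (rule order_tendstoD(2)) (use assms(2) in simp)
    qed
  qed simp
  then obtain N where N: "\<And>n j. n \<ge> N \<Longrightarrow> j < k \<Longrightarrow> norm (f (s n) j - f (s (Suc n)) j) < \<epsilon>"
    unfolding eventually_sequentially by auto
  \<comment> \<open>A strictly increasing \<open>s\<close> satisfies \<open>n \<le> s n\<close>, so
    \<open>Suc i0\<close> gives the strict \<open>i0 < s n\<close>.\<close>
  define n where "n = max N (Suc i0)"
  have "i0 < s n" using strict_mono_imp_increasing[OF s(1), of n] by (simp add: n_def)
  moreover have "s n < s (Suc n)" using s(1) by (simp add: strict_mono_def)
  moreover have "\<forall>j<k. norm (f (s n) j - f (s (Suc n)) j) < \<epsilon>" using N[of n] by (simp add: n_def)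
  ultimately show ?thesis by blast
qed

definition restrict_seq :: "nat set \<Rightarrow> (nat \<Rightarrow> 'a::zero) \<Rightarrow> nat \<Rightarrow> 'a"
  where "restrict_seq S x k = (if k \<in> S then x k else 0)"

context garling
begin

lemma restrict_seq_in:
  fixes x :: "nat \<Rightarrow> 'a::{real_normed_field, heine_borel}"
  shows "x \<in> garling_space w p \<Longrightarrow> restrict_seq S x \<in> garling_space w p"
  by (rule garling_space_mono(1)) (auto simp: restrict_seq_def)

lemma D_less_gnm_less:
  fixes x :: "nat \<Rightarrow> 'a::{real_normed_field, heine_borel}"
  assumes "x \<in> garling_space w p" "D x < e powr max 1 p" "0 < e"
  shows "gnm x < e"
proof (rule ccontr)
  assume "\<not> ?thesis"
  then have "e powr max 1 p \<le> gnm x powr max 1 p" using assms by (intro powr_mono2) auto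
  then show False using assms by (simp add: D_eq)
qed

lemma tail_small:
  fixes x :: "nat \<Rightarrow> 'a::{real_normed_field, heine_borel}"
  assumes x: "x \<in> garling_space w p" and e: "0 < e"
  shows "\<exists>n\<ge>n0. gnm (restrict_seq {n..} x) < e"
proof -
  have "0 < e powr max 1 p" using e by simp
  then obtain n where n: "n \<ge> n0" "gsup w (\<lambda>k. if k < n then 0 else mod_pow x k) < e powr max 1 p"
    using gsup_tail_small[of "mod_pow x"] x mod_pow_nonneg unfolding garling_space_iff by blast
  have "mod_pow (restrict_seq {n..} x) = (\<lambda>k. if k < n then 0 else mod_pow x k)"
    using p_pos by (auto simp: restrict_seq_def mod_pow_def fun_eq_iff)
  then have "gnm (restrict_seq {n..} x) < e"
    using n(2) e by (intro D_less_gnm_less restrict_seq_in[OF x]) (auto simp: D_def)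
  then show ?thesis using n by blast
qed

lemma head_small:
  fixes x :: "nat \<Rightarrow> 'a::{real_normed_field, heine_borel}"
  assumes e: "0 < e"
  shows "\<exists>\<epsilon>>0. \<forall>x\<in>(garling_space w p :: (nat \<Rightarrow> 'a) set). (\<forall>j<k. norm (x j) < \<epsilon>) \<longrightarrow> gnm (restrict_seq {..<k} x) < e"
proof -
  \<comment> \<open>The first \<open>k\<close> coordinates contribute at most \<open>q * k\<close>;
    dividing by \<open>k + 1\<close> makes the final inequality strict.\<close>
  define q where "q = e powr max 1 p / (real k + 1)"
  have q: "0 < q" using e by (simp add: q_def)
  define \<epsilon> where "\<epsilon> = q powr (1 / p)"
  have eps: "0 < \<epsilon>" using q by (simp add: \<epsilon>_def)
  have eq: "\<epsilon> powr p = q" using q p_pos by (simp add: \<epsilon>_def powr_powr)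
  have "gnm (restrict_seq {..<k} x) < e"
    if x: "x \<in> garling_space w p" and small: "\<And>j. j < k \<Longrightarrow> norm (x j) < \<epsilon>" for x :: "nat \<Rightarrow> 'a"
  proof (rule D_less_gnm_less[OF restrict_seq_in[OF x] _ e])
    have mp: "mod_pow (restrict_seq {..<k} x) j \<le> q" for j
    proof (cases "j < k")
      case True
      then have "norm (x j) powr p \<le> \<epsilon> powr p" using small[of j] p_pos by (intro powr_mono2) auto
      then show ?thesis using True eq by (simp add: mod_pow_def restrict_seq_def)
    qed (use q p_pos in \<open>simp add: mod_pow_def restrict_seq_def\<close>)
    have "D (restrict_seq {..<k} x) \<le> q * k"
    proof (rule D_leI)
      fix xs :: "nat list" assume xs: "sorted_wrt (<) xs"
      have "gsum w (mod_pow (restrict_seq {..<k} x)) 0 xs \<le> w 0 * q * card {..<k}"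
        by (rule gsum_le_card[OF strict_sorted_distinct[OF xs]])
           (use mp q p_pos in \<open>auto simp: mod_pow_nonneg, auto simp: mod_pow_def restrict_seq_def\<close>)
      then show "gsum w (mod_pow (restrict_seq {..<k} x)) 0 xs \<le> q * k" by (simp add: w_one)
    qed
    also have "q * k < q * (real k + 1)" using q by simp
    also have "\<dots> = e powr max 1 p" by (simp add: q_def add_nonneg_eq_0_iff)
    finally show "D (restrict_seq {..<k} x) < e powr max 1 p" .
  qed
  then show ?thesis using eps by blast
qed

text \<open>The difference is small before \<open>k\<close> by the choice of a close pair and small
  after some \<open>k'\<close> by density, so only its middle piece matters.\<close>

lemma block_pair:
  fixes B :: "nat \<Rightarrow> nat \<Rightarrow> 'a::{real_normed_field, heine_borel}"
  assumes B: "\<And>n. B n \<in> garling_space w p" "\<And>n. gnm (B n) \<le> M" and e: "0 < e"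
  shows "\<exists>i>i0. \<exists>l>i. \<exists>k'>k. gnm ((B i - B l) - restrict_seq {k..<k'} (B i - B l)) < e"
proof -
  interpret F: fspace "garling_space w p :: (nat \<Rightarrow> 'a) set" gnm "min 1 p" by (rule gnm_fspace)
  have "0 < e / 2" using e by simp
  then obtain \<epsilon> where eps: "0 < \<epsilon>" "\<And>x :: nat \<Rightarrow> 'a. x \<in> garling_space w p \<Longrightarrow> (\<And>j. j < k \<Longrightarrow> norm (x j) < \<epsilon>) \<Longrightarrow>
      gnm (restrict_seq {..<k} x) < e / 2"
    using head_small[of "e / 2" k] by metis
  have "bounded (range (\<lambda>n. B n j))" for j
  proof (rule boundedI)
    fix y assume "y \<in> range (\<lambda>n. B n j)"
    then obtain n where n: "y = B n j" by blast
    have r: "0 < min 1 p" using p_pos by simp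
    have "norm (B n j) powr min 1 p \<le> M" using norm_le_gnm[OF B(1), of n j] B(2)[of n] by linarith
    then have "(norm (B n j) powr min 1 p) powr (1 / min 1 p) \<le> M powr (1 / min 1 p)"
      using r by (intro powr_mono2) auto
    then show "norm y \<le> M powr (1 / min 1 p)" using r n by (simp add: powr_powr)
  qed
  then obtain i l where il: "i0 < i" "i < l" "\<And>j. j < k \<Longrightarrow> norm (B i j - B l j) < \<epsilon>"
    using close_pair[of B \<epsilon> i0 k] eps(1) by blast
  define y where "y = B i - B l"
  have y: "y \<in> garling_space w p" unfolding y_def by (intro F.V_diff B)
  have h: "gnm (restrict_seq {..<k} y) < e / 2" by (rule eps(2)[OF y]) (use il in \<open>simp add: y_def\<close>)
  obtain k' where k': "k' \<ge> Suc k" "gnm (restrict_seq {k'..} y) < e / 2" using tail_small[OF y \<open>0 < e / 2\<close>] by blast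
  have "y - restrict_seq {k..<k'} y = restrict_seq {..<k} y + restrict_seq {k'..} y"
    using k' by (auto simp: restrict_seq_def fun_eq_iff)
  then have "gnm (y - restrict_seq {k..<k'} y) \<le> gnm (restrict_seq {..<k} y) + gnm (restrict_seq {k'..} y)"
    by (simp only:) (intro F.nm_add restrict_seq_in y)
  then have "gnm (y - restrict_seq {k..<k'} y) < e" using h k' by linarith
  then show ?thesis using il(1,2) k'(1) unfolding y_def by (meson Suc_le_lessD)
qed

lemma block_sequence:
  fixes B :: "nat \<Rightarrow> nat \<Rightarrow> 'a::{real_normed_field, heine_borel}"
  assumes B: "\<And>n. B n \<in> garling_space w p" "\<And>n. gnm (B n) \<le> M" and e: "0 < e"
  shows "\<exists>I L K. strict_mono K \<and> inj I \<and> inj L \<and> range I \<inter> range L = {} \<and>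
    (\<forall>n. gnm ((B (I n) - B (L n)) - restrict_seq {K n..<K (Suc n)} (B (I n) - B (L n))) < e / 2 ^ Suc n)"
proof -
  define Q where "Q i0 k n i l k' \<longleftrightarrow> i0 < i \<and> i < l \<and> k < k' \<and>
     gnm ((B i - B l) - restrict_seq {k..<k'} (B i - B l)) < e / 2 ^ Suc n" for i0 k n i l k'
  have "\<exists>i l k'. Q i0 k n i l k'" for i0 k n
    using block_pair[of B M "e / 2 ^ Suc n" i0 k, OF B] e unfolding Q_def by auto
  then obtain fi fl fk where f: "\<And>i0 k n. Q i0 k n (fi i0 k n) (fl i0 k n) (fk i0 k n)" by metis
  \<comment> \<open>The state holds the last index of \<open>B\<close> used and the right end of the
    last block.\<close>
  define st where "st = rec_nat (0, 0) (\<lambda>n s. (fl (fst s) (snd s) n, fk (fst s) (snd s) n))"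
  define K where "K n = snd (st n)" for n
  define P where "P n = fst (st n)" for n
  define I where "I n = fi (P n) (K n) n" for n
  define L where "L n = fl (P n) (K n) n" for n
  have Suc: "P (Suc n) = L n" "K (Suc n) = fk (P n) (K n) n" for n
    by (auto simp: P_def K_def L_def st_def)
  have q: "Q (P n) (K n) n (I n) (L n) (K (Suc n))" for n
    using f[of "P n" "K n" n] by (simp only: I_def L_def Suc)
  have IL: "I n < L n" "L n < I (Suc n)" "K n < K (Suc n)" for n
    using q[of n] q[of "Suc n"] by (auto simp: Q_def Suc)
  have mL: "strict_mono L" by (rule strict_monoI_Suc) (use IL less_trans in blast)
  have mI: "strict_mono I" by (rule strict_monoI_Suc) (use IL less_trans in blast)
  have "I m \<noteq> L n" for m n
  proof (cases "m \<le> n")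
    case True
    then have "I m \<le> I n" using strict_mono_less_eq[OF mI] by simp
    then show ?thesis using IL(1)[of n] by linarith
  next
    case False
    then have "I (Suc n) \<le> I m" using strict_mono_less_eq[OF mI] by simp
    then show ?thesis using IL(2)[of n] by linarith
  qed
  moreover have "strict_mono K" by (rule strict_monoI_Suc) (rule IL)
  ultimately show ?thesis
    using q mI mL by (intro exI[of _ I] exI[of _ L] exI[of _ K]) (auto simp: Q_def strict_mono_imp_inj_on)
qed

end

section \<open>Comparison with the space of p-summable sequences\<close>

context fspace_symmetric
begin

text \<open>As the two index sets are disjoint, the difference is one finite combination, and its
  \<open>L\<close> part is removed by suppression.\<close>

lemma difference_lower:
  "\<exists>C\<ge>1. \<forall>(A :: nat set) a I L. finite A \<longrightarrow> inj_on I A \<longrightarrow> inj_on L A \<longrightarrow> I ` A \<inter> L ` A = {} \<longrightarrow>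
     nm (comb a I A) \<le> C * nm (comb a I A - comb a L A)"
proof -
  obtain C where C: "1 \<le> C" "\<And>A E a. finite A \<Longrightarrow> E \<subseteq> A \<Longrightarrow> nm (comb a id E) \<le> C * nm (comb a id A)"
    using suppression_constant by blast
  have "nm (comb a I A) \<le> C * nm (comb a I A - comb a L A)"
    if A: "finite A" "inj_on I A" "inj_on L A" "I ` A \<inter> L ` A = {}" for A :: "nat set" and a I L
  proof -
    define c where "c i = (if i \<in> I ` A then a (the_inv_into A I i) else - a (the_inv_into A L i))" for i
    have cI: "comb c id (I ` A) = comb a I A"
      unfolding sum.reindex[OF A(2)] by (rule sum.cong) (auto simp: c_def the_inv_into_f_f[OF A(2)])
    have cL: "comb c id (L ` A) = - comb a L A"
      unfolding sum.reindex[OF A(3)] sum_negf[symmetric]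
    proof (rule sum.cong[OF refl])
      fix j assume j: "j \<in> A"
      then have "L j \<notin> I ` A" using A(4) by blast
      then show "((\<lambda>j. seq_scale (c j) (B (id j))) \<circ> L) j = - seq_scale (a j) (B (L j))"
        using j by (simp add: c_def the_inv_into_f_f[OF A(3)])
    qed
    have "comb c id (I ` A \<union> L ` A) = comb c id (I ` A) + comb c id (L ` A)"
      by (rule sum.union_disjoint) (use A in auto)
    also have "\<dots> = comb a I A - comb a L A" unfolding cI cL by simp
    finally have u: "comb c id (I ` A \<union> L ` A) = comb a I A - comb a L A" .
    have "nm (comb c id (I ` A)) \<le> C * nm (comb c id (I ` A \<union> L ` A))"
      by (rule C(2)) (use A in auto)
    then show ?thesis unfolding cI u .
  qed
  then show ?thesis using C(1) by blast
qed

end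

locale garling_symmetric = garling w p for w p +
  fixes B :: "nat \<Rightarrow> nat \<Rightarrow> 'a::{real_normed_field, heine_borel}"
  assumes symmetric_B: "symmetric_basic_sequence (garling_space w p) gnm B"
begin

sublocale fspace_symmetric "garling_space w p" gnm "min 1 p" B
proof -
  interpret fspace "garling_space w p :: (nat \<Rightarrow> 'a) set" gnm "min 1 p" by (rule gnm_fspace)
  show "fspace_symmetric (garling_space w p) gnm (min 1 p) B"
    by unfold_locales (use symmetric_B in \<open>auto simp: symmetric_basic_sequence_def\<close>)
qed

text \<open>A perturbation argument. Both bounds hold for every injective \<open>\<sigma>\<close>,
  so the blocks inherit uniform symmetry from \<open>B\<close>.\<close>

lemma equivalent_blocks:
  obtains K z c C where "strict_mono K" "\<And>n. z n \<in> garling_space w p"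
    "\<And>n k. z n k \<noteq> (0 :: 'a) \<Longrightarrow> K n \<le> k \<and> k < K (Suc n)" "0 < c" "0 < C"
    "\<And>(A :: nat set) \<sigma> a. finite A \<Longrightarrow> inj_on \<sigma> A \<Longrightarrow>
        c * gnm (comb a id A) \<le> gnm (\<Sum>j\<in>A. seq_scale (a j) (z (\<sigma> j)))"
    "\<And>(A :: nat set) \<sigma> a. finite A \<Longrightarrow> inj_on \<sigma> A \<Longrightarrow>
        gnm (\<Sum>j\<in>A. seq_scale (a j) (z (\<sigma> j))) \<le> C * gnm (comb a id A)"
proof -
  obtain Cs where Cs: "1 \<le> Cs" "\<And>(A::nat set) \<sigma> \<tau> a. finite A \<Longrightarrow> inj_on \<sigma> A \<Longrightarrow> inj_on \<tau> A \<Longrightarrow>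
      gnm (comb a \<sigma> A) \<le> Cs * gnm (comb a \<tau> A)"
    using symmetric_constant by blast
  obtain Cd where Cd: "1 \<le> Cd" "\<And>(A :: nat set) a I L. finite A \<Longrightarrow> inj_on I A \<Longrightarrow> inj_on L A \<Longrightarrow>
      I ` A \<inter> L ` A = {} \<Longrightarrow> gnm (comb a I A) \<le> Cd * gnm (comb a I A - comb a L A)"
    using difference_lower by blast
  obtain b b' where b: "0 < b" "\<And>n. b \<le> gnm (B n)" "\<And>n. gnm (B n) \<le> b'" using seminormalized by blast
  obtain Kb where Kb: "1 \<le> Kb" "\<And>A a j. finite A \<Longrightarrow> j \<in> A \<Longrightarrow> norm (a j) powr min 1 p * gnm (B j) \<le> Kb * gnm (comb a id A)"
    using coefficient_bound unfolding id_def by blast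
  \<comment> \<open>Coefficients are bounded by \<open>Kb * F / b\<close>, so errors of total size
    \<open>\<theta>\<close> change the norm by at most \<open>c * F\<close>, which is half the lower
    bound \<open>F / (Cs * Cd)\<close> for the differences.\<close>
  define \<theta> where "\<theta> = b / (2 * Kb * Cs * Cd)"
  have th: "0 < \<theta>" using b Kb Cs Cd by (simp add: \<theta>_def)
  obtain I L :: "nat \<Rightarrow> nat" and K where K: "strict_mono K" and IL: "inj I" "inj L" "range I \<inter> range L = {}"
    and near: "\<And>n. gnm ((B (I n) - B (L n)) - restrict_seq {K n..<K (Suc n)} (B (I n) - B (L n))) < \<theta> / 2 ^ Suc n"
    using block_sequence[of B b' \<theta>, OF B_in b(3) th] by blast
  define y where "y n = B (I n) - B (L n)" for n
  define z where "z n = restrict_seq {K n..<K (Suc n)} (y n)" for n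
  define rest where "rest n = y n - z n" for n
  have V: "y n \<in> garling_space w p" "z n \<in> garling_space w p" "rest n \<in> garling_space w p" for n
    unfolding rest_def y_def z_def by (intro V_diff restrict_seq_in B_in)+
  have rest: "gnm (rest n) \<le> \<theta> / 2 ^ Suc n" for n using near[of n] by (simp add: rest_def y_def z_def)
  define c where "c = 1 / (2 * Cs * Cd)"
  have c: "0 < c" using Cs Cd by (simp add: c_def)
  have main: "c * gnm (comb a id A) \<le> gnm (\<Sum>j\<in>A. seq_scale (a j) (z (\<sigma> j)))"
    "gnm (\<Sum>j\<in>A. seq_scale (a j) (z (\<sigma> j))) \<le> (2 * Cs + c) * gnm (comb a id A)"
    if A: "finite A" "inj_on \<sigma> A" for A :: "nat set" and \<sigma> a
  proof -
    define F where "F = gnm (comb a id A)"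
    have F: "0 \<le> F" by (simp add: F_def nm_nonneg)
    have inj: "inj_on (I \<circ> \<sigma>) A" "inj_on (L \<circ> \<sigma>) A"
      using A(2) IL(1,2) by (auto intro!: comp_inj_on dest: inj_on_subset)
    define sY where "sY = (\<Sum>j\<in>A. seq_scale (a j) (y (\<sigma> j)))"
    define sZ where "sZ = (\<Sum>j\<in>A. seq_scale (a j) (z (\<sigma> j)))"
    define sR where "sR = (\<Sum>j\<in>A. seq_scale (a j) (rest (\<sigma> j)))"
    have VV: "sY \<in> garling_space w p" "sZ \<in> garling_space w p" "sR \<in> garling_space w p"
      unfolding sY_def sZ_def sR_def by (intro V_sum V_scale V)+
    have Y: "sY = comb a (I \<circ> \<sigma>) A - comb a (L \<circ> \<sigma>) A"
      unfolding sY_def by (simp add: y_def seq.scale_right_diff_distrib sum_subtractf)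
    have R: "sR = sY - sZ"
      unfolding sR_def sY_def sZ_def by (simp add: rest_def seq.scale_right_diff_distrib sum_subtractf)
    have up: "gnm sY \<le> 2 * Cs * F"
    proof -
      have "gnm sY \<le> gnm (comb a (I \<circ> \<sigma>) A) + gnm (comb a (L \<circ> \<sigma>) A)"
        unfolding Y by (rule nm_diff_le[OF comb_V comb_V])
      also have "\<dots> \<le> Cs * F + Cs * F"
        unfolding F_def by (intro add_mono Cs(2) A inj) auto
      finally show ?thesis by simp
    qed
    have lo: "F \<le> Cs * (Cd * gnm sY)"
    proof -
      have "F \<le> Cs * gnm (comb a (I \<circ> \<sigma>) A)" unfolding F_def by (intro Cs(2) A inj) auto
      also have "\<dots> \<le> Cs * (Cd * gnm sY)"
        unfolding Y using Cs(1) IL(3) by (intro mult_left_mono Cd(2) A inj) auto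
      finally show ?thesis .
    qed
    have sm: "gnm sR \<le> c * F"
    proof -
      \<comment> \<open>Injectivity of \<open>\<sigma>\<close> makes the errors distinct terms of
        one geometric series.\<close>
      have half: "(\<Sum>j\<in>A. (1 / 2 :: real) ^ Suc (\<sigma> j)) \<le> 1"
      proof -
        have "(\<Sum>j\<in>A. (1 / 2 :: real) ^ Suc (\<sigma> j)) = (\<Sum>i\<in>\<sigma> ` A. (1 / 2) ^ Suc i)"
          by (simp add: sum.reindex[OF A(2)])
        also have "\<dots> \<le> (\<Sum>i. (1 / 2) ^ Suc i)"
          by (rule sum_le_suminf[OF sums_summable[OF power_half_series]]) (use A in auto)
        also have "\<dots> = 1" by (rule sums_unique[OF power_half_series, symmetric])
        finally show ?thesis .
      qed
      have "gnm sR \<le> (\<Sum>j\<in>A. gnm (seq_scale (a j) (rest (\<sigma> j))))" unfolding sR_def by (intro nm_sum V_scale V)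
      also have "\<dots> \<le> (\<Sum>j\<in>A. Kb * F / b * (\<theta> / 2 ^ Suc (\<sigma> j)))"
      proof (rule sum_mono)
        fix j assume j: "j \<in> A"
        have "norm (a j) powr min 1 p * b \<le> norm (a j) powr min 1 p * gnm (B j)" by (intro mult_left_mono b) simp
        also have "\<dots> \<le> Kb * F" unfolding F_def by (rule Kb(2)[OF A(1) j])
        finally have "norm (a j) powr min 1 p \<le> Kb * F / b" using b(1) by (simp add: pos_le_divide_eq)
        then show "gnm (seq_scale (a j) (rest (\<sigma> j))) \<le> Kb * F / b * (\<theta> / 2 ^ Suc (\<sigma> j))"
          unfolding nm_scale[OF V(3)] using rest F Kb(1) b(1) by (intro mult_mono) (auto simp: nm_nonneg)
      qed
      also have "\<dots> = Kb * F / b * \<theta> * (\<Sum>j\<in>A. (1 / 2) ^ Suc (\<sigma> j))"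
        unfolding sum_distrib_left by (simp add: power_divide)
      also have "\<dots> \<le> Kb * F / b * \<theta> * 1"
        using F Kb(1) b(1) th by (intro mult_left_mono half) auto
      also have "Kb * F / b * \<theta> * 1 = c * F" using b(1) Kb(1) by (simp add: \<theta>_def c_def)
      finally show ?thesis .
    qed
    have "gnm sZ \<le> gnm sY + gnm sR"
    proof -
      have "sZ = sY - sR" unfolding R by simp
      then show ?thesis using nm_diff_le[OF VV(1,3)] by simp
    qed
    then show "gnm (\<Sum>j\<in>A. seq_scale (a j) (z (\<sigma> j))) \<le> (2 * Cs + c) * gnm (comb a id A)"
      using up sm unfolding sZ_def[symmetric] F_def[symmetric] by (simp add: distrib_right)
    have "gnm sY \<le> gnm sZ + gnm sR"
      using nm_le_add_diff[OF VV(1,2)] unfolding R .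
    moreover have "2 * c * F \<le> gnm sY"
      using lo Cs(1) Cd(1) by (simp add: c_def field_simps)
    ultimately show "c * gnm (comb a id A) \<le> gnm (\<Sum>j\<in>A. seq_scale (a j) (z (\<sigma> j)))"
      using sm unfolding sZ_def[symmetric] F_def[symmetric] by linarith
  qed
  have supp: "K n \<le> k \<and> k < K (Suc n)" if "z n k \<noteq> 0" for n k
    using that by (auto simp: z_def restrict_seq_def split: if_splits)
  have "0 < 2 * Cs + c" using Cs(1) c by simp
  from that[OF K V(2) supp c this main] show thesis .
qed

text \<open>At each coordinate at most one term is nonzero, so the \<open>p\<close>-th power
  distributes over the sum.\<close>

lemma mod_pow_block_sum:
  fixes z :: "nat \<Rightarrow> nat \<Rightarrow> 'a"
  assumes A: "finite A" "inj_on \<sigma> A" and K: "mono K"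
    and supp: "\<And>n k. z n k \<noteq> 0 \<Longrightarrow> K n \<le> k \<and> k < K (Suc n)"
  shows "mod_pow (\<Sum>j\<in>A. seq_scale (a j) (z (\<sigma> j))) k = (\<Sum>j\<in>A. norm (a j) powr p * mod_pow (z (\<sigma> j)) k)"
proof -
  have app: "(\<Sum>j\<in>A. seq_scale (a j) (z (\<sigma> j))) k = (\<Sum>j\<in>A. a j * z (\<sigma> j) k)"
    by (induction A rule: infinite_finite_induct) (auto simp: seq_scale_def)
  show ?thesis
  proof (cases "\<exists>i\<in>A. z (\<sigma> i) k \<noteq> 0")
    case True
    then obtain i where i: "i \<in> A" "z (\<sigma> i) k \<noteq> 0" by blast
    have zero: "z (\<sigma> j) k = 0" if j: "j \<in> A - {i}" for j
    proof (rule ccontr)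
      assume "z (\<sigma> j) k \<noteq> 0"
      then have h: "K (\<sigma> j) \<le> k" "k < K (Suc (\<sigma> j))" "K (\<sigma> i) \<le> k" "k < K (Suc (\<sigma> i))" using supp i by blast+
      have "\<sigma> i \<noteq> \<sigma> j" using A(2) i(1) j by (auto simp: inj_on_def)
      then have "Suc (\<sigma> i) \<le> \<sigma> j \<or> Suc (\<sigma> j) \<le> \<sigma> i" by linarith
      then have "K (Suc (\<sigma> i)) \<le> K (\<sigma> j) \<or> K (Suc (\<sigma> j)) \<le> K (\<sigma> i)" using monoD[OF K] by blast
      then show False using h by linarith
    qed
    have "(\<Sum>j\<in>A. a j * z (\<sigma> j) k) = (\<Sum>j\<in>{i}. a j * z (\<sigma> j) k)"
      by (rule sum.mono_neutral_right) (use A i zero in auto)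
    moreover have "(\<Sum>j\<in>A. norm (a j) powr p * mod_pow (z (\<sigma> j)) k) = (\<Sum>j\<in>{i}. norm (a j) powr p * mod_pow (z (\<sigma> j)) k)"
      by (rule sum.mono_neutral_right) (use A i zero p_pos in \<open>auto simp: mod_pow_def\<close>)
    ultimately show ?thesis
      unfolding mod_pow_def app by (simp add: norm_mult powr_mult)
  next
    case False
    then have "(\<Sum>j\<in>A. a j * z (\<sigma> j) k) = 0" "(\<Sum>j\<in>A. norm (a j) powr p * mod_pow (z (\<sigma> j)) k) = 0"
      using p_pos by (auto intro!: sum.neutral simp: mod_pow_def)
    then show ?thesis unfolding mod_pow_def app using p_pos by simp
  qed
qed

lemma lp_estimate:
  "\<exists>c C. 0 < c \<and> 0 < C \<and> (\<forall>A a. finite A \<longrightarrow>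
      c * (\<Sum>j\<in>A. norm (a j) powr p) \<le> gnm (comb a id A) powr max 1 p \<and>
      gnm (comb a id A) powr max 1 p \<le> C * (\<Sum>j\<in>A. norm (a j) powr p))"
proof -
  obtain K z c C where K: "strict_mono K" and zV: "\<And>n. z n \<in> garling_space w p"
    and supp: "\<And>n k. z n k \<noteq> (0 :: 'a) \<Longrightarrow> K n \<le> k \<and> k < K (Suc n)" and cC: "0 < c" "0 < C"
    and lo: "\<And>(A :: nat set) \<sigma> a. finite A \<Longrightarrow> inj_on \<sigma> A \<Longrightarrow>
        c * gnm (comb a id A) \<le> gnm (\<Sum>j\<in>A. seq_scale (a j) (z (\<sigma> j)))"
    and up: "\<And>(A :: nat set) \<sigma> a. finite A \<Longrightarrow> inj_on \<sigma> A \<Longrightarrow>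
        gnm (\<Sum>j\<in>A. seq_scale (a j) (z (\<sigma> j))) \<le> C * gnm (comb a id A)"
    by (rule equivalent_blocks) (rule that; assumption)
  define q where "q = max 1 p"
  have q: "1 \<le> q" by (simp add: q_def)
  define Z where "Z a \<sigma> A = (\<Sum>j\<in>A. seq_scale (a j) (z (\<sigma> j)))" for a \<sigma> and A :: "nat set"
  define \<zeta> where "\<zeta> n = mod_pow (z n)" for n
  have ZV: "Z a \<sigma> A \<in> garling_space w p" for a \<sigma> A unfolding Z_def by (intro V_sum V_scale zV)
  have mono: "mono K" using K by (rule strict_mono_mono)
  have modZ: "mod_pow (Z a \<sigma> A) = (\<lambda>k. \<Sum>j\<in>A. norm (a j) powr p * \<zeta> (\<sigma> j) k)"
    if "finite A" "inj_on \<sigma> A" for a \<sigma> A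
    unfolding Z_def \<zeta>_def by (rule ext, rule mod_pow_block_sum[OF that mono supp])
  have DZ: "gsup w (\<lambda>k. \<Sum>j\<in>A. norm (a j) powr p * \<zeta> (\<sigma> j) k) = gnm (Z a \<sigma> A) powr q"
    if "finite A" "inj_on \<sigma> A" for a \<sigma> A
    using D_eq[OF ZV, of a \<sigma> A] modZ[OF that] by (simp add: D_def q_def)
  have loq: "c powr q * gnm (comb a id A) powr q \<le> gnm (Z a \<sigma> A) powr q"
    and upq: "gnm (Z a \<sigma> A) powr q \<le> C powr q * gnm (comb a id A) powr q"
    if "finite A" "inj_on \<sigma> A" for a \<sigma> A
    unfolding powr_mult[symmetric] using lo[OF that, of a] up[OF that, of a] q cC
    by (auto simp: Z_def nm_nonneg powr_mult[symmetric] intro!: powr_mono2)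
  \<comment> \<open>Singletons compare every block with \<open>B 0\<close>, which bounds all block
    norms above and below through \<open>g\<close>.\<close>
  define g where "g = gnm (B 0) powr q"
  have g: "0 < g" using nm_B_pos[of 0] by (simp add: g_def)
  have zeta: "c powr q * g \<le> gsup w (\<zeta> n)" "gsup w (\<zeta> n) \<le> C powr q * g" for n
    using loq[of "{0}" "\<lambda>_. n" "\<lambda>_. 1"] upq[of "{0}" "\<lambda>_. n" "\<lambda>_. 1"] DZ[of "{0}" "\<lambda>_. n" "\<lambda>_. 1"]
    by (simp_all add: g_def)
  \<comment> \<open>Every nonnegative \<open>t\<close> is the \<open>p\<close>-th power of the
    modulus of a scalar, so the symmetry of the blocks covers all coefficients that
    \<open>symmetric_blocks\<close> allows.\<close>
  have root: "norm (of_real (t powr (1 / p)) :: 'a) powr p = t" if "0 \<le> t" for t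
    using that p_pos by (simp add: powr_powr)
  interpret S: symmetric_blocks w \<zeta> K "C powr q * g" "c powr q * g" "max 1 (C powr q / c powr q)"
  proof
    show "gsup w (\<lambda>k. \<Sum>j\<in>A. t j * \<zeta> (\<sigma> j) k) \<le> max 1 (C powr q / c powr q) * gsup w (\<lambda>k. \<Sum>j\<in>A. t j * \<zeta> (\<tau> j) k)"
      if A: "finite A" "inj_on \<sigma> A" "inj_on \<tau> A" "\<And>j. 0 \<le> t j" for A :: "nat set" and \<sigma> \<tau> t
    proof -
      define a where "a j = (of_real (t j powr (1 / p)) :: 'a)" for j
      have t: "t = (\<lambda>j. norm (a j) powr p)" using root A(4) by (simp add: a_def)
      have "gnm (Z a \<sigma> A) powr q \<le> C powr q * gnm (comb a id A) powr q" by (rule upq[OF A(1,2)])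
      also have "\<dots> = C powr q / c powr q * (c powr q * gnm (comb a id A) powr q)" using cC by simp
      also have "\<dots> \<le> C powr q / c powr q * gnm (Z a \<tau> A) powr q"
        by (intro mult_left_mono loq[OF A(1,3)]) auto
      also have "\<dots> \<le> max 1 (C powr q / c powr q) * gnm (Z a \<tau> A) powr q"
        by (intro mult_right_mono) auto
      finally show ?thesis unfolding t DZ[OF A(1,2)] DZ[OF A(1,3)] .
    qed
    show "0 < c powr q * g" using cC g by simp
    show "\<And>n k. \<zeta> n k \<noteq> 0 \<Longrightarrow> K n \<le> k \<and> k < K (Suc n)" using supp p_pos by (auto simp: \<zeta>_def mod_pow_def)
  qed (use mono zeta in \<open>auto simp: \<zeta>_def mod_pow_nonneg\<close>)
  obtain d where d: "0 < d" "\<And>A t. finite A \<Longrightarrow> (\<And>j. 0 \<le> t j) \<Longrightarrow> d * (\<Sum>j\<in>A. t j) \<le> gsup w (\<lambda>k. \<Sum>j\<in>A. t j * \<zeta> j k)"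
    using S.lower_lp_estimate by blast
  have L: "d / C powr q * (\<Sum>j\<in>A. norm (a j) powr p) \<le> gnm (comb a id A) powr q" if A: "finite A" for A a
  proof -
    have "d * (\<Sum>j\<in>A. norm (a j) powr p) \<le> gnm (Z a id A) powr q"
      using d(2)[OF A, of "\<lambda>j. norm (a j) powr p"] DZ[OF A, of id a] by simp
    also have "\<dots> \<le> C powr q * gnm (comb a id A) powr q" by (rule upq[OF A]) simp
    finally show ?thesis using cC by (simp add: pos_divide_le_eq mult.commute)
  qed
  \<comment> \<open>A selection is linear in the \<open>p\<close>-th powers and collects at most
    \<open>C powr q * g\<close> from each block.\<close>
  have U: "gnm (comb a id A) powr q \<le> C powr q * g / c powr q * (\<Sum>j\<in>A. norm (a j) powr p)" if A: "finite A" for A a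
  proof -
    have "c powr q * gnm (comb a id A) powr q \<le> gnm (Z a id A) powr q" by (rule loq[OF A]) simp
    also have "\<dots> = gsup w (\<lambda>k. \<Sum>j\<in>A. norm (a j) powr p * \<zeta> j k)"
      using DZ[OF A, of id a] by simp
    also have "\<dots> \<le> (\<Sum>j\<in>A. norm (a j) powr p) * (C powr q * g)"
    proof (rule gsup_le)
      fix xs :: "nat list" assume xs: "sorted_wrt (<) xs"
      have "gsum w (\<zeta> j) 0 xs \<le> C powr q * g" for j
        using gsum_le_gsup[OF S.z_gbdd xs] zeta(2) order_trans by blast
      then show "gsum w (\<lambda>k. \<Sum>j\<in>A. norm (a j) powr p * \<zeta> j k) 0 xs \<le> (\<Sum>j\<in>A. norm (a j) powr p) * (C powr q * g)"
        unfolding gsum_sum gsum_cmult sum_distrib_right by (intro sum_mono mult_left_mono) auto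
    qed
    finally show ?thesis using cC by (simp add: pos_le_divide_eq mult.commute)
  qed
  have "0 < d / C powr q" "0 < C powr q * g / c powr q" using d cC g by simp_all
  then show ?thesis using L U unfolding q_def by blast
qed

text \<open>Applied to intervals of indices, the two-sided estimate identifies the Cauchy criteria
  of the two series.\<close>

lemma converges_iff: "series_converges (garling_space w p) gnm B a \<longleftrightarrow> summable (\<lambda>j. norm (a j) powr p)"
proof -
  obtain c C where cC: "0 < c" "0 < C"
    and lo: "\<And>A a. finite A \<Longrightarrow> c * (\<Sum>j\<in>A. norm (a j) powr p) \<le> gnm (comb a id A) powr max 1 p"
    and up: "\<And>A a. finite A \<Longrightarrow> gnm (comb a id A) powr max 1 p \<le> C * (\<Sum>j\<in>A. norm (a j) powr p)"
    using lp_estimate by blast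
  define q where "q = max 1 p"
  have q: "0 < q" by (simp add: q_def)
  have diff: "ps a n - ps a m = comb a id {m..<n}" if "m \<le> n" for m n
  proof -
    have "{..<n} - {..<m} = {m..<n}" by auto
    then show ?thesis using sum_diff[of "{..<n}" "{..<m}" "\<lambda>j. seq_scale (a j) (B j)"] that by auto
  qed
  show ?thesis unfolding series_Cauchy[of B, OF B_in] summable_Cauchy
  proof (intro iffI allI impI)
    fix e :: real
    assume H: "\<forall>e>0. \<exists>N. \<forall>n\<ge>N. \<forall>m\<ge>N. gnm (ps a n - ps a m) < e" and e: "0 < e"
    have "0 < (c * e) powr (1 / q)" using cC e by simp
    then obtain N where N: "\<And>n m. n \<ge> N \<Longrightarrow> m \<ge> N \<Longrightarrow> gnm (ps a n - ps a m) < (c * e) powr (1 / q)" using H by blast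
    have "norm (\<Sum>j=m..<n. norm (a j) powr p) < e" if "m \<ge> N" for m n
    proof (cases "m \<le> n")
      case True
      have "c * (\<Sum>j=m..<n. norm (a j) powr p) \<le> gnm (comb a id {m..<n}) powr q" unfolding q_def by (rule lo) simp
      also have "\<dots> < ((c * e) powr (1 / q)) powr q"
        using N[of n m] True that q unfolding diff[OF True] by (intro powr_less_mono2) (auto simp: nm_nonneg)
      also have "\<dots> = c * e" using q cC e by (simp add: powr_powr)
      finally show ?thesis using cC by (simp add: sum_nonneg)
    qed (use e in simp)
    then show "\<exists>N. \<forall>m\<ge>N. \<forall>n. norm (\<Sum>j=m..<n. norm (a j) powr p) < e" by blast
  next
    fix e :: real
    assume H: "\<forall>e>0. \<exists>N. \<forall>m\<ge>N. \<forall>n. norm (\<Sum>j=m..<n. norm (a j) powr p) < e" and e: "0 < e"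
    have "0 < e powr q / C" using cC e by simp
    then obtain N where N: "\<And>m n. m \<ge> N \<Longrightarrow> norm (\<Sum>j=m..<n. norm (a j) powr p) < e powr q / C" using H by blast
    have less: "gnm (ps a n - ps a m) < e" if "N \<le> m" "m \<le> n" for m n
    proof (rule ccontr)
      assume "\<not> ?thesis"
      then have "e powr q \<le> gnm (comb a id {m..<n}) powr q"
        unfolding diff[OF that(2)] using e q by (intro powr_mono2) auto
      also have "\<dots> \<le> C * (\<Sum>j=m..<n. norm (a j) powr p)" unfolding q_def by (rule up) simp
      also have "\<dots> < C * (e powr q / C)" using N[OF that(1), of n] cC by (intro mult_strict_left_mono) auto
      finally show False using cC by simp
    qed
    have "gnm (ps a n - ps a m) < e" if "N \<le> n" "N \<le> m" for n m
      using less[of m n] less[of n m] nm_commute[of "ps a n" "ps a m"] that by (cases "m \<le> n") auto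
    then show "\<exists>N. \<forall>n\<ge>N. \<forall>m\<ge>N. gnm (ps a n - ps a m) < e" by blast
  qed
qed

end

section \<open>From the subadditive power back to the quasi-norm\<close>

lemma tendsto_zero_powr_iff:
  fixes f :: "nat \<Rightarrow> real"
  assumes "\<And>n. 0 \<le> f n" "0 < r"
  shows "(\<lambda>n. f n powr r) \<longlonglongrightarrow> 0 \<longleftrightarrow> f \<longlonglongrightarrow> 0"
proof
  assume "(\<lambda>n. f n powr r) \<longlonglongrightarrow> 0"
  then have "(\<lambda>n. (f n powr r) powr (1 / r)) \<longlonglongrightarrow> 0 powr (1 / r)"
    by (rule tendsto_powr') (use assms in auto)
  then show "f \<longlonglongrightarrow> 0" using assms by (simp add: powr_powr)
next
  assume "f \<longlonglongrightarrow> 0"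
  then have "(\<lambda>n. f n powr r) \<longlonglongrightarrow> 0 powr r" by (rule tendsto_powr') (use assms in auto)
  then show "(\<lambda>n. f n powr r) \<longlonglongrightarrow> 0" by simp
qed

context garling
begin

lemma garling_norm_nonneg:
  fixes x :: "nat \<Rightarrow> 'a::{real_normed_field, heine_borel}"
  shows "x \<in> garling_space w p \<Longrightarrow> 0 \<le> garling_norm w p x"
  by (simp add: garling_norm_eq)

lemma series_converges_to_gnm:
  fixes X :: "nat \<Rightarrow> nat \<Rightarrow> 'a::{real_normed_field, heine_borel}"
  assumes "\<And>j. X j \<in> garling_space w p"
  shows "series_converges_to (garling_space w p) gnm X = series_converges_to (garling_space w p) (garling_norm w p) X"
proof -
  interpret F: fspace "garling_space w p :: (nat \<Rightarrow> 'a) set" gnm "min 1 p" by (rule gnm_fspace)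
  have "0 \<le> garling_norm w p ((\<Sum>j<n. seq_scale (a j) (X j)) - x)" if "x \<in> garling_space w p" for a x n
    by (intro garling_norm_nonneg F.V_diff F.V_sum F.V_scale assms that)
  then have "(\<lambda>n. gnm ((\<Sum>j<n. seq_scale (a j) (X j)) - x)) \<longlonglongrightarrow> 0 \<longleftrightarrow>
      (\<lambda>n. garling_norm w p ((\<Sum>j<n. seq_scale (a j) (X j)) - x)) \<longlonglongrightarrow> 0"
    if "x \<in> garling_space w p" for a x
    unfolding gnm_def using that p_pos by (intro tendsto_zero_powr_iff) auto
  then show ?thesis unfolding series_converges_to_def fun_eq_iff by blast
qed

lemma closed_span_gnm:
  fixes S :: "(nat \<Rightarrow> 'a::{real_normed_field, heine_borel}) set"
  assumes "S \<subseteq> garling_space w p"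
  shows "closed_span (garling_space w p) gnm S = closed_span (garling_space w p) (garling_norm w p) S"
proof -
  interpret F: fspace "garling_space w p :: (nat \<Rightarrow> 'a) set" gnm "min 1 p" by (rule gnm_fspace)
  have r: "0 < min 1 p" using p_pos by simp
  have nn: "0 \<le> garling_norm w p (y - x)" if "x \<in> garling_space w p" "y \<in> seq.span S" for x y
    using that F.V_span[OF assms] by (intro garling_norm_nonneg F.V_diff) auto
  have "(\<forall>e>0. \<exists>y\<in>seq.span S. gnm (y - x) < e) \<longleftrightarrow> (\<forall>e>0. \<exists>y\<in>seq.span S. garling_norm w p (y - x) < e)"
    if x: "x \<in> garling_space w p" for x
  proof (intro iffI allI impI)
    fix e :: real assume e: "0 < e" and "\<forall>e>0. \<exists>y\<in>seq.span S. gnm (y - x) < e"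
    moreover have "0 < e powr min 1 p" using e by simp
    ultimately obtain y where y: "y \<in> seq.span S" "gnm (y - x) < e powr min 1 p" by blast
    have "garling_norm w p (y - x) < e"
    proof (rule ccontr)
      assume "\<not> ?thesis"
      then have "e powr min 1 p \<le> gnm (y - x)" unfolding gnm_def using e r by (intro powr_mono2) auto
      then show False using y by simp
    qed
    then show "\<exists>y\<in>seq.span S. garling_norm w p (y - x) < e" using y by blast
  next
    fix e :: real assume e: "0 < e" and "\<forall>e>0. \<exists>y\<in>seq.span S. garling_norm w p (y - x) < e"
    moreover have "0 < e powr (1 / min 1 p)" using e by simp
    ultimately obtain y where y: "y \<in> seq.span S" "garling_norm w p (y - x) < e powr (1 / min 1 p)" by blast
    have "gnm (y - x) < (e powr (1 / min 1 p)) powr min 1 p"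
      unfolding gnm_def using y nn[OF x y(1)] r by (intro powr_less_mono2) auto
    also have "\<dots> = e" using e r by (simp add: powr_powr)
    finally show "\<exists>y\<in>seq.span S. gnm (y - x) < e" using y by blast
  qed
  then show ?thesis unfolding closed_span_def by blast
qed

lemma symmetric_basic_sequence_gnm:
  fixes B :: "nat \<Rightarrow> nat \<Rightarrow> 'a::{real_normed_field, heine_borel}"
  assumes "symmetric_basic_sequence (garling_space w p) (garling_norm w p) B"
  shows "symmetric_basic_sequence (garling_space w p) gnm B"
proof -
  have B: "range B \<subseteq> garling_space w p" using assms by (simp add: symmetric_basic_sequence_def basic_sequence_def)
  have c: "series_converges_to (garling_space w p) gnm B = series_converges_to (garling_space w p) (garling_norm w p) B"
    "\<And>\<pi>. series_converges_to (garling_space w p) gnm (B \<circ> \<pi>) = series_converges_to (garling_space w p) (garling_norm w p) (B \<circ> \<pi>)"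
    by (rule series_converges_to_gnm, use B in auto)+
  show ?thesis
    using assms unfolding symmetric_basic_sequence_def basic_sequence_def schauder_basis_of_def
      equivalent_sequences_def series_converges_def c closed_span_gnm[OF B] .
qed

end

section \<open>The unit vector basis of the space of p-summable sequences\<close>

lemma sum_unit_vectors: "(\<Sum>j<n. seq_scale (a j) (unit_vectors j)) k = (if k < n then a k else (0 :: 'a::real_normed_field))"
proof -
  have "(\<Sum>j<n. seq_scale (a j) (unit_vectors j)) k = (\<Sum>j<n. a j * (if k = j then 1 else 0))"
    by (induction n) (auto simp: seq_scale_def unit_vectors_def)
  then show ?thesis by (simp add: if_distrib sum.delta' cong: if_cong)
qed

text \<open>The quasi-norm dominates every coordinate, so a limit of the partial sums can only be
  \<open>a\<close>; conversely the error of a partial sum is a tail of a convergent series.\<close>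

lemma lp_unit_vectors_converges_iff:
  fixes a :: "nat \<Rightarrow> 'a::real_normed_field"
  assumes p: "0 < p"
  shows "series_converges (lp_space p) (lp_norm p) unit_vectors a \<longleftrightarrow> summable (\<lambda>j. norm (a j) powr p)"
proof
  define S where "S n = (\<Sum>j<n. seq_scale (a j) (unit_vectors j))" for n
  have Sk: "S n k = (if k < n then a k else 0)" for n k unfolding S_def by (rule sum_unit_vectors)
  {
    assume "series_converges (lp_space p) (lp_norm p) unit_vectors a"
    then obtain x where x: "summable (\<lambda>j. norm (x j) powr p)" "(\<lambda>n. lp_norm p (S n - x)) \<longlonglongrightarrow> 0"
      by (auto simp: series_converges_def series_converges_to_def lp_space_def S_def)
    \<comment> \<open>From index \<open>n\<close> on, the difference is \<open>- x\<close>.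
      Summability has to be known before \<open>suminf\<close> can be compared with single
      terms.\<close>
    have s: "summable (\<lambda>k. norm ((S n - x) k) powr p)" for n
      by (rule summable_cong[THEN iffD2, OF _ x(1)]) (auto simp: eventually_sequentially Sk intro!: exI[of _ n])
    have le: "norm ((S n - x) k) \<le> lp_norm p (S n - x)" for n k
    proof -
      have "norm ((S n - x) k) powr p \<le> (\<Sum>k. norm ((S n - x) k) powr p)"
        using sum_le_suminf[OF s[of n], of "{k}"] by simp
      then have "(norm ((S n - x) k) powr p) powr (1 / p) \<le> lp_norm p (S n - x)"
        unfolding lp_norm_def using p by (intro powr_mono2) auto
      then show ?thesis using p by (simp add: powr_powr)
    qed
    have "a k = x k" for k
    proof -
      have "norm (a k - x k) \<le> 0"
      proof (rule tendsto_lowerbound[OF x(2)])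
        show "\<forall>\<^sub>F n in sequentially. norm (a k - x k) \<le> lp_norm p (S n - x)"
          unfolding eventually_sequentially
        proof (intro exI allI impI)
          fix n assume "Suc k \<le> n"
          then show "norm (a k - x k) \<le> lp_norm p (S n - x)" using le[of n k] by (simp add: Sk)
        qed
      qed simp
      then show ?thesis by simp
    qed
    then show "summable (\<lambda>j. norm (a j) powr p)" using x(1) by simp
  }
  assume s: "summable (\<lambda>j. norm (a j) powr p)"
  have eq: "lp_norm p (S n - a) = (\<Sum>j. norm (a (j + n)) powr p) powr (1 / p)" for n
  proof -
    have "norm ((S n - a) k) powr p = (if k < n then 0 else norm (a k) powr p)" for k
      using p by (simp add: Sk)
    moreover have sm: "summable (\<lambda>k. if k < n then 0 else norm (a k) powr p)"
      by (rule summable_cong[THEN iffD2, OF _ s]) (auto simp: eventually_sequentially intro!: exI[of _ n])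
    moreover have "(\<Sum>k. if k < n then 0 else norm (a k) powr p) = (\<Sum>j. norm (a (j + n)) powr p)"
      by (subst suminf_split_initial_segment[OF sm, of n]) simp
    ultimately show ?thesis by (simp add: lp_norm_def)
  qed
  have "(\<lambda>n. \<Sum>j. norm (a (j + n)) powr p) \<longlonglongrightarrow> 0" by (rule suminf_exist_split2[OF s])
  then have "(\<lambda>n. (\<Sum>j. norm (a (j + n)) powr p) powr (1 / p)) \<longlonglongrightarrow> 0"
    using p summable_ignore_initial_segment[OF s] by (subst tendsto_zero_powr_iff) (auto intro!: suminf_nonneg)
  then have "series_converges_to (lp_space p) (lp_norm p) unit_vectors a a"
    using s by (simp add: series_converges_to_def lp_space_def eq[unfolded S_def])
  then show "series_converges (lp_space p) (lp_norm p) unit_vectors a" by (auto simp: series_converges_def)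
qed

theorem theorem3p17:
  fixes p :: real and w :: "nat \<Rightarrow> real"
    and B :: "nat \<Rightarrow> nat \<Rightarrow> 'a::{real_normed_field, heine_borel}"
  assumes "0 < p"
    and "w \<in> garling_weights"
    and "symmetric_basic_sequence (garling_space w p) (garling_norm w p) B"
  shows "equivalent_sequences (garling_space w p) (garling_norm w p) B
           (lp_space p) (lp_norm p) unit_vectors"
proof -
  have abs_w: "(\<lambda>j. \<bar>w j\<bar>) = w" using assms(2) by (auto simp: garling_weights_def fun_eq_iff less_imp_le)
  interpret garling w p
    using assms(1,2) by unfold_locales (auto simp: garling_weights_def abs_w)
  interpret garling_symmetric w p B
    by unfold_locales (rule symmetric_basic_sequence_gnm[OF assms(3)])
  have "series_converges (garling_space w p) (garling_norm w p) B a \<longleftrightarrow>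
      series_converges (garling_space w p) gnm B a" for a
    unfolding series_converges_def series_converges_to_gnm[of B, OF B_in] ..
  then show ?thesis
    unfolding equivalent_sequences_def by (simp add: converges_iff lp_unit_vectors_converges_iff[OF assms(1)])
qed

end
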